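(* Assume $a$ is (WD) or (SD) and let $y$ be a mild solution of $$\begin{cases} y_{tt}(t,x)+(ay_{xx})_{xx}(t,x)=0, & (t,x)\in(0,+\infty)\times(0,1),\\ y(t,0)=y(t,1)=y_x(t,1)=0, & t>0,\\ y_x(t,0)=0\text{ if }a\text{ is (WD)},\quad(ay_{xx})(t,0)=0\text{ if }a\text{ is (SD)}, & t>0,\\ y(0,x)=y_T^0(x),\ y_t(0,x)=y_T^1(x), & x\in(0,1).\end{cases}$$ Then the energy $E_y(t):=\frac12\int_0^1\left(y_t^2(t,x)+a(x)y_{xx}^2(t,x)\right)dx$ satisfies $$E_y(t)=E_y(0)\qquad\forall\,t\ge0.$$
   Context: Degeneracy. $a$ is weakly degenerate (WD) if $a\in C[0,1]\cap C^1(0,1]$, $a(0)=0$, $a>0$ on $(0,1]$ and $K:=\sup_{x\in(0,1]}\frac{x|a'(x)|}{a(x)}\in(0,1)$; $a$ is strongly degenerate (SD) if $a\in C^1[0,1]$, $a(0)=0$, $a>0$ on $(0,1]$ and $K\in[1,2)$. Spaces. If $a$ is (WD), $H^2_{a,0}(0,1)$ is the set of $u\in H^1_0(0,1)$ with $u'$ absolutely continuous on $[0,1]$, $u'(0)=u'(1)=0$, $\sqrt a u''\in L^2(0,1)$. If $a$ is (SD), it is the set of $u\in H^1_0(0,1)$ with $u'$ locally absolutely continuous on $(0,1]$, $u'(1)=0$, $\sqrt a u''\in L^2(0,1)$. $\mathcal H_0:=H^2_{a,0}(0,1)\times L^2(0,1)$ with $\|(u,v)\|^2_{\mathcal H_0}=\int_0^1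 a(u'')^2dx+\int_0^1v^2dx$. $D(A)$ is the set of $u\in H^2_{a,0}(0,1)$ with $au''\in H^2(0,1)$ and, if $a$ is (SD), $(au'')(0)=0$; $Au:=(au'')''$; $\mathcal A(u,v):=(v,-Au)$ on $D(\mathcal A):=D(A)\times H^2_{a,0}(0,1)$ generates a contraction semigroup $(T(t))_{t\ge0}$ on $\mathcal H_0$. The mild solution with data $(y_T^0,y_T^1)\in\mathcal H_0$ is the first component of $(y(t),y_t(t))=T(t)(y_T^0,y_T^1)$. *)

theory Defs
  imports "HOL-Analysis.Analysis"
begin

section \<open>Derivatives and absolute continuity on the unit interval\<close>

text \<open>All functions on [0,1] are total functions on the reals of which only the restriction
  to [0,1] matters: the derivative is relative to [0,1], hence one-sided at 0 and 1.
  It is only meaningful at points of differentiability.\<close>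

definition deriv01 :: "(real \<Rightarrow> real) \<Rightarrow> real \<Rightarrow> real" where
  "deriv01 u x = vector_derivative u (at x within {0..1})"

abbreviation deriv2_01 :: "(real \<Rightarrow> real) \<Rightarrow> real \<Rightarrow> real" where
  "deriv2_01 u \<equiv> deriv01 (deriv01 u)"

definition diff01_on :: "real set \<Rightarrow> (real \<Rightarrow> real) \<Rightarrow> bool" where
  "diff01_on S u \<longleftrightarrow> (\<forall>x\<in>S. u differentiable (at x within {0..1}))"

definition abs_cont_on :: "real \<Rightarrow> real \<Rightarrow> (real \<Rightarrow> real) \<Rightarrow> bool" where
  "abs_cont_on c d f \<longleftrightarrow>
     (\<forall>\<epsilon>>0. \<exists>\<delta>>0. \<forall>P :: (real \<times> real) set.
        finite P \<and> (\<forall>(l, r)\<in>P. c \<le> l \<and> l \<le> r \<and> r \<le> d) \<and>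
        disjoint_family_on (\<lambda>(l, r). {l<..<r}) P \<and> (\<Sum>(l, r)\<in>P. r - l) < \<delta>
        \<longrightarrow> (\<Sum>(l, r)\<in>P. \<bar>f r - f l\<bar>) < \<epsilon>)"

section \<open>Degenerate coefficients\<close>

text \<open>The supremum is taken in the extended reals, so that it is infinite when the quotient
  is unbounded.\<close>

definition degeneracy_K :: "(real \<Rightarrow> real) \<Rightarrow> ereal" where
  "degeneracy_K a = (SUP x\<in>{0<..1}. ereal (x * \<bar>deriv01 a x\<bar> / a x))"

definition weakly_degenerate :: "(real \<Rightarrow> real) \<Rightarrow> bool" where
  "weakly_degenerate a \<longleftrightarrow>
     continuous_on {0..1} a \<and>
     diff01_on {0<..1} a \<and> continuous_on {0<..1} (deriv01 a) \<and>
     a 0 = 0 \<and> (\<forall>x\<in>{0<..1}. a x > 0) \<and>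
     0 < degeneracy_K a \<and> degeneracy_K a < 1"

definition strongly_degenerate :: "(real \<Rightarrow> real) \<Rightarrow> bool" where
  "strongly_degenerate a \<longleftrightarrow>
     diff01_on {0..1} a \<and> continuous_on {0..1} (deriv01 a) \<and>
     a 0 = 0 \<and> (\<forall>x\<in>{0<..1}. a x > 0) \<and>
     1 \<le> degeneracy_K a \<and> degeneracy_K a < 2"

section \<open>Function spaces\<close>

abbreviation leb01 :: "real measure" where
  "leb01 \<equiv> lebesgue_on {0<..<1}"

text \<open>Elements of the Lebesgue space are represented by square-integrable functions, identified
  when they agree almost everywhere; elements of Sobolev spaces by their absolutely
  continuous representatives on [0,1].\<close>

definition L2_01 :: "(real \<Rightarrow> real) set" where
  "L2_01 = {v. v \<in> borel_measurable leb01 \<and> integrable leb01 (\<lambda>x. (v x)\<^sup>2)}"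

definition H1_01 :: "(real \<Rightarrow> real) set" where
  "H1_01 = {u. abs_cont_on 0 1 u \<and> deriv01 u \<in> L2_01}"

definition H10_01 :: "(real \<Rightarrow> real) set" where
  "H10_01 = {u \<in> H1_01. u 0 = 0 \<and> u 1 = 0}"

definition H2_01 :: "(real \<Rightarrow> real) set" where
  "H2_01 = {u \<in> H1_01. diff01_on {0..1} u \<and> deriv01 u \<in> H1_01}"

definition H2a0_wd :: "(real \<Rightarrow> real) \<Rightarrow> (real \<Rightarrow> real) set" where
  "H2a0_wd a = {u \<in> H10_01.
     diff01_on {0..1} u \<and> abs_cont_on 0 1 (deriv01 u) \<and>
     deriv01 u 0 = 0 \<and> deriv01 u 1 = 0 \<and>
     (\<lambda>x. sqrt (a x) * deriv2_01 u x) \<in> L2_01}"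

definition H2a0_sd :: "(real \<Rightarrow> real) \<Rightarrow> (real \<Rightarrow> real) set" where
  "H2a0_sd a = {u \<in> H10_01.
     diff01_on {0<..1} u \<and> (\<forall>c\<in>{0<..<1}. abs_cont_on c 1 (deriv01 u)) \<and>
     deriv01 u 1 = 0 \<and>
     (\<lambda>x. sqrt (a x) * deriv2_01 u x) \<in> L2_01}"

text \<open>Only used for coefficients that are weakly or strongly degenerate (these exclude each other).\<close>

definition H2a0 :: "(real \<Rightarrow> real) \<Rightarrow> (real \<Rightarrow> real) set" where
  "H2a0 a = (if weakly_degenerate a then H2a0_wd a else H2a0_sd a)"

section \<open>The beam operator\<close>

text \<open>The product of the coefficient with the second derivative is only determined almost
  everywhere, so its membership in the Sobolev space, its value at 0 and its derivatives
  refer to its regular representative, which is unique on [0,1].\<close>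

definition H2_rep :: "(real \<Rightarrow> real) \<Rightarrow> (real \<Rightarrow> real) \<Rightarrow> bool" where
  "H2_rep f p \<longleftrightarrow> p \<in> H2_01 \<and> (AE x in leb01. p x = f x)"

definition flux :: "(real \<Rightarrow> real) \<Rightarrow> (real \<Rightarrow> real) \<Rightarrow> real \<Rightarrow> real" where
  "flux a u = (SOME p. H2_rep (\<lambda>x. a x * deriv2_01 u x) p)"

definition domA :: "(real \<Rightarrow> real) \<Rightarrow> (real \<Rightarrow> real) set" where
  "domA a = {u \<in> H2a0 a. (\<exists>p. H2_rep (\<lambda>x. a x * deriv2_01 u x) p) \<and>
                         (strongly_degenerate a \<longrightarrow> flux a u 0 = 0)}"

definition opA :: "(real \<Rightarrow> real) \<Rightarrow> (real \<Rightarrow> real) \<Rightarrow> real \<Rightarrow> real" where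
  "opA a u = deriv2_01 (flux a u)"

section \<open>The energy space and the first-order system\<close>

type_synonym state = "(real \<Rightarrow> real) \<times> (real \<Rightarrow> real)"

definition H0 :: "(real \<Rightarrow> real) \<Rightarrow> state set" where
  "H0 a = H2a0 a \<times> L2_01"

definition H0_norm :: "(real \<Rightarrow> real) \<Rightarrow> state \<Rightarrow> real" where
  "H0_norm a U = sqrt ((LINT x|leb01. a x * (deriv2_01 (fst U) x)\<^sup>2) + (LINT x|leb01. (snd U x)\<^sup>2))"

text \<open>Equality in the energy space.\<close>

definition state_eq :: "state \<Rightarrow> state \<Rightarrow> bool" (infix "\<approx>" 50) where
  "U \<approx> V \<longleftrightarrow> (\<forall>x\<in>{0..1}. fst U x = fst V x) \<and> (AE x in leb01. snd U x = snd V x)"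

definition lincomb :: "real \<Rightarrow> state \<Rightarrow> real \<Rightarrow> state \<Rightarrow> state" where
  "lincomb \<alpha> U \<beta> V =
     (\<lambda>x. \<alpha> * fst U x + \<beta> * fst V x, \<lambda>x. \<alpha> * snd U x + \<beta> * snd V x)"

definition state_diff :: "state \<Rightarrow> state \<Rightarrow> state" where
  "state_diff U V = lincomb 1 U (-1) V"

definition dom_calA :: "(real \<Rightarrow> real) \<Rightarrow> state set" where
  "dom_calA a = domA a \<times> H2a0 a"

definition calA :: "(real \<Rightarrow> real) \<Rightarrow> state \<Rightarrow> state" where
  "calA a U = (snd U, \<lambda>x. - opA a (fst U) x)"

section \<open>Contraction semigroups and mild solutions\<close>

definition contraction_semigroup :: "(real \<Rightarrow> real) \<Rightarrow> (real \<Rightarrow> state \<Rightarrow> state) \<Rightarrow> bool" where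
  "contraction_semigroup a T \<longleftrightarrow>
     (\<forall>t\<ge>0. \<forall>U\<in>H0 a. T t U \<in> H0 a) \<and>
     (\<forall>t\<ge>0. \<forall>U\<in>H0 a. \<forall>V\<in>H0 a. U \<approx> V \<longrightarrow> T t U \<approx> T t V) \<and>
     (\<forall>t\<ge>0. \<forall>U\<in>H0 a. \<forall>V\<in>H0 a. \<forall>\<alpha> \<beta>.
        T t (lincomb \<alpha> U \<beta> V) \<approx> lincomb \<alpha> (T t U) \<beta> (T t V)) \<and>
     (\<forall>U\<in>H0 a. T 0 U \<approx> U) \<and>
     (\<forall>s\<ge>0. \<forall>t\<ge>0. \<forall>U\<in>H0 a. T (s + t) U \<approx> T s (T t U)) \<and>
     (\<forall>U\<in>H0 a. ((\<lambda>t. H0_norm a (state_diff (T t U) U)) \<longlongrightarrow> 0) (at_right 0)) \<and>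
     (\<forall>t\<ge>0. \<forall>U\<in>H0 a. H0_norm a (T t U) \<le> H0_norm a U)"

definition generator_limit ::
  "(real \<Rightarrow> real) \<Rightarrow> (real \<Rightarrow> state \<Rightarrow> state) \<Rightarrow> state \<Rightarrow> state \<Rightarrow> bool" where
  "generator_limit a T U V \<longleftrightarrow>
     ((\<lambda>h. H0_norm a (state_diff (lincomb (1 / h) (T h U) (- (1 / h)) U) V)) \<longlongrightarrow> 0) (at_right 0)"

text \<open>The graph of the infinitesimal generator of the semigroup is the graph of
  the operator; both are graphs of operators on classes modulo \<open>\<approx>\<close>.\<close>

definition generated_by_calA :: "(real \<Rightarrow> real) \<Rightarrow> (real \<Rightarrow> state \<Rightarrow> state) \<Rightarrow> bool" where
  "generated_by_calA a T \<longleftrightarrow>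
     (\<forall>U\<in>H0 a. \<forall>V\<in>H0 a.
        generator_limit a T U V \<longleftrightarrow> (\<exists>U'\<in>dom_calA a. U \<approx> U' \<and> V \<approx> calA a U'))"

text \<open>The second component of the orbit plays the role of the time derivative of the solution.\<close>

definition mild_solution ::
  "(real \<Rightarrow> state \<Rightarrow> state) \<Rightarrow> (real \<Rightarrow> real) \<Rightarrow> (real \<Rightarrow> real) \<Rightarrow>
   (real \<Rightarrow> real \<Rightarrow> real) \<Rightarrow> (real \<Rightarrow> real \<Rightarrow> real) \<Rightarrow> bool" where
  "mild_solution T y0 y1 y yt \<longleftrightarrow> (\<forall>t\<ge>0. (y t, yt t) \<approx> T t (y0, y1))"

definition energy ::
  "(real \<Rightarrow> real) \<Rightarrow> (real \<Rightarrow> real \<Rightarrow> real) \<Rightarrow> (real \<Rightarrow> real \<Rightarrow> real) \<Rightarrow> real \<Rightarrow> real" where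
  "energy a y yt t = 1 / 2 * (LINT x|leb01. (yt t x)\<^sup>2 + a x * (deriv2_01 (y t) x)\<^sup>2)"

end

theory Submission
  imports Defs
begin

text \<open>The generator is skew symmetric: two integrations by parts, in which the boundary conditions
  and the square integrability of \<open>u'\<close> kill all boundary terms. Hence along an orbit that starts in its
  domain, a time step \<open>h\<close> changes the energy by \<open>o(h)\<close> uniformly, so the energy is constant. The
  contractivity of the semigroup extends this to all data, because the domain is dense: cut off
  \<open>u''\<close> near the endpoints, approximate it by \<open>p / a\<close> with \<open>p\<close> twice continuously differentiable and compactly
  supported, and correct the moments so that integrating twice restores the boundary
  conditions. The integrations by parts rest on the fundamental theorem of calculus for absolutely
  continuous functions, obtained from the Jordan decomposition, the Radon-Nikodym theorem for
  Stieltjes measures and the Lebesgue differentiation theorem.\<close>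

section \<open>Absolutely continuous functions\<close>

text \<open>The semigroup is accessible only through a graph relation modulo
  \<open>\<approx>\<close> and forward difference quotients in the energy norm. Skew symmetry
  therefore acts on the expansion of the squared norm over one step: the first-order cross term
  vanishes, and what is left is bounded by a residual that \<open>T t\<close> cannot enlarge.
  Summing equal steps then avoids differentiating the energy in time. Density is delicate because
  \<open>a\<close> vanishes at 0, where \<open>u'\<close> may even be unbounded in the strongly
  degenerate case. Hence the flux \<open>p\<close> is prescribed instead of \<open>u\<close>: since
  \<open>p\<close> vanishes near the endpoints, \<open>p / a\<close> is continuous, \<open>p\<close>
  itself is the regular representative, and the flux condition at 0 holds. Integrating
  \<open>p / a\<close> twice from 1 gives both conditions at 1. The conditions
  \<open>u 0 = 0\<close> and \<open>u' 0 = 0\<close> become the vanishing of the integrals of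
  \<open>x u''\<close> and \<open>u''\<close>; the latter is imposed only in the weakly degenerate
  case. Derivatives are total functions with arbitrary values where differentiability fails, so
  identities for \<open>u''\<close> hold almost everywhere only, and the fundamental theorem must be
  available for \<open>deriv01\<close> itself.\<close>

definition subints :: "real \<Rightarrow> real \<Rightarrow> (real \<times> real) set \<Rightarrow> bool" where
  "subints c d P \<longleftrightarrow> finite P \<and> (\<forall>p\<in>P. c \<le> fst p \<and> fst p < snd p \<and> snd p \<le> d) \<and>
     (\<forall>p\<in>P. \<forall>q\<in>P. p \<noteq> q \<longrightarrow> snd p \<le> fst q \<or> snd q \<le> fst p)"

text \<open>Signed increments, because their supremum over families is the positive variation.
  \<open>incr id P\<close> is the total length of the family.\<close>

definition incr :: "(real \<Rightarrow> real) \<Rightarrow> (real \<times> real) set \<Rightarrow> real" where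
  "incr f P = (\<Sum>p\<in>P. f (snd p) - f (fst p))"

text \<open>One-sided, without absolute values: for nondecreasing functions, the only ones to which
  it is finally applied, this is ordinary absolute continuity.\<close>

definition ac_incr :: "real \<Rightarrow> real \<Rightarrow> (real \<Rightarrow> real) \<Rightarrow> bool" where
  "ac_incr c d f \<longleftrightarrow> (\<forall>\<epsilon>>0. \<exists>\<delta>>0. \<forall>P. subints c d P \<and> incr id P < \<delta> \<longrightarrow> incr f P < \<epsilon>)"

lemma subints_empty [simp]: "subints c d {}"
  by (simp add: subints_def)

lemma subints_mono: "subints c d P \<Longrightarrow> c' \<le> c \<Longrightarrow> d \<le> d' \<Longrightarrow> subints c' d' P"
  unfolding subints_def by (meson order_trans)

lemma incr_id_le:
  assumes "subints c d P" "c \<le> d"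
  shows "incr id P \<le> d - c"
proof -
  have fin: "finite P" using assms by (simp add: subints_def)
  let ?A = "\<lambda>p::real \<times> real. {fst p<..<snd p}"
  have "incr id P = (\<Sum>p\<in>P. measure lborel (?A p))"
    unfolding incr_def using assms by (intro sum.cong) (auto simp: subints_def less_imp_le)
  also have "\<dots> = measure lborel (\<Union>p\<in>P. ?A p)"
  proof (rule measure_finite_Union[symmetric])
    show "disjoint_family_on ?A P"
      unfolding disjoint_family_on_def using assms by (fastforce simp: subints_def)
    show "emeasure lborel (?A p) \<noteq> \<infinity>" if "p \<in> P" for p
      using assms that by (auto simp: subints_def less_imp_le)
  qed (auto simp: fin)
  also have "\<dots> \<le> measure lborel {c..d}"
  proof (rule measure_mono_fmeasurable)
    show "(\<Union>p\<in>P. ?A p) \<subseteq> {c..d}" using assms by (force simp: subints_def)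
    show "(\<Union>p\<in>P. ?A p) \<in> sets lborel" using fin by auto
  qed (simp add: fmeasurable_def emeasure_lborel_Icc_eq)
  finally show ?thesis using assms by simp
qed

lemma abs_cont_on_subints:
  assumes "abs_cont_on c d f" "0 < \<epsilon>"
  obtains \<delta> where "0 < \<delta>"
    "\<And>P. subints c d P \<Longrightarrow> incr id P < \<delta> \<Longrightarrow> (\<Sum>p\<in>P. \<bar>f (snd p) - f (fst p)\<bar>) < \<epsilon>"
proof -
  obtain \<delta> where d: "\<delta> > 0" "\<And>P :: (real \<times> real) set.
        finite P \<and> (\<forall>(l, r)\<in>P. c \<le> l \<and> l \<le> r \<and> r \<le> d) \<and>
        disjoint_family_on (\<lambda>(l, r). {l<..<r}) P \<and> (\<Sum>(l, r)\<in>P. r - l) < \<delta>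
        \<Longrightarrow> (\<Sum>(l, r)\<in>P. \<bar>f r - f l\<bar>) < \<epsilon>"
    using assms unfolding abs_cont_on_def by blast
  have "(\<Sum>p\<in>P. \<bar>f (snd p) - f (fst p)\<bar>) < \<epsilon>" if P: "subints c d P" "incr id P < \<delta>" for P
  proof -
    have "disjoint_family_on (\<lambda>(l, r). {l<..<r}) P"
      unfolding disjoint_family_on_def using P(1) by (fastforce simp: subints_def)
    then have "(\<Sum>(l, r)\<in>P. \<bar>f r - f l\<bar>) < \<epsilon>"
      using P by (intro d(2)) (force simp: subints_def incr_def case_prod_unfold less_imp_le)
    then show ?thesis by (simp add: case_prod_unfold)
  qed
  then show thesis using d(1) that by blast
qed

lemma abs_cont_on_ac_incr: "abs_cont_on c d f \<Longrightarrow> ac_incr c d f"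
  unfolding ac_incr_def
proof (intro allI impI)
  fix \<epsilon> :: real assume "abs_cont_on c d f" "0 < \<epsilon>"
  then obtain \<delta> where \<delta>: "0 < \<delta>"
    "\<And>P. subints c d P \<Longrightarrow> incr id P < \<delta> \<Longrightarrow> (\<Sum>p\<in>P. \<bar>f (snd p) - f (fst p)\<bar>) < \<epsilon>"
    using abs_cont_on_subints by blast
  have "incr f P \<le> (\<Sum>p\<in>P. \<bar>f (snd p) - f (fst p)\<bar>)" for P
    unfolding incr_def by (intro sum_mono) auto
  then show "\<exists>\<delta>>0. \<forall>P. subints c d P \<and> incr id P < \<delta> \<longrightarrow> incr f P < \<epsilon>"
    using \<delta> by (meson le_less_trans)
qed

text \<open>The common source of the closure properties: linear combinations, products, Lipschitz
  functions and functions equal on the interval all satisfy such an increment bound. The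
  \<open>M + 1\<close> in \<open>\<eta>\<close> covers \<open>M = 0\<close>.\<close>

lemma abs_cont_on_bound2:
  fixes h :: "real \<Rightarrow> real"
  assumes "abs_cont_on c d f" "abs_cont_on c d g" "0 \<le> M"
    and bd: "\<And>x y. c \<le> x \<Longrightarrow> x \<le> y \<Longrightarrow> y \<le> d \<Longrightarrow> \<bar>h y - h x\<bar> \<le> M * \<bar>f y - f x\<bar> + M * \<bar>g y - g x\<bar>"
  shows "abs_cont_on c d h"
  unfolding abs_cont_on_def
proof (intro allI impI)
  fix \<epsilon> :: real assume "0 < \<epsilon>"
  define \<eta> where "\<eta> = \<epsilon> / (2 * (M + 1))"
  have "\<eta> > 0" using \<open>0 < \<epsilon>\<close> assms by (simp add: \<eta>_def)
  obtain \<delta>1 where d1: "\<delta>1 > 0" "\<forall>P. finite P \<and> (\<forall>(l, r)\<in>P. c \<le> l \<and> l \<le> r \<and> r \<le> d) \<and>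
     disjoint_family_on (\<lambda>(l, r). {l<..<r}) P \<and> (\<Sum>(l, r)\<in>P. r - l) < \<delta>1 \<longrightarrow> (\<Sum>(l, r)\<in>P. \<bar>f r - f l\<bar>) < \<eta>"
    using assms(1) \<open>\<eta> > 0\<close> unfolding abs_cont_on_def by blast
  obtain \<delta>2 where d2: "\<delta>2 > 0" "\<forall>P. finite P \<and> (\<forall>(l, r)\<in>P. c \<le> l \<and> l \<le> r \<and> r \<le> d) \<and>
     disjoint_family_on (\<lambda>(l, r). {l<..<r}) P \<and> (\<Sum>(l, r)\<in>P. r - l) < \<delta>2 \<longrightarrow> (\<Sum>(l, r)\<in>P. \<bar>g r - g l\<bar>) < \<eta>"
    using assms(2) \<open>\<eta> > 0\<close> unfolding abs_cont_on_def by blast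
  show "\<exists>\<delta>>0. \<forall>P. finite P \<and> (\<forall>(l, r)\<in>P. c \<le> l \<and> l \<le> r \<and> r \<le> d) \<and> disjoint_family_on (\<lambda>(l, r). {l<..<r}) P \<and> (\<Sum>(l, r)\<in>P. r - l) < \<delta> \<longrightarrow> (\<Sum>(l, r)\<in>P. \<bar>h r - h l\<bar>) < \<epsilon>"
  proof (rule exI[of _ "min \<delta>1 \<delta>2"], intro conjI allI impI)
    show "0 < min \<delta>1 \<delta>2" using d1 d2 by simp
    fix P :: "(real \<times> real) set"
    assume P: "finite P \<and> (\<forall>(l, r)\<in>P. c \<le> l \<and> l \<le> r \<and> r \<le> d) \<and> disjoint_family_on (\<lambda>(l, r). {l<..<r}) P \<and> (\<Sum>(l, r)\<in>P. r - l) < min \<delta>1 \<delta>2"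
    have F: "(\<Sum>(l, r)\<in>P. \<bar>f r - f l\<bar>) < \<eta>" by (rule d1(2)[rule_format]) (use P in simp)
    have G: "(\<Sum>(l, r)\<in>P. \<bar>g r - g l\<bar>) < \<eta>" by (rule d2(2)[rule_format]) (use P in simp)
    have "(\<Sum>(l, r)\<in>P. \<bar>h r - h l\<bar>) \<le> (\<Sum>(l, r)\<in>P. M * \<bar>f r - f l\<bar> + M * \<bar>g r - g l\<bar>)"
      using P bd by (intro sum_mono) auto
    also have "\<dots> = M * (\<Sum>(l, r)\<in>P. \<bar>f r - f l\<bar>) + M * (\<Sum>(l, r)\<in>P. \<bar>g r - g l\<bar>)"
      by (simp add: sum.distrib sum_distrib_left case_prod_unfold)
    also have "\<dots> \<le> M * \<eta> + M * \<eta>"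
      using F G assms(3) by (intro add_mono mult_left_mono) auto
    also have "\<dots> < 2 * (M + 1) * \<eta>" using \<open>\<eta> > 0\<close> by (simp add: algebra_simps)
    also have "\<dots> = \<epsilon>" using assms(3) by (simp add: \<eta>_def)
    finally show "(\<Sum>(l, r)\<in>P. \<bar>h r - h l\<bar>) < \<epsilon>" .
  qed
qed

lemma abs_cont_on_imp_continuous:
  assumes "abs_cont_on c d f"
  shows "continuous_on {c..d} f"
  unfolding continuous_on_iff
proof (intro ballI allI impI)
  fix x \<epsilon> :: real assume x: "x \<in> {c..d}" and "0 < \<epsilon>"
  obtain \<delta> where \<delta>: "0 < \<delta>"
    "\<And>P. subints c d P \<Longrightarrow> incr id P < \<delta> \<Longrightarrow> (\<Sum>p\<in>P. \<bar>f (snd p) - f (fst p)\<bar>) < \<epsilon>"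
    using abs_cont_on_subints[OF assms \<open>0 < \<epsilon>\<close>] by blast
  have "dist (f y) (f x) < \<epsilon>" if "y \<in> {c..d}" "dist y x < \<delta>" for y
  proof (cases "y = x")
    case False
    then show ?thesis
      using \<delta>(2)[of "{(min x y, max x y)}"] x that
      by (cases "x < y") (auto simp: subints_def incr_def dist_real_def abs_minus_commute)
  qed (use \<open>0 < \<epsilon>\<close> in simp)
  then show "\<exists>\<delta>>0. \<forall>y\<in>{c..d}. dist y x < \<delta> \<longrightarrow> dist (f y) (f x) < \<epsilon>"
    using \<delta>(1) by blast
qed

lemma abs_cont_on_subset:
  assumes "abs_cont_on c d f" "c \<le> c'" "d' \<le> d"
  shows "abs_cont_on c' d' f"
  unfolding abs_cont_on_def
proof (intro allI impI)
  fix \<epsilon> :: real assume "0 < \<epsilon>"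
  then obtain \<delta> where \<delta>: "\<delta> > 0" "\<And>P :: (real \<times> real) set.
        finite P \<and> (\<forall>(l, r)\<in>P. c \<le> l \<and> l \<le> r \<and> r \<le> d) \<and>
        disjoint_family_on (\<lambda>(l, r). {l<..<r}) P \<and> (\<Sum>(l, r)\<in>P. r - l) < \<delta>
        \<Longrightarrow> (\<Sum>(l, r)\<in>P. \<bar>f r - f l\<bar>) < \<epsilon>"
    using assms(1) unfolding abs_cont_on_def by blast
  then show "\<exists>\<delta>>0. \<forall>P. finite P \<and> (\<forall>(l, r)\<in>P. c' \<le> l \<and> l \<le> r \<and> r \<le> d') \<and>
        disjoint_family_on (\<lambda>(l, r). {l<..<r}) P \<and> (\<Sum>(l, r)\<in>P. r - l) < \<delta>
        \<longrightarrow> (\<Sum>(l, r)\<in>P. \<bar>f r - f l\<bar>) < \<epsilon>"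
    using assms(2,3) by (intro exI[of _ \<delta>]) (fastforce intro!: \<delta>(2))
qed

lemma abs_cont_on_lincomb:
  assumes "abs_cont_on c d f" "abs_cont_on c d g"
  shows "abs_cont_on c d (\<lambda>x. \<alpha> * f x + \<beta> * g x)"
proof (rule abs_cont_on_bound2[OF assms, of "\<bar>\<alpha>\<bar> + \<bar>\<beta>\<bar>"])
  fix x y :: real
  have "\<bar>(\<alpha> * f y + \<beta> * g y) - (\<alpha> * f x + \<beta> * g x)\<bar> = \<bar>\<alpha> * (f y - f x) + \<beta> * (g y - g x)\<bar>"
    by (simp add: algebra_simps)
  also have "\<dots> \<le> \<bar>\<alpha>\<bar> * \<bar>f y - f x\<bar> + \<bar>\<beta>\<bar> * \<bar>g y - g x\<bar>"
    by (metis abs_mult abs_triangle_ineq)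
  also have "\<dots> \<le> (\<bar>\<alpha>\<bar> + \<bar>\<beta>\<bar>) * \<bar>f y - f x\<bar> + (\<bar>\<alpha>\<bar> + \<bar>\<beta>\<bar>) * \<bar>g y - g x\<bar>"
    by (intro add_mono mult_right_mono) auto
  finally show "\<bar>(\<alpha> * f y + \<beta> * g y) - (\<alpha> * f x + \<beta> * g x)\<bar> \<le> \<dots>" .
qed auto

lemma abs_cont_on_mult:
  assumes "abs_cont_on c d f" "abs_cont_on c d g"
  shows "abs_cont_on c d (\<lambda>x. f x * g x)"
proof -
  have "bounded (f ` {c..d})" "bounded (g ` {c..d})"
    using assms by (auto intro!: compact_imp_bounded compact_continuous_image abs_cont_on_imp_continuous)
  then obtain A B where AB: "\<And>x. x \<in> {c..d} \<Longrightarrow> \<bar>f x\<bar> \<le> A" "\<And>x. x \<in> {c..d} \<Longrightarrow> \<bar>g x\<bar> \<le> B"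
    by (fastforce simp: bounded_iff)
  show ?thesis
  proof (rule abs_cont_on_bound2[OF assms, of "\<bar>A\<bar> + \<bar>B\<bar>"])
    fix x y assume xy: "c \<le> x" "x \<le> y" "y \<le> d"
    have "\<bar>f y * g y - f x * g x\<bar> = \<bar>g y * (f y - f x) + f x * (g y - g x)\<bar>"
      by (simp add: algebra_simps)
    also have "\<dots> \<le> \<bar>g y\<bar> * \<bar>f y - f x\<bar> + \<bar>f x\<bar> * \<bar>g y - g x\<bar>"
      by (metis abs_mult abs_triangle_ineq)
    also have "\<dots> \<le> (\<bar>A\<bar> + \<bar>B\<bar>) * \<bar>f y - f x\<bar> + (\<bar>A\<bar> + \<bar>B\<bar>) * \<bar>g y - g x\<bar>"
      using AB(1)[of x] AB(2)[of y] xy by (intro add_mono mult_right_mono) auto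
    finally show "\<bar>f y * g y - f x * g x\<bar> \<le> \<dots>" .
  qed auto
qed

lemma abs_cont_on_lipschitz:
  assumes "\<And>x y. c \<le> x \<Longrightarrow> x \<le> y \<Longrightarrow> y \<le> d \<Longrightarrow> \<bar>f y - f x\<bar> \<le> L * (y - x)" "0 \<le> L"
  shows "abs_cont_on c d f"
proof -
  have "abs_cont_on c d (\<lambda>x. x)"
    unfolding abs_cont_on_def
  proof (intro allI impI)
    fix \<epsilon> :: real assume "0 < \<epsilon>"
    have "(\<Sum>(l, r)\<in>P. \<bar>r - l\<bar>) = (\<Sum>(l, r)\<in>P. r - l)" if "\<forall>(l, r)\<in>P. c \<le> l \<and> l \<le> r \<and> r \<le> d" for P
      using that by (intro sum.cong) auto
    then show "\<exists>\<delta>>0. \<forall>P. finite P \<and> (\<forall>(l, r)\<in>P. c \<le> l \<and> l \<le> r \<and> r \<le> d) \<and>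
        disjoint_family_on (\<lambda>(l, r). {l<..<r}) P \<and> (\<Sum>(l, r)\<in>P. r - l) < \<delta>
        \<longrightarrow> (\<Sum>(l, r)\<in>P. \<bar>r - l\<bar>) < \<epsilon>" using \<open>0 < \<epsilon>\<close> by force
  qed
  then show ?thesis
  proof (rule abs_cont_on_bound2[where M = L, of _ _ "\<lambda>x. x" "\<lambda>x. x"])
    show "\<bar>f y - f x\<bar> \<le> L * \<bar>y - x\<bar> + L * \<bar>y - x\<bar>" if "c \<le> x" "x \<le> y" "y \<le> d" for x y
      using assms(1)[OF that] assms(2) that mult_nonneg_nonneg[of L "y - x"] by simp
  qed (use \<open>abs_cont_on c d (\<lambda>x. x)\<close> assms in auto)
qed

section \<open>Positive variation and Jordan decomposition\<close>

text \<open>Intervals that straddle \<open>m\<close> are cut there; the increments telescope across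
  the cut.\<close>

lemma subints_split:
  assumes P: "subints c d P" and m: "c \<le> m" "m \<le> d"
  obtains Q R where "subints c m Q" "subints m d R" "\<And>f. incr f P = incr f Q + incr f R"
proof -
  let ?q = "\<lambda>p::real \<times> real. (fst p, min (snd p) m)" and ?r = "\<lambda>p::real \<times> real. (max (fst p) m, snd p)"
  let ?PQ = "{p \<in> P. fst p < m}" and ?PR = "{p \<in> P. m < snd p}"
  have fin: "finite P" using P by (simp add: subints_def)
  have inj: "inj_on ?q ?PQ" "inj_on ?r ?PR"
    using P by (fastforce simp: inj_on_def subints_def)+
  have "subints c m (?q ` ?PQ)"
    unfolding subints_def using P by (fastforce simp: subints_def)
  moreover have "subints m d (?r ` ?PR)"
    unfolding subints_def using P by (fastforce simp: subints_def)
  moreover have "incr f P = incr f (?q ` ?PQ) + incr f (?r ` ?PR)" for f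
  proof -
    have "incr f P = (\<Sum>p\<in>P. (if fst p < m then f (min (snd p) m) - f (fst p) else 0)
                            + (if m < snd p then f (snd p) - f (max (fst p) m) else 0))"
      unfolding incr_def using P
      by (intro sum.cong) (force simp: subints_def min_def max_def)+
    also have "\<dots> = (\<Sum>p\<in>?PQ. f (min (snd p) m) - f (fst p)) + (\<Sum>p\<in>?PR. f (snd p) - f (max (fst p) m))"
      by (simp add: sum.distrib sum.inter_filter fin)
    also have "\<dots> = incr f (?q ` ?PQ) + incr f (?r ` ?PR)"
      unfolding incr_def by (simp add: sum.reindex inj)
    finally show ?thesis .
  qed
  ultimately show thesis using that by blast
qed

text \<open>The positive variation \<open>posvar f c\<close> yields the Jordan decomposition
  \<open>f x = posvar f c x - (posvar f c x - f x)\<close> into nondecreasing functions; both inherit the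
  absolute continuity of \<open>f\<close>.\<close>

definition posvar :: "(real \<Rightarrow> real) \<Rightarrow> real \<Rightarrow> real \<Rightarrow> real" where
  "posvar f c x = Sup (incr f ` {P. subints c x P})"

text \<open>The interval is covered by finitely many windows so short that a family inside one
  window has increment below 1; the number of windows bounds the total.\<close>

lemma ac_incr_bdd_above:
  assumes ac: "ac_incr c d f"
  shows "bdd_above (incr f ` {P. subints c d P})"
proof -
  obtain \<delta> where \<delta>: "\<delta> > 0" "\<And>P. subints c d P \<Longrightarrow> incr id P < \<delta> \<Longrightarrow> incr f P < 1"
    using ac unfolding ac_incr_def by (metis zero_less_one)
  have step: "incr f P \<le> real k" if "subints c x P" "c \<le> x" "x \<le> d" "x \<le> c + real k * (\<delta>/2)" for k x P
    using that
  proof (induction k arbitrary: x P)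
    case 0
    then have "P = {}" by (force simp: subints_def)
    then show ?case by (simp add: incr_def)
  next
    case (Suc k)
    \<comment> \<open>Windows have length \<open>\<delta>/2\<close> because a family filling one
      must have total length strictly below \<open>\<delta>\<close>. The maximum keeps the last
      window inside the interval.\<close>
    define m where "m = max c (x - \<delta>/2)"
    have m: "c \<le> m" "m \<le> x" "x - m \<le> \<delta>/2" "m \<le> c + real k * (\<delta>/2)"
      using Suc.prems \<delta>(1) unfolding m_def by (auto simp: max_def algebra_simps add_divide_distrib)
    obtain Q R where QR: "subints c m Q" "subints m x R" "\<And>f. incr f P = incr f Q + incr f R"
      using subints_split[OF Suc.prems(1) m(1,2)] by blast
    have "incr f Q \<le> real k"
      using Suc.IH[OF QR(1)] m Suc.prems by simp
    moreover have "incr f R < 1"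
    proof (rule \<delta>(2))
      show "subints c d R" using subints_mono[OF QR(2)] m Suc.prems by auto
      show "incr id R < \<delta>" using incr_id_le[OF QR(2) m(2)] m(3) \<delta>(1) by simp
    qed
    ultimately show ?case using QR(3)[of f] by simp
  qed
  show ?thesis
  proof (cases "c \<le> d")
    case True
    obtain k where "(d - c) / (\<delta>/2) \<le> real k" using real_arch_simple by blast
    then have "d \<le> c + real k * (\<delta>/2)" using \<delta>(1) by (simp add: field_simps)
    then show ?thesis using step[where x=d] True by (intro bdd_aboveI[of _ "real k"]) auto
  next
    case False
    then have "{P. subints c d P} = {{}}" by (force simp: subints_def)
    then show ?thesis by simp
  qed
qed

context
  fixes c d :: real and f :: "real \<Rightarrow> real"
  assumes ac: "abs_cont_on c d f"
begin

lemma posvar_bdd: "c \<le> x \<Longrightarrow> y \<le> d \<Longrightarrow> bdd_above (incr f ` {P. subints x y P})"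
  by (rule bdd_above_mono[OF ac_incr_bdd_above[OF abs_cont_on_ac_incr[OF ac]]])
     (auto intro: subints_mono)

lemma incr_le_posvar: "c \<le> x \<Longrightarrow> y \<le> d \<Longrightarrow> subints x y P \<Longrightarrow> incr f P \<le> posvar f x y"
  unfolding posvar_def by (intro cSup_upper posvar_bdd) auto

lemma posvar_le: "(\<And>P. subints x y P \<Longrightarrow> incr f P \<le> B) \<Longrightarrow> posvar f x y \<le> B"
  unfolding posvar_def by (rule cSup_least) (use subints_empty in blast)+

lemma posvar_mono: "x \<le> y \<Longrightarrow> y \<le> d \<Longrightarrow> posvar f c x \<le> posvar f c y"
  by (rule posvar_le) (meson incr_le_posvar order_refl subints_mono)

text \<open>The interval \<open>(x, y)\<close> can be appended to any family in
  \<open>{c..x}\<close>. This makes \<open>posvar f c - f\<close> nondecreasing.\<close>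

lemma posvar_increment: 
  assumes "c \<le> x" "x \<le> y" "y \<le> d"
  shows "f y - f x \<le> posvar f c y - posvar f c x"
proof (cases "x = y")
  case False
  have "posvar f c x \<le> posvar f c y - (f y - f x)"
  proof (rule posvar_le)
    fix P assume P: "subints c x P"
    then have nin: "(x, y) \<notin> P" and fin: "finite P" using assms False by (force simp: subints_def)+
    have "subints c y (insert (x, y) P)"
      using P assms False by (fastforce simp: subints_def)
    then have "incr f (insert (x, y) P) \<le> posvar f c y"
      using assms by (intro incr_le_posvar) auto
    then show "incr f P \<le> posvar f c y - (f y - f x)" by (simp add: incr_def fin nin)
  qed
  then show ?thesis by simp
qed simp

text \<open>Each family in \<open>{c..y}\<close> is cut at \<open>x\<close>, and the two parts are
  estimated separately.\<close>

lemma posvar_split: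
  assumes "c \<le> x" "x \<le> y" "y \<le> d"
  shows "posvar f c y - posvar f c x \<le> posvar f x y"
proof -
  have "posvar f c y \<le> posvar f c x + posvar f x y"
  proof (rule posvar_le)
    fix P assume "subints c y P"
    then obtain Q R where QR: "subints c x Q" "subints x y R" "\<And>f. incr f P = incr f Q + incr f R"
      using subints_split assms by blast
    then show "incr f P \<le> posvar f c x + posvar f x y"
      using assms by (auto intro!: add_mono incr_le_posvar)
  qed
  then show ?thesis by simp
qed

text \<open>Each interval of a short family is refined by a nearly optimal family for its own
  positive variation. The union of the refinements is no longer than the original family, so the
  condition on \<open>f\<close> applies to it.\<close>

lemma ac_incr_posvar: "ac_incr c d (posvar f c)"
  unfolding ac_incr_def
proof (intro allI impI)
  fix \<epsilon> :: real assume "0 < \<epsilon>"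
  then obtain \<delta> where \<delta>: "\<delta> > 0" "\<And>P. subints c d P \<Longrightarrow> incr id P < \<delta> \<Longrightarrow> incr f P < \<epsilon>/2"
    using abs_cont_on_ac_incr[OF ac] unfolding ac_incr_def by (meson half_gt_zero)
  have "incr (posvar f c) P < \<epsilon>" if P: "subints c d P" "incr id P < \<delta>" for P
  proof -
    have fin: "finite P" using P by (simp add: subints_def)
    have bds: "c \<le> fst p" "fst p < snd p" "snd p \<le> d" if "p \<in> P" for p
      using that P by (auto simp: subints_def)
    \<comment> \<open>The loss allowed per interval: over all of \<open>P\<close> it stays within
      \<open>\<epsilon>/2\<close>, and the added 1 covers empty \<open>P\<close>.\<close>
    define \<eta> where "\<eta> = \<epsilon> / (2 * (real (card P) + 1))"
    have "\<eta> > 0" using \<open>0 < \<epsilon>\<close> by (simp add: \<eta>_def)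
    have "\<exists>Q. subints (fst p) (snd p) Q \<and> posvar f (fst p) (snd p) - \<eta> < incr f Q" if "p \<in> P" for p
    proof (rule ccontr)
      assume "\<not> ?thesis"
      then have "posvar f (fst p) (snd p) \<le> posvar f (fst p) (snd p) - \<eta>"
        by (intro posvar_le) force
      then show False using \<open>\<eta> > 0\<close> by simp
    qed
    then obtain Q where Q: "\<And>p. p \<in> P \<Longrightarrow> subints (fst p) (snd p) (Q p)"
      "\<And>p. p \<in> P \<Longrightarrow> posvar f (fst p) (snd p) - \<eta> < incr f (Q p)" by metis
    have sep: "snd q \<le> fst q' \<or> snd q' \<le> fst q"
      if "p \<in> P" "p' \<in> P" "q \<in> Q p" "q' \<in> Q p'" "p \<noteq> p'" for p p' q q'
    proof -
      have "snd p \<le> fst p' \<or> snd p' \<le> fst p" using that P by (auto simp: subints_def)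
      then show ?thesis using Q(1)[OF that(1)] Q(1)[OF that(2)] that(3,4)
        by (force simp: subints_def)
    qed
    \<comment> \<open>A pair common to both refinements would be separated from itself, which the
      strict inequality \<open>fst p < snd p\<close> in \<open>subints\<close> excludes.\<close>
    have disj: "Q p \<inter> Q p' = {}" if "p \<in> P" "p' \<in> P" "p \<noteq> p'" for p p'
      using sep[OF that(1,2) _ _ that(3)] Q(1)[OF that(1)] by (fastforce simp: subints_def)
    have sumU: "incr g (\<Union>(Q ` P)) = (\<Sum>p\<in>P. incr g (Q p))" for g
      unfolding incr_def using disj fin Q(1)
      by (intro sum.UNION_disjoint) (auto simp: subints_def)
    have sub: "subints c d (\<Union>(Q ` P))"
      unfolding subints_def
    proof (intro conjI ballI impI)
      show "finite (\<Union>(Q ` P))" using fin Q(1) by (auto simp: subints_def)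
    next
      fix q assume "q \<in> \<Union>(Q ` P)"
      then obtain p where "p \<in> P" "q \<in> Q p" by blast
      then show "c \<le> fst q" "fst q < snd q" "snd q \<le> d"
        using Q(1)[of p] bds[of p] by (force simp: subints_def)+
    next
      fix q q' assume "q \<in> \<Union>(Q ` P)" "q' \<in> \<Union>(Q ` P)" "q \<noteq> q'"
      then obtain p p' where p: "p \<in> P" "q \<in> Q p" "p' \<in> P" "q' \<in> Q p'" by blast
      show "snd q \<le> fst q' \<or> snd q' \<le> fst q"
      proof (cases "p = p'")
        case True
        then show ?thesis using Q(1)[OF p(1)] p \<open>q \<noteq> q'\<close> by (auto simp: subints_def)
      next
        case False
        then show ?thesis using sep p by blast
      qed
    qed
    have "incr id (\<Union>(Q ` P)) \<le> (\<Sum>p\<in>P. snd p - fst p)"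
      unfolding sumU using bds Q(1) by (intro sum_mono incr_id_le) (auto simp: less_imp_le)
    also have "\<dots> = incr id P" by (simp add: incr_def)
    finally have "incr f (\<Union>(Q ` P)) < \<epsilon>/2" using P by (intro \<delta>(2) sub) auto
    have "incr (posvar f c) P \<le> (\<Sum>p\<in>P. incr f (Q p) + \<eta>)"
      unfolding incr_def[of "posvar f c"]
    proof (rule sum_mono)
      fix p assume "p \<in> P"
      then show "posvar f c (snd p) - posvar f c (fst p) \<le> incr f (Q p) + \<eta>"
        using posvar_split[of "fst p" "snd p"] bds[of p] Q(2)[of p] by simp
    qed
    also have "\<dots> = incr f (\<Union>(Q ` P)) + real (card P) * \<eta>" by (simp add: sumU sum.distrib)
    also have "\<dots> < \<epsilon>/2 + \<epsilon>/2"
    proof (rule add_less_le_mono)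
      show "real (card P) * \<eta> \<le> \<epsilon>/2" using \<open>0 < \<epsilon>\<close> by (simp add: \<eta>_def field_simps)
    qed fact
    finally show ?thesis by simp
  qed
  then show "\<exists>\<delta>>0. \<forall>P. subints c d P \<and> incr id P < \<delta> \<longrightarrow> incr (posvar f c) P < \<epsilon>"
    using \<delta>(1) by blast
qed

text \<open>For the second component the increments of \<open>f\<close> enter with a minus sign, so
  they have to be bounded in absolute value, as \<open>abs_cont_on\<close> permits.\<close>

lemma abs_cont_on_decompose:
  obtains F G where "mono_on {c..d} F" "ac_incr c d F" "mono_on {c..d} G" "ac_incr c d G" "\<And>x. f x = F x - G x"
proof (rule that)
  let ?F = "posvar f c" and ?G = "\<lambda>x. posvar f c x - f x"
  show "mono_on {c..d} ?F" by (auto simp: mono_on_def intro: posvar_mono)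
  show "mono_on {c..d} ?G"
  proof (rule mono_onI)
    fix r s assume "r \<in> {c..d}" "s \<in> {c..d}" "r \<le> s"
    then show "posvar f c r - f r \<le> posvar f c s - f s" using posvar_increment[of r s] by simp
  qed
  show "ac_incr c d ?F" by (rule ac_incr_posvar)
  show "ac_incr c d ?G"
    unfolding ac_incr_def
  proof (intro allI impI)
    fix \<epsilon> :: real assume "0 < \<epsilon>"
    then obtain \<delta> where \<delta>: "\<delta> > 0" "\<And>P. subints c d P \<Longrightarrow> incr id P < \<delta> \<Longrightarrow> incr ?F P < \<epsilon>/2"
      using ac_incr_posvar half_gt_zero[OF \<open>0 < \<epsilon>\<close>] unfolding ac_incr_def by blast
    obtain \<delta>' where \<delta>': "0 < \<delta>'"
      "\<And>P. subints c d P \<Longrightarrow> incr id P < \<delta>' \<Longrightarrow> (\<Sum>p\<in>P. \<bar>f (snd p) - f (fst p)\<bar>) < \<epsilon>/2"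
      using abs_cont_on_subints[OF ac half_gt_zero[OF \<open>0 < \<epsilon>\<close>]] by blast
    have "incr ?G P < \<epsilon>" if P: "subints c d P" "incr id P < min \<delta> \<delta>'" for P
    proof -
      have "incr ?G P = incr ?F P - (\<Sum>p\<in>P. f (snd p) - f (fst p))"
        by (simp add: incr_def sum_subtractf)
      also have "\<dots> \<le> incr ?F P + (\<Sum>p\<in>P. \<bar>f (snd p) - f (fst p)\<bar>)"
        using sum_abs[of "\<lambda>p. f (snd p) - f (fst p)" P] by linarith
      also have "\<dots> < \<epsilon>" using \<delta>(2)[of P] \<delta>'(2)[of P] P by simp
      finally show ?thesis .
    qed
    then show "\<exists>\<delta>>0. \<forall>P. subints c d P \<and> incr id P < \<delta> \<longrightarrow> incr ?G P < \<epsilon>"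
      using \<delta>(1) \<delta>'(1) by (intro exI[of _ "min \<delta> \<delta>'"]) auto
  qed
qed auto

end

section \<open>Absolute continuity of Stieltjes measures and their densities\<close>

text \<open>Translates finite parts of the cover produced by \<open>covering_lemma\<close> into
  \<open>subints\<close>: on the line, nondegenerate intervals with disjoint interiors are
  ordered.\<close>

lemma subints_of_cover:
  assumes E: "finite E" "\<And>K. K \<in> E \<Longrightarrow> K = {u K..v K} \<and> u K < v K \<and> K \<subseteq> {c..d}"
    and disj: "pairwise (\<lambda>A B. interior A \<inter> interior B = {}) E"
  shows "subints c d ((\<lambda>K. (u K, v K)) ` E)" "inj_on (\<lambda>K. (u K, v K)) E"
proof -
  show inj: "inj_on (\<lambda>K. (u K, v K)) E"
    by (rule inj_onI) (metis E(2) prod.inject)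
  show "subints c d ((\<lambda>K. (u K, v K)) ` E)"
    unfolding subints_def
  proof (intro conjI ballI impI)
    show "finite ((\<lambda>K. (u K, v K)) ` E)" using E by simp
  next
    fix p assume "p \<in> (\<lambda>K. (u K, v K)) ` E"
    then obtain K where K: "K \<in> E" "p = (u K, v K)" by blast
    then have "K = {u K..v K}" "u K < v K" "K \<subseteq> {c..d}" using E(2) by blast+
    then have "u K \<in> {c..d}" "v K \<in> {c..d}" by force+
    then show "c \<le> fst p" "fst p < snd p" "snd p \<le> d" using K \<open>u K < v K\<close> by auto
  next
    fix p q assume "p \<in> (\<lambda>K. (u K, v K)) ` E" "q \<in> (\<lambda>K. (u K, v K)) ` E" "p \<noteq> q"
    then obtain K L where KL: "K \<in> E" "p = (u K, v K)" "L \<in> E" "q = (u L, v L)" "K \<noteq> L" by blast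
    then have eq: "K = {u K..v K}" "u K < v K" "L = {u L..v L}" "u L < v L" using E(2) by blast+
    have "interior K \<inter> interior L = {}" using disj KL unfolding pairwise_def by blast
    then have "{u K<..<v K} \<inter> {u L<..<v L} = {}" using eq by (metis interior_atLeastAtMost_real)
    then have "{max (u K) (u L)<..<min (v K) (v L)} = {}" by auto
    then have "min (v K) (v L) \<le> max (u K) (u L)" by (simp add: greaterThanLessThan_empty_iff)
    then show "snd p \<le> fst q \<or> snd q \<le> fst p"
      using KL eq by (auto simp: min_def max_def split: if_splits)
  qed
qed

lemma ac_incr_imp_continuous:
  assumes mono: "mono_on {c..d} F" and ac: "ac_incr c d F"
  shows "continuous_on {c..d} F"
  unfolding continuous_on_iff
proof (intro ballI allI impI)
  fix x \<epsilon> :: real assume x: "x \<in> {c..d}" and "0 < \<epsilon>"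
  then obtain \<delta> where \<delta>: "\<delta> > 0" "\<And>P. subints c d P \<Longrightarrow> incr id P < \<delta> \<Longrightarrow> incr F P < \<epsilon>"
    using ac unfolding ac_incr_def by blast
  have key: "F s - F r < \<epsilon> \<and> F r \<le> F s" if "r \<in> {c..d}" "s \<in> {c..d}" "r < s" "s - r < \<delta>" for r s
    using \<delta>(2)[of "{(r, s)}"] that mono by (auto simp: subints_def incr_def mono_on_def)
  have "dist (F y) (F x) < \<epsilon>" if "y \<in> {c..d}" "dist y x < \<delta>" for y
    using key[of x y] key[of y x] x that \<open>0 < \<epsilon>\<close>
    by (cases x y rule: linorder_cases) (auto simp: dist_real_def)
  then show "\<exists>\<delta>>0. \<forall>y\<in>{c..d}. dist y x < \<delta> \<longrightarrow> dist (F y) (F x) < \<epsilon>"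
    using \<delta>(1) by blast
qed

text \<open>Extending \<open>F\<close> by constants outside \<open>{c..d}\<close> makes it a distribution function on the real
  line; its Stieltjes measure is absolutely continuous, so that the Radon-Nikodym theorem provides
  the derivative.\<close>

lemma ac_incr_interval_measure_null:
  fixes F :: "real \<Rightarrow> real"
  assumes cd: "c < d" and mono: "mono_on {c..d} F" and ac: "ac_incr c d F"
    and N: "N \<in> null_sets lborel" "N \<subseteq> {c..d}"
  shows "N \<in> null_sets (interval_measure (\<lambda>x. F (max c (min d x))))"
proof -
  define G where "G = (\<lambda>x. F (max c (min d x)))"
  have Gmono: "G x \<le> G y" if "x \<le> y" for x y
    using mono that cd unfolding G_def mono_on_def by (simp add: max_def min_def)
  have "continuous_on UNIV (F \<circ> (\<lambda>x. max c (min d x)))"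
  proof (rule continuous_on_compose)
    show "continuous_on (range (\<lambda>x. max c (min d x))) F"
      by (rule continuous_on_subset[OF ac_incr_imp_continuous[OF mono ac]]) (use cd in auto)
  qed (intro continuous_intros)
  then have Gcont: "continuous_on UNIV G" by (simp add: G_def o_def)
  let ?\<mu> = "interval_measure G"
  have em: "emeasure ?\<mu> {u..v} = G v - G u" if "u \<le> v" for u v
    using that Gmono Gcont by (rule emeasure_interval_measure_Icc)
  have Nb: "N \<in> sets borel" using N by auto
  have "emeasure ?\<mu> N \<le> ennreal \<epsilon>" if "\<epsilon> > 0" for \<epsilon> :: real
  proof -
    obtain \<delta> where \<delta>: "\<delta> > 0" "\<And>P. subints c d P \<Longrightarrow> incr id P < \<delta> \<Longrightarrow> incr F P < \<epsilon>"
      using ac \<open>\<epsilon> > 0\<close> unfolding ac_incr_def by blast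
    obtain U where U: "open U" "N \<subseteq> U" "emeasure lborel (U - N) < \<delta>"
      using outer_regular_lborel[OF Nb \<open>\<delta> > 0\<close>] by blast
    have "emeasure lborel U \<le> emeasure lborel (U - N) + emeasure lborel N"
      using U(1) Nb by (intro order_trans[OF emeasure_mono[of U "(U - N) \<union> N"] emeasure_subadditive]) auto
    then have Ul: "emeasure lborel U < \<delta>" using N(1) U(3) by auto
    \<comment> \<open>The gauge confines every covering interval with tag in \<open>N\<close> to
      \<open>U\<close>. The value \<open>UNIV\<close> elsewhere only completes it to a gauge, as all
      tags lie in \<open>N\<close>, a subset of \<open>U\<close>.\<close>
    define \<gamma> where "\<gamma> = (\<lambda>x::real. if x \<in> U then U else UNIV)"
    have g: "gauge \<gamma>" using U(1) by (auto simp: gauge_def \<gamma>_def)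
    have Ncd: "N \<subseteq> cbox c d" "box c d \<noteq> {}" using N(2) cd by (simp_all add: box_real)
    obtain D where D: "countable D" "\<Union>D \<subseteq> cbox c d"
      "\<And>K. K \<in> D \<Longrightarrow> interior K \<noteq> {} \<and> (\<exists>u v. K = cbox u v)"
      "pairwise (\<lambda>A B. interior A \<inter> interior B = {}) D"
      "\<And>K. K \<in> D \<Longrightarrow> \<exists>x \<in> N \<inter> K. K \<subseteq> \<gamma> x" "N \<subseteq> \<Union>D"
      by (rule covering_lemma[OF Ncd g]) (rule that; assumption)
    have "\<forall>K\<in>D. \<exists>u v. K = {u..v} \<and> u < v"
    proof
      fix K assume "K \<in> D"
      then obtain u v where "K = cbox u v" "interior K \<noteq> {}" using D(3) by blast
      then have "K = {u..v}" "u < v" by (auto simp: interior_cbox box_real)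
      then show "\<exists>u v. K = {u..v} \<and> u < v" by blast
    qed
    then obtain u v where uv: "\<And>K. K \<in> D \<Longrightarrow> K = {u K..v K} \<and> u K < v K" by metis
    have KU: "K \<subseteq> U \<and> K \<subseteq> {c..d}" if K: "K \<in> D" for K
    proof -
      obtain x where x: "x \<in> N" "K \<subseteq> \<gamma> x" using D(5)[OF K] by blast
      then have "x \<in> U" using U(2) by blast
      then have "K \<subseteq> U" using x(2) by (simp add: \<gamma>_def)
      moreover have "K \<subseteq> \<Union>D" using K by (rule Union_upper)
      then have "K \<subseteq> {c..d}" using D(2) unfolding cbox_interval by (rule subset_trans)
      ultimately show ?thesis by blast
    qed
    \<comment> \<open>\<open>ac_incr\<close> speaks about finite families only, so finite parts of
      the countable cover are bounded first. Their total length is below \<open>\<delta>\<close>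
      because disjoint open intervals inside \<open>U\<close> measure at most as much as
      \<open>U\<close>.\<close>
    have fin: "emeasure ?\<mu> (\<Union>E) \<le> \<epsilon>" if E: "finite E" "E \<subseteq> D" for E
    proof -
      let ?P = "(\<lambda>K. (u K, v K)) ` E"
      have *: "K = {u K..v K} \<and> u K < v K \<and> K \<subseteq> {c..d}" if "K \<in> E" for K
        using uv KU that E by blast
      have disj: "pairwise (\<lambda>A B. interior A \<inter> interior B = {}) E"
        using D(4) E(2) by (meson pairwise_subset)
      have lt: "u K < v K" "u K \<le> v K" if "K \<in> E" for K using *[OF that] by auto
      have bds: "c \<le> u K" "v K \<le> d" if "K \<in> E" for K
      proof -
        have "{u K..v K} \<subseteq> {c..d}" using *[OF that] by metis
        then show "c \<le> u K" "v K \<le> d" using lt(2)[OF that] by auto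
      qed
      have P: "subints c d ?P" "inj_on (\<lambda>K. (u K, v K)) E"
        by (rule subints_of_cover[OF E(1) _ disj]; rule *; assumption)+
      have dj: "disjoint_family_on (\<lambda>K. {u K<..<v K}) E"
        using disj * unfolding disjoint_family_on_def pairwise_def
        by (metis interior_atLeastAtMost_real)
      have "incr id ?P = (\<Sum>K\<in>E. measure lborel {u K<..<v K})"
        unfolding incr_def by (subst sum.reindex[OF P(2)]) (simp add: lt o_def)
      also have "\<dots> = measure lborel (\<Union>K\<in>E. {u K<..<v K})"
        using E(1) lt dj by (intro measure_finite_Union[symmetric]) auto
      also have "ennreal \<dots> \<le> emeasure lborel (\<Union>K\<in>E. {u K<..<v K})"
        by (simp add: measure_def ennreal_enn2real_if)
      also have "\<dots> \<le> emeasure lborel U"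
      proof (rule emeasure_mono)
        show "(\<Union>K\<in>E. {u K<..<v K}) \<subseteq> U"
        proof (rule UN_least)
          fix K assume "K \<in> E"
          then have "{u K..v K} \<subseteq> U" using * KU E(2) by (metis subsetD)
          then show "{u K<..<v K} \<subseteq> U" by auto
        qed
      qed (use U in simp)
      finally have "ennreal (incr id ?P) < \<delta>" using Ul by (rule le_less_trans)
      then have "incr id ?P < \<delta>"
        using \<delta>(1) by (meson ennreal_leI leD leI)
      then have inc: "incr F ?P < \<epsilon>" using P(1) \<delta>(2) by blast
      have "emeasure ?\<mu> (\<Union>E) \<le> (\<Sum>K\<in>E. emeasure ?\<mu> K)"
      proof (rule order_trans[OF _ emeasure_subadditive_finite[OF E(1), of "\<lambda>K. K" ?\<mu>]])
        show "(\<lambda>K. K) ` E \<subseteq> sets ?\<mu>"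
        proof
          fix K assume "K \<in> (\<lambda>K. K) ` E"
          then have "K = {u K..v K}" using * by auto
          then show "K \<in> sets ?\<mu>" by (metis atLeastAtMost_borel sets_interval_measure)
        qed
      qed simp
      also have "\<dots> = (\<Sum>K\<in>E. ennreal (F (v K) - F (u K)))"
      proof (rule sum.cong[OF refl])
        fix K assume "K \<in> E"
        then have K: "K = {u K..v K}" and G: "G (v K) = F (v K)" "G (u K) = F (u K)"
          using *[of K] lt[of K] bds[of K] by (simp_all add: G_def)
        have "emeasure ?\<mu> {u K..v K} = ennreal (F (v K) - F (u K))"
          using em[of "u K" "v K"] lt[OF \<open>K \<in> E\<close>] G by simp
        then show "emeasure ?\<mu> K = ennreal (F (v K) - F (u K))"
          by (subst K)
      qed
      also have "\<dots> = ennreal (\<Sum>K\<in>E. F (v K) - F (u K))"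
      proof (rule sum_ennreal)
        fix K assume "K \<in> E"
        then show "0 \<le> F (v K) - F (u K)" using mono lt[of K] bds[of K] by (auto simp: mono_on_def)
      qed
      also have "\<dots> = ennreal (incr F ?P)"
        unfolding incr_def using P(2) by (simp add: sum.reindex)
      also have "\<dots> \<le> ennreal \<epsilon>" using inc by (intro ennreal_leI) simp
      finally show ?thesis .
    qed
    show ?thesis
    proof (cases "D = {}")
      case True
      then show ?thesis using D(6) by simp
    next
      case False
      \<comment> \<open>Exhausts the cover by finite parts, so that continuity from below carries
        the bound over to the whole; repetitions in the enumeration are harmless.\<close>
      let ?A = "\<lambda>n::nat. \<Union>(from_nat_into D ` {..<n})"
      have sub: "from_nat_into D ` {..<n} \<subseteq> D" for n
        using from_nat_into[OF False] by auto
      have cl: "K \<in> sets borel" if "K \<in> D" for K using uv[OF that] by (metis atLeastAtMost_borel)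
      have setsA: "range ?A \<subseteq> sets ?\<mu>" 
      proof (rule image_subsetI)
        fix n
        have "\<Union>(from_nat_into D ` {..<n}) \<in> sets borel"
          using sub[of n] cl by (intro sets.finite_Union) auto
        then show "?A n \<in> sets ?\<mu>" by simp
      qed
      have "emeasure ?\<mu> N \<le> emeasure ?\<mu> (\<Union>n. ?A n)"
      proof (rule emeasure_mono)
        show "N \<subseteq> (\<Union>n. ?A n)"
        proof
          fix x assume "x \<in> N"
          then obtain K where "K \<in> D" "x \<in> K" using D(6) by blast
          then obtain n where "K = from_nat_into D n" using D(1) by (metis from_nat_into_surj)
          then have "x \<in> ?A (Suc n)" using \<open>x \<in> K\<close> by blast
          then show "x \<in> (\<Union>n. ?A n)" by blast
        qed
        show "(\<Union>n. ?A n) \<in> sets ?\<mu>" using setsA by blast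
      qed
      also have "\<dots> = (SUP n. emeasure ?\<mu> (?A n))"
      proof (rule SUP_emeasure_incseq[symmetric, OF setsA])
        show "incseq ?A" unfolding incseq_def by (meson Union_mono image_mono lessThan_subset_iff)
      qed
      also have "\<dots> \<le> \<epsilon>" by (intro SUP_least fin sub finite_imageI finite_lessThan)
      finally show ?thesis .
    qed
  qed
  then have "emeasure ?\<mu> N \<le> 0 + ennreal \<epsilon>" if "\<epsilon> > 0" for \<epsilon> :: real using that by simp
  then have "emeasure ?\<mu> N \<le> 0" by (rule ennreal_le_epsilon)
  then have "N \<in> null_sets ?\<mu>" using Nb by (auto simp: null_sets_def)
  then show ?thesis by (simp add: G_def)
qed

text \<open>\<open>g\<close> is the Radon-Nikodym density of the Stieltjes measure with respect to
  Lebesgue measure. Continuity of \<open>F\<close> excludes atoms, so the closed interval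
  \<open>{c..x}\<close> has mass \<open>F x - F c\<close>.\<close>

lemma mono_ac_incr_integral:
  fixes F :: "real \<Rightarrow> real"
  assumes cd: "c < d" and mono: "mono_on {c..d} F" and ac: "ac_incr c d F"
  obtains g where "integrable lborel g" "\<And>x. x \<in> {c..d} \<Longrightarrow> (g has_integral F x - F c) {c..x}"
proof -
  define G where "G = (\<lambda>x. F (max c (min d x)))"
  have Gmono: "G x \<le> G y" if "x \<le> y" for x y
    using mono that cd unfolding G_def mono_on_def by (simp add: max_def min_def)
  have "continuous_on UNIV (F \<circ> (\<lambda>x. max c (min d x)))"
  proof (rule continuous_on_compose)
    show "continuous_on (range (\<lambda>x. max c (min d x))) F"
      by (rule continuous_on_subset[OF ac_incr_imp_continuous[OF mono ac]]) (use cd in auto)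
  qed (intro continuous_intros)
  then have Gcont: "continuous_on UNIV G" by (simp add: G_def o_def)
  define \<mu> where "\<mu> = density (interval_measure G) (indicator {c..d})"
  have em: "emeasure (interval_measure G) {u..v} = G v - G u" if "u \<le> v" for u v
    using that Gmono Gcont by (rule emeasure_interval_measure_Icc)
  have mu: "emeasure \<mu> A = emeasure (interval_measure G) ({c..d} \<inter> A)" if "A \<in> sets borel" for A
    unfolding \<mu>_def using that by (subst emeasure_density) (auto simp: indicator_inter_arith[symmetric])
  have setsmu: "sets \<mu> = sets lborel" by (simp add: \<mu>_def)
  have "absolutely_continuous lborel \<mu>"
    unfolding absolutely_continuous_def
  proof
    fix N :: "real set" assume N: "N \<in> null_sets lborel"
    then have "{c..d} \<inter> N \<in> null_sets lborel" by (intro null_set_Int1) auto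
    then have "{c..d} \<inter> N \<in> null_sets (interval_measure G)"
      using ac_incr_interval_measure_null[OF cd mono ac] unfolding G_def by auto
    then show "N \<in> null_sets \<mu>" using mu[of N] N setsmu by (auto simp: null_sets_def)
  qed
  then obtain h where h: "h \<in> borel_measurable lborel" "density lborel h = \<mu>"
    using sigma_finite_measure.Radon_Nikodym[OF sigma_finite_lborel] setsmu by blast
  have hint: "(\<integral>\<^sup>+x. h x * indicator A x \<partial>lborel) = emeasure (interval_measure G) ({c..d} \<inter> A)"
    if "A \<in> sets borel" for A
    using emeasure_density[OF h(1), of A] that mu[OF that] h(2) by simp
  have "(\<integral>\<^sup>+x. h x \<partial>lborel) = emeasure (interval_measure G) {c..d}"
    using hint[of UNIV] by simp
  then have fin: "(\<integral>\<^sup>+x. h x \<partial>lborel) \<noteq> \<infinity>" using em[of c d] cd by simp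
  \<comment> \<open>The total mass \<open>F d - F c\<close> is finite, so the extended-real density
    is finite almost everywhere and can be replaced by a real one.\<close>
  have AE: "AE x in lborel. h x \<noteq> \<infinity>"
    using nn_integral_PInf_AE[OF h(1) fin] .
  define g where "g = (\<lambda>x. enn2real (h x))"
  have gm[measurable]: "g \<in> borel_measurable lborel" unfolding g_def using h(1) by measurable
  have gh: "AE x in lborel. ennreal (g x) = h x"
    using AE by eventually_elim (simp add: g_def ennreal_enn2real_if)
  have "(\<integral>\<^sup>+x. ennreal (g x) \<partial>lborel) = (\<integral>\<^sup>+x. h x \<partial>lborel)"
    by (rule nn_integral_cong_AE[OF gh])
  then have ig: "integrable lborel g"
    using fin by (intro integrableI_nonneg gm) (auto simp: g_def less_top)
  show thesis
  proof (rule that[OF ig])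
    fix x assume x: "x \<in> {c..d}"
    have "(\<integral>\<^sup>+y. ennreal (g y * indicator {c..x} y) \<partial>lborel) = (\<integral>\<^sup>+y. h y * indicator {c..x} y \<partial>lborel)"
      using gh by (intro nn_integral_cong_AE) (auto simp: indicator_def)
    also have "\<dots> = emeasure (interval_measure G) {c..x}"
      using hint[of "{c..x}"] x by (simp add: Int_absorb1)
    also have "\<dots> = ennreal (F x - F c)" using em[of c x] x by (simp add: G_def)
    finally have "((\<lambda>y. g y * indicator {c..x} y) has_integral (F x - F c)) UNIV"
    proof (intro nn_integral_has_integral)
      show "(\<lambda>y. g y * indicator {c..x} y) \<in> borel_measurable borel"
        using gm by (auto intro!: borel_measurable_times)
    qed (use x mono cd in \<open>auto simp: g_def mono_on_def\<close>)
    then have "((\<lambda>y. if y \<in> {c..x} then g y else 0) has_integral (F x - F c)) UNIV"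
      by (rule has_integral_eq[rotated]) (auto simp: indicator_def)
    then show "(g has_integral (F x - F c)) {c..x}" by (simp only: has_integral_restrict_UNIV)
  qed
qed

lemma abs_cont_on_integral:
  assumes cd: "c < d" and ac: "abs_cont_on c d f"
  obtains g where "integrable lborel g" "\<And>x. x \<in> {c..d} \<Longrightarrow> (g has_integral f x - f c) {c..x}"
proof -
  obtain F G where FG: "mono_on {c..d} F" "ac_incr c d F" "mono_on {c..d} G" "ac_incr c d G" "\<And>x. f x = F x - G x"
    using abs_cont_on_decompose[OF ac] by blast
  obtain g where g: "integrable lborel g" "\<And>x. x \<in> {c..d} \<Longrightarrow> (g has_integral F x - F c) {c..x}"
    using mono_ac_incr_integral[OF cd FG(1,2)] by blast
  obtain h where h: "integrable lborel h" "\<And>x. x \<in> {c..d} \<Longrightarrow> (h has_integral G x - G c) {c..x}"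
    using mono_ac_incr_integral[OF cd FG(3,4)] by blast
  show thesis
  proof (rule that[of "\<lambda>x. g x - h x"])
    show "integrable lborel (\<lambda>x. g x - h x)" using g(1) h(1) by simp
    fix x assume "x \<in> {c..d}"
    then show "((\<lambda>x. g x - h x) has_integral f x - f c) {c..x}"
      using has_integral_diff[OF g(2)[of x] h(2)[of x]] by (simp add: FG(5) algebra_simps)
  qed
qed

section \<open>Almost everywhere differentiability\<close>

lemma AE_indefinite_integral_right:
  fixes g :: "real \<Rightarrow> real"
  assumes "integrable lborel g"
  obtains N where "negligible N"
    "\<And>x e. x \<notin> N \<Longrightarrow> 0 < e \<Longrightarrow> \<exists>\<delta>>0. \<forall>h. 0 < h \<and> h < \<delta> \<longrightarrow> \<bar>integral {x..x + h} g / h - g x\<bar> < e"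
proof -
  have "g integrable_on UNIV" using assms integrable_on_lborel by blast
  then have "g integrable_on cbox a b" for a b :: real
    by (rule integrable_on_subcbox) simp
  then obtain N where "negligible N" "\<And>x e. \<lbrakk>x \<notin> N; 0 < e\<rbrakk> \<Longrightarrow> \<exists>d>0. \<forall>h. 0 < h \<and> h < d \<longrightarrow>
     norm (integral (cbox x (x + h *\<^sub>R One)) g /\<^sub>R h ^ DIM(real) - g x) < e"
    using integrable_ccontinuous_explicit by blast
  then show thesis
    by (intro that[of N]) (auto simp: divide_inverse mult.commute)
qed

text \<open>Difference quotients of \<open>f\<close> are averages of \<open>g\<close> over adjacent
  intervals, and these converge to \<open>g x\<close> for almost every \<open>x\<close>.\<close>

lemma abs_cont_on_AE_derivative:
  assumes cd: "c < d" and ac: "abs_cont_on c d f"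
  obtains g N where "integrable lborel g" "\<And>x. x \<in> {c..d} \<Longrightarrow> (g has_integral f x - f c) {c..x}"
    "negligible N" "\<And>x. x \<in> {c<..<d} - N \<Longrightarrow> (f has_real_derivative g x) (at x)"
proof -
  obtain g where g: "integrable lborel g" "\<And>x. x \<in> {c..d} \<Longrightarrow> (g has_integral f x - f c) {c..x}"
    using abs_cont_on_integral[OF cd ac] by blast
  obtain N1 where N1: "negligible N1"
    "\<And>x e. x \<notin> N1 \<Longrightarrow> 0 < e \<Longrightarrow> \<exists>\<delta>>0. \<forall>h. 0 < h \<and> h < \<delta> \<longrightarrow> \<bar>integral {x..x + h} g / h - g x\<bar> < e"
    using AE_indefinite_integral_right[OF g(1)] by blast
  \<comment> \<open>The differentiation result concerns intervals to the right of \<open>x\<close>;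
    reflecting the line turns it into the statement for left difference quotients.\<close>
  have g': "integrable lborel (\<lambda>x. g (- x))"
    using lborel_integrable_real_affine[OF g(1), of "-1" 0] by simp
  obtain N2 where N2: "negligible N2"
    "\<And>x e. x \<notin> N2 \<Longrightarrow> 0 < e \<Longrightarrow> \<exists>\<delta>>0. \<forall>h. 0 < h \<and> h < \<delta> \<longrightarrow> \<bar>integral {x..x + h} (\<lambda>x. g (- x)) / h - g (- x)\<bar> < e"
    using AE_indefinite_integral_right[OF g'] by blast
  have N2': "negligible (uminus ` N2)"
    by (rule negligible_locally_Lipschitz_image[OF _ N2(1)]) (auto simp: abs_minus_commute intro!: exI[of _ "UNIV :: real set"] exI[of _ "1 :: real"])
  have int: "integral {x..y} g = f y - f x" if "c \<le> x" "x \<le> y" "y \<le> d" for x y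
  proof -
    have "integral {c..x} g + integral {x..y} g = integral {c..y} g"
      using that g(2)[of y] by (intro Henstock_Kurzweil_Integration.integral_combine) auto
    then show ?thesis using g(2)[of x] g(2)[of y] that by (auto dest!: integral_unique)
  qed
  show thesis
  proof (rule that[OF g(1) g(2), of "N1 \<union> uminus ` N2"])
    show "negligible (N1 \<union> uminus ` N2)" using N1(1) N2' by simp
    fix x assume "x \<in> {c<..<d} - (N1 \<union> uminus ` N2)"
    then have x: "c < x" "x < d" "x \<notin> N1" "- x \<notin> N2" by (auto simp: image_iff)
    show "(f has_real_derivative g x) (at x)"
      unfolding DERIV_def LIM_eq
    proof (intro allI impI)
      fix e :: real assume "0 < e"
      obtain \<delta>1 where d1: "\<delta>1 > 0" "\<And>h. 0 < h \<Longrightarrow> h < \<delta>1 \<Longrightarrow> \<bar>integral {x..x + h} g / h - g x\<bar> < e"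
        using N1(2)[OF x(3) \<open>0 < e\<close>] by blast
      obtain \<delta>2 where d2: "\<delta>2 > 0" "\<And>h. 0 < h \<Longrightarrow> h < \<delta>2 \<Longrightarrow> \<bar>integral {-x..-x + h} (\<lambda>x. g (-x)) / h - g x\<bar> < e"
        using N2(2)[OF x(4) \<open>0 < e\<close>] by auto
      have "\<bar>(f (x + h) - f x) / h - g x\<bar> < e"
        if h: "h \<noteq> 0" "\<bar>h\<bar> < min (min \<delta>1 \<delta>2) (min (x - c) (d - x))" for h
      proof (cases "h > 0")
        case True
        then show ?thesis using d1(2)[of h] h int[of x "x + h"] x by auto
      next
        case False
        then have "h < 0" using h by simp
        have "integral {-x..-x + -h} (\<lambda>x. g (-x)) = integral {x + h..x} g"
          using Henstock_Kurzweil_Integration.integral_reflect_real[of x "x + h" g] by simp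
        then show ?thesis using d2(2)[of "-h"] h \<open>h < 0\<close> int[of "x + h" x] x
          by (auto simp: divide_simps)
      qed
      then show "\<exists>s>0. \<forall>h. h \<noteq> 0 \<and> norm (h - 0) < s \<longrightarrow> norm ((f (x + h) - f x) / h - g x) < e"
        using d1(1) d2(1) x by (intro exI[of _ "min (min \<delta>1 \<delta>2) (min (x - c) (d - x))"]) auto
    qed
  qed
qed

section \<open>Square integrable functions on the unit interval\<close>

lemma AE_leb01_negligible:
  assumes "negligible N" "\<And>x. x \<in> {0<..<1} - N \<Longrightarrow> P x"
  shows "AE x in leb01. P x"
proof -
  have "AE x in lebesgue. x \<notin> N"
    using assms(1) by (intro AE_not_in) (simp add: negligible_iff_null_sets)
  then have "AE x in lebesgue. x \<in> {0<..<1} \<longrightarrow> P x"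
    by eventually_elim (use assms(2) in auto)
  then show ?thesis by (subst AE_restrict_space_iff) auto
qed

lemma AE_leb01_imp_negligible:
  assumes "AE x in leb01. P x"
  obtains N where "negligible N" "\<And>x. x \<in> {0<..<1} - N \<Longrightarrow> P x"
proof -
  have "AE x in lebesgue. x \<in> {0<..<1} \<longrightarrow> P x"
    using assms by (subst (asm) AE_restrict_space_iff) auto
  then obtain N where "{x \<in> space lebesgue. \<not> (x \<in> {0<..<1} \<longrightarrow> P x)} \<subseteq> N" "N \<in> null_sets lebesgue"
    by (rule AE_E3) auto
  then show thesis by (intro that[of N]) (auto simp: negligible_iff_null_sets)
qed

text \<open>Lebesgue measure is complete, so changes on null sets preserve measurability. This lets
  second derivatives, meaningful only almost everywhere, be exchanged freely.\<close>

lemma borel_measurable_leb01_AE: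
  assumes f: "f \<in> borel_measurable leb01" and eq: "AE x in leb01. f x = (g x :: real)"
  shows "g \<in> borel_measurable leb01"
proof -
  obtain N where N: "negligible N" "\<And>x. x \<in> {0<..<1} - N \<Longrightarrow> f x = g x"
    using AE_leb01_imp_negligible[OF eq] by blast
  have "f measurable_on {0<..<1}" using f by (simp add: measurable_on_iff_borel_measurable)
  then have "g measurable_on {0<..<1}" using N by (auto intro: measurable_on_spike)
  then show ?thesis by (simp add: measurable_on_iff_borel_measurable)
qed

text \<open>No measurability has to be assumed: by completeness both functions are measurable or
  neither is, and in the latter case both integrals have the default value 0.\<close>

lemma integral_leb01_cong_AE:
  fixes f g :: "real \<Rightarrow> real"
  assumes "AE x in leb01. f x = g x"
  shows "integral\<^sup>L leb01 f = integral\<^sup>L leb01 g"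
proof (cases "f \<in> borel_measurable leb01")
  case True
  then show ?thesis by (rule integral_cong_AE[OF _ borel_measurable_leb01_AE[OF True assms] assms])
next
  case False
  then have "g \<notin> borel_measurable leb01"
    using borel_measurable_leb01_AE[of g f] assms by (subst (asm) eq_commute) blast
  then have "\<not> integrable leb01 f" "\<not> integrable leb01 g" using False by auto
  then show ?thesis by (simp add: not_integrable_integral_eq)
qed

lemma integrable_leb01_cong_AE:
  fixes f g :: "real \<Rightarrow> real"
  assumes "integrable leb01 f" "AE x in leb01. f x = g x"
  shows "integrable leb01 g"
proof (rule integrable_cong_AE_imp[OF assms(1)])
  show "g \<in> borel_measurable leb01"
    using borel_measurable_leb01_AE[OF borel_measurable_integrable[OF assms(1)] assms(2)] .
qed (use assms(2) in \<open>auto elim: AE_mp\<close>)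

lemma L2_01_cong_AE:
  assumes "f \<in> L2_01" "AE x in leb01. f x = g x"
  shows "g \<in> L2_01"
proof -
  have f: "f \<in> borel_measurable leb01" "integrable leb01 (\<lambda>x. (f x)\<^sup>2)"
    using assms(1) by (auto simp: L2_01_def)
  have "AE x in leb01. (f x)\<^sup>2 = (g x)\<^sup>2" using assms(2) by eventually_elim simp
  from integrable_leb01_cong_AE[OF f(2) this] borel_measurable_leb01_AE[OF f(1) assms(2)]
  show ?thesis unfolding L2_01_def by blast
qed

lemma L2_01_mult_integrable:
  assumes "f \<in> L2_01" "g \<in> L2_01"
  shows "integrable leb01 (\<lambda>x. f x * g x)"
proof (rule Bochner_Integration.integrable_bound)
  show "integrable leb01 (\<lambda>x. (f x)\<^sup>2 + (g x)\<^sup>2)" using assms by (simp add: L2_01_def)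
  show "(\<lambda>x. f x * g x) \<in> borel_measurable leb01" using assms by (auto simp: L2_01_def)
  have "\<bar>f x * g x\<bar> \<le> (f x)\<^sup>2 + (g x)\<^sup>2" for x
    
  proof -
    have "2 * \<bar>f x * g x\<bar> \<le> (f x)\<^sup>2 + (g x)\<^sup>2"
      using sum_squares_bound[of "\<bar>f x\<bar>" "\<bar>g x\<bar>"] by (simp add: abs_mult mult.assoc)
    then show ?thesis using abs_ge_zero[of "f x * g x"] by linarith
  qed
  then show "AE x in leb01. norm (f x * g x) \<le> norm ((f x)\<^sup>2 + (g x)\<^sup>2)" by simp
qed

lemma L2_01_lincomb:
  assumes "f \<in> L2_01" "g \<in> L2_01"
  shows "(\<lambda>x. \<alpha> * f x + \<beta> * g x) \<in> L2_01"
proof -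
  have "integrable leb01 (\<lambda>x. \<alpha>\<^sup>2 * (f x)\<^sup>2 + (2 * \<alpha> * \<beta> * (f x * g x) + \<beta>\<^sup>2 * (g x)\<^sup>2))"
    using assms L2_01_mult_integrable[OF assms] by (auto simp: L2_01_def)
  also have "(\<lambda>x. \<alpha>\<^sup>2 * (f x)\<^sup>2 + (2 * \<alpha> * \<beta> * (f x * g x) + \<beta>\<^sup>2 * (g x)\<^sup>2)) = (\<lambda>x. (\<alpha> * f x + \<beta> * g x)\<^sup>2)"
    by (auto simp: power2_eq_square algebra_simps)
  finally show ?thesis using assms by (auto simp: L2_01_def)
qed

lemma L2_01_bounded_mult:
  assumes "f \<in> L2_01" "k \<in> borel_measurable leb01" "\<And>x. x \<in> {0<..<1} \<Longrightarrow> \<bar>k x\<bar> \<le> C"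
  shows "(\<lambda>x. k x * f x) \<in> L2_01"
proof -
  have "integrable leb01 (\<lambda>x. (k x * f x)\<^sup>2)"
  proof (rule Bochner_Integration.integrable_bound)
    show "integrable leb01 (\<lambda>x. C\<^sup>2 * (f x)\<^sup>2)" using assms by (simp add: L2_01_def)
    show "(\<lambda>x. (k x * f x)\<^sup>2) \<in> borel_measurable leb01" using assms by (auto simp: L2_01_def)
    have "(k x * f x)\<^sup>2 \<le> C\<^sup>2 * (f x)\<^sup>2" if "x \<in> {0<..<1}" for x
      unfolding power_mult_distrib using assms(3)[OF that]
      by (intro mult_right_mono) (auto simp: power2_le_iff_abs_le intro: order_trans abs_ge_zero)
    then show "AE x in leb01. norm ((k x * f x)\<^sup>2) \<le> norm (C\<^sup>2 * (f x)\<^sup>2)"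
      by (intro AE_I2) simp
  qed
  then show ?thesis using assms by (auto simp: L2_01_def)
qed

lemma borel_measurable_leb01_continuous:
  "continuous_on {0<..<1} f \<Longrightarrow> (f :: real \<Rightarrow> real) \<in> borel_measurable leb01"
  by (rule continuous_imp_measurable_on_sets_lebesgue) auto

lemma L2_01_bounded:
  assumes "k \<in> borel_measurable leb01" "\<And>x. x \<in> {0<..<1} \<Longrightarrow> \<bar>k x\<bar> \<le> C"
  shows "k \<in> L2_01"
proof -
  have fin: "finite_measure leb01"
    by (intro finite_measureI) (simp add: emeasure_restrict_space)
  have "(\<lambda>x. 1) \<in> L2_01"
    using finite_measure.integrable_const[OF fin, of "1::real"] by (simp add: L2_01_def)
  from L2_01_bounded_mult[OF this assms] show ?thesis by simp
qed

lemma L2_01_continuous: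
  assumes "continuous_on {0..1} f" shows "f \<in> L2_01"
proof -
  have "bounded (f ` {0..1})"
    using assms by (auto intro!: compact_imp_bounded compact_continuous_image)
  then obtain C where "\<And>x. x \<in> {0..1} \<Longrightarrow> \<bar>f x\<bar> \<le> C" by (auto simp: bounded_iff simp del: atLeastAtMost_iff)
  then show ?thesis
    by (intro L2_01_bounded[of _ C] borel_measurable_leb01_continuous continuous_on_subset[OF assms]) auto
qed

lemma L2_01_integrable: "f \<in> L2_01 \<Longrightarrow> integrable leb01 f"
  using L2_01_mult_integrable[OF L2_01_continuous[of "\<lambda>_. 1"], of f] by simp

section \<open>Derivatives on the unit interval\<close>

lemma deriv01_eq:
  assumes "(f has_vector_derivative D) (at x within {0..1})" "x \<in> {0..1}"
  shows "deriv01 f x = D"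
  unfolding deriv01_def using assms by (intro vector_derivative_within_closed_interval) auto

lemma deriv01_DERIV:
  assumes "(f has_real_derivative D) (at x)" "x \<in> {0..1}"
  shows "deriv01 f x = D"
  using assms by (intro deriv01_eq)
    (auto simp: has_real_derivative_iff_has_vector_derivative intro: has_vector_derivative_at_within)

lemma diff01_on_has_vector_derivative:
  assumes "diff01_on S f" "x \<in> S"
  shows "(f has_vector_derivative deriv01 f x) (at x within {0..1})"
  using assms unfolding diff01_on_def deriv01_def by (auto simp: vector_derivative_works[symmetric])

lemma diff01_on_DERIV:
  assumes "diff01_on S f" "x \<in> S" "x \<in> {0<..<1}"
  shows "(f has_real_derivative deriv01 f x) (at x)"
proof -
  have "(f has_vector_derivative deriv01 f x) (at x within {0<..<1})"
    using diff01_on_has_vector_derivative[OF assms(1,2)] by (rule has_vector_derivative_within_subset) auto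
  moreover have "at x within {0<..<1} = at x" using assms(3) by (intro at_within_open) auto
  ultimately show ?thesis by (simp add: has_real_derivative_iff_has_vector_derivative)
qed

lemma deriv01_cong:
  assumes "open S" "x \<in> S" "x \<in> {0..1}" "\<And>y. y \<in> S \<Longrightarrow> y \<in> {0..1} \<Longrightarrow> f y = g y"
  shows "deriv01 f x = deriv01 g x"
  unfolding deriv01_def
proof (rule vector_derivative_cong_eq)
  show "\<forall>\<^sub>F x in nhds x. x \<in> {0..1} \<longrightarrow> f x = g x"
    using assms unfolding eventually_nhds by (intro exI[of _ S]) auto
qed (use assms in auto)

lemma deriv01_cong_01:
  assumes "\<And>y. y \<in> {0..1} \<Longrightarrow> f y = g y" "x \<in> {0..1}"
  shows "deriv01 f x = deriv01 g x"
  by (rule deriv01_cong[of UNIV]) (use assms in auto)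

text \<open>The fundamental theorem of calculus for \<open>deriv01\<close> itself: its arbitrary
  values at points without derivative fill a negligible set, outside which it equals the
  density.\<close>

lemma abs_cont_on_deriv01:
  assumes cd: "0 \<le> c" "c < d" "d \<le> 1" and ac: "abs_cont_on c d f"
  shows "deriv01 f absolutely_integrable_on {c..d}"
    and "\<And>x. x \<in> {c..d} \<Longrightarrow> (deriv01 f has_integral f x - f c) {c..x}"
    and "\<exists>N. negligible N \<and> (\<forall>x\<in>{c<..<d} - N. (f has_real_derivative deriv01 f x) (at x))"
proof -
  obtain g N where g: "integrable lborel g" "\<And>x. x \<in> {c..d} \<Longrightarrow> (g has_integral f x - f c) {c..x}"
    "negligible N" "\<And>x. x \<in> {c<..<d} - N \<Longrightarrow> (f has_real_derivative g x) (at x)"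
    using abs_cont_on_AE_derivative[OF cd(2) ac] by blast
  have eq: "deriv01 f x = g x" if "x \<in> {c<..<d} - N" for x
    using g(4)[OF that] cd that by (intro deriv01_DERIV) auto
  have neg: "negligible (N \<union> {c, d})" using g(3) by (simp add: negligible_insert)
  have "integrable lebesgue g" using g(1) by (simp add: integrable_completion)
  then have "g absolutely_integrable_on {c..d}"
    unfolding set_integrable_def by (intro integrable_mult_indicator) auto
  then show "deriv01 f absolutely_integrable_on {c..d}"
    by (rule absolutely_integrable_spike[OF _ neg]) (use eq in auto)
  show "(deriv01 f has_integral f x - f c) {c..x}" if "x \<in> {c..d}" for x
    by (rule has_integral_spike[OF neg _ g(2)[OF that]]) (use eq that in auto)
  show "\<exists>N. negligible N \<and> (\<forall>x\<in>{c<..<d} - N. (f has_real_derivative deriv01 f x) (at x))"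
    using g(3,4) eq by (intro exI[of _ N]) auto
qed

section \<open>Linearity of the second derivative\<close>

lemma H2a0_sdD:
  assumes "u \<in> H2a0_sd a"
  shows "abs_cont_on 0 1 u" "deriv01 u \<in> L2_01" "u 0 = 0" "u 1 = 0" "diff01_on {0<..1} u"
    "\<And>c. c \<in> {0<..<1} \<Longrightarrow> abs_cont_on c 1 (deriv01 u)" "deriv01 u 1 = 0"
    "(\<lambda>x. sqrt (a x) * deriv2_01 u x) \<in> L2_01"
  using assms by (auto simp: H2a0_sd_def H10_01_def H1_01_def)

text \<open>As a set of functions the weak space lies in the strong one, so facts shown for
  \<open>H2a0_sd\<close> serve both cases.\<close>

lemma H2a0_wdD:
  assumes "u \<in> H2a0_wd a"
  shows "u \<in> H2a0_sd a" "diff01_on {0..1} u" "abs_cont_on 0 1 (deriv01 u)" "deriv01 u 0 = 0"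
  using assms by (auto simp: H2a0_sd_def H2a0_wd_def diff01_on_def intro: abs_cont_on_subset)

lemma H2a0_sd: "u \<in> H2a0 a \<Longrightarrow> u \<in> H2a0_sd a"
  by (auto simp: H2a0_def H2a0_wdD split: if_splits)

lemma H2a0_sd_AE_deriv2:
  assumes "u \<in> H2a0_sd a"
  shows "\<exists>N. negligible N \<and> (\<forall>x\<in>{0<..<1} - N. (deriv01 u has_real_derivative deriv2_01 u x) (at x))"
proof -
  have "\<exists>N. negligible N \<and> (\<forall>x\<in>{c<..<1} - N. (deriv01 u has_real_derivative deriv2_01 u x) (at x))"
    if "c \<in> {0<..<1}" for c
    using that H2a0_sdD(6)[OF assms that] by (intro abs_cont_on_deriv01(3)) auto
  then obtain N where N: "\<And>c. c \<in> {0<..<1} \<Longrightarrow> negligible (N c)"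
     "\<And>c x. c \<in> {0<..<1} \<Longrightarrow> x \<in> {c<..<1} - N c \<Longrightarrow> (deriv01 u has_real_derivative deriv2_01 u x) (at x)"
    by metis
  \<comment> \<open>\<open>deriv01 u\<close> is absolutely continuous only away from 0, so countably
    many left endpoints tending to 0 are used. The shift by 2 keeps all of them strictly below
    1.\<close>
  let ?c = "\<lambda>n::nat. inverse (real (Suc (Suc n)))"
  have c: "?c n \<in> {0<..<1}" for n by (auto simp: inverse_less_1_iff)
  show ?thesis
  proof (intro exI conjI ballI)
    show "negligible (\<Union>n. N (?c n))" using N(1)[OF c] by (intro negligible_Union_nat) auto
    fix x assume x: "x \<in> {0<..<1} - (\<Union>n. N (?c n))"
    then obtain n where "inverse (real (Suc n)) < x" using reals_Archimedean[of x] by auto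
    moreover have "?c n \<le> inverse (real (Suc n))" by (simp add: field_simps)
    ultimately have "?c n < x" by (rule le_less_trans[rotated])
    then show "(deriv01 u has_real_derivative deriv2_01 u x) (at x)"
      using N(2)[OF c[of n], of x] x by auto
  qed
qed

lemma deriv01_lincomb:
  assumes "diff01_on S u" "diff01_on S v" "x \<in> S" "x \<in> {0..1}"
  shows "deriv01 (\<lambda>x. \<alpha> * u x + \<beta> * v x) x = \<alpha> * deriv01 u x + \<beta> * deriv01 v x"
  using assms diff01_on_has_vector_derivative
  by (intro deriv01_eq) (auto intro!: derivative_eq_intros)

lemma diff01_on_lincomb:
  "diff01_on S u \<Longrightarrow> diff01_on S v \<Longrightarrow> diff01_on S (\<lambda>x. \<alpha> * u x + \<beta> * v x)"
  unfolding diff01_on_def by (auto intro!: differentiable_add differentiable_mult)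

text \<open>Linearity can fail where \<open>deriv01 u\<close> or \<open>deriv01 v\<close> has no
  derivative, since \<open>deriv2_01\<close> is arbitrary there; hence the exceptional null
  set.\<close>

lemma AE_deriv2_01_lincomb:
  assumes "u \<in> H2a0_sd a" "v \<in> H2a0_sd a"
  shows "AE x in leb01. deriv2_01 (\<lambda>x. \<alpha> * u x + \<beta> * v x) x = \<alpha> * deriv2_01 u x + \<beta> * deriv2_01 v x"
proof -
  obtain N M where N: "negligible N" "\<And>x. x \<in> {0<..<1} - N \<Longrightarrow> (deriv01 u has_real_derivative deriv2_01 u x) (at x)"
    and M: "negligible M" "\<And>x. x \<in> {0<..<1} - M \<Longrightarrow> (deriv01 v has_real_derivative deriv2_01 v x) (at x)"
    using H2a0_sd_AE_deriv2 assms by metis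
  show ?thesis
  proof (rule AE_leb01_negligible)
    show "negligible (N \<union> M)" using N M by simp
    fix x assume x: "x \<in> {0<..<1} - (N \<union> M)"
    have "deriv2_01 (\<lambda>x. \<alpha> * u x + \<beta> * v x) x = deriv01 (\<lambda>x. \<alpha> * deriv01 u x + \<beta> * deriv01 v x) x"
      by (rule deriv01_cong[of "{0<..<1}"], use x assms in auto)
        (intro deriv01_lincomb[of "{0<..1}"] H2a0_sdD; auto)
    also have "\<dots> = \<alpha> * deriv2_01 u x + \<beta> * deriv2_01 v x"
      using x N(2)[of x] M(2)[of x] by (intro deriv01_DERIV) (auto intro!: derivative_eq_intros)
    finally show "deriv2_01 (\<lambda>x. \<alpha> * u x + \<beta> * v x) x = \<alpha> * deriv2_01 u x + \<beta> * deriv2_01 v x" .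
  qed
qed

lemma abs_cont_on_cong:
  assumes "abs_cont_on c d f" "\<And>x. c \<le> x \<Longrightarrow> x \<le> d \<Longrightarrow> f x = g x"
  shows "abs_cont_on c d g"
  by (rule abs_cont_on_bound2[OF assms(1) assms(1), of 1]) (use assms(2) in auto)

lemma H2a0_sd_lincomb:
  assumes u: "u \<in> H2a0_sd a" and v: "v \<in> H2a0_sd a"
  shows "(\<lambda>x. \<alpha> * u x + \<beta> * v x) \<in> H2a0_sd a"
proof -
  note U = H2a0_sdD[OF u] and V = H2a0_sdD[OF v]
  let ?w = "\<lambda>x. \<alpha> * u x + \<beta> * v x"
  have d: "deriv01 ?w x = \<alpha> * deriv01 u x + \<beta> * deriv01 v x" if "x \<in> {0<..1}" for x
    using U V that by (intro deriv01_lincomb[of "{0<..1}"]) auto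
  have "deriv01 ?w \<in> L2_01"
    by (rule L2_01_cong_AE[OF L2_01_lincomb[OF U(2) V(2), of \<alpha> \<beta>]]) (rule AE_I2, use d in auto)
  moreover have "abs_cont_on c 1 (deriv01 ?w)" if "c \<in> {0<..<1}" for c
    by (rule abs_cont_on_cong[OF abs_cont_on_lincomb[OF U(6)[OF that] V(6)[OF that], of \<alpha> \<beta>]])
      (use d that in auto)
  moreover have "(\<lambda>x. sqrt (a x) * deriv2_01 ?w x) \<in> L2_01"
  proof (rule L2_01_cong_AE[OF L2_01_lincomb[OF U(8) V(8), of \<alpha> \<beta>]])
    show "AE x in leb01. \<alpha> * (sqrt (a x) * deriv2_01 u x) + \<beta> * (sqrt (a x) * deriv2_01 v x) = sqrt (a x) * deriv2_01 ?w x"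
      using AE_deriv2_01_lincomb[OF u v, of \<alpha> \<beta>] by eventually_elim (simp add: algebra_simps)
  qed
  ultimately show ?thesis
    using U V d by (auto simp: H2a0_sd_def H10_01_def H1_01_def intro: diff01_on_lincomb abs_cont_on_lincomb)
qed

lemma H2a0_lincomb:
  assumes u: "u \<in> H2a0 a" and v: "v \<in> H2a0 a"
  shows "(\<lambda>x. \<alpha> * u x + \<beta> * v x) \<in> H2a0 a"
proof (cases "weakly_degenerate a")
  case False
  then show ?thesis using u v H2a0_sd_lincomb by (auto simp: H2a0_def)
next
  case True
  let ?w = "\<lambda>x. \<alpha> * u x + \<beta> * v x"
  have wd: "u \<in> H2a0_wd a" "v \<in> H2a0_wd a" using u v True by (auto simp: H2a0_def)
  note U = H2a0_wdD[OF wd(1)] and V = H2a0_wdD[OF wd(2)]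
  have d: "deriv01 ?w x = \<alpha> * deriv01 u x + \<beta> * deriv01 v x" if "x \<in> {0..1}" for x
    using U V that by (intro deriv01_lincomb[of "{0..1}"]) auto
  have "abs_cont_on 0 1 (deriv01 ?w)"
    by (rule abs_cont_on_cong[OF abs_cont_on_lincomb[OF U(3) V(3), of \<alpha> \<beta>]]) (use d in auto)
  then show ?thesis
    using H2a0_sd_lincomb[OF U(1) V(1), of \<alpha> \<beta>] U V d True
    by (auto simp: H2a0_def H2a0_sd_def H2a0_wd_def intro: diff01_on_lincomb)
qed

no_notation eqpoll (infixl \<open>\<approx>\<close> 50)

section \<open>Inner product\<close>

text \<open>The weight is split into square roots, one for each factor, so that membership in
  \<open>H0\<close> is square integrability of \<open>bend\<close> and the inner product is a sum of
  two \<open>L2\<close> products.\<close>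

definition bend :: "(real \<Rightarrow> real) \<Rightarrow> state \<Rightarrow> real \<Rightarrow> real" where
  "bend a U x = sqrt (a x) * deriv2_01 (fst U) x"

definition ip :: "(real \<Rightarrow> real) \<Rightarrow> state \<Rightarrow> state \<Rightarrow> real" where
  "ip a U V = (LINT x|leb01. bend a U x * bend a V x) + (LINT x|leb01. snd U x * snd V x)"

lemma H0D:
  assumes "U \<in> H0 a"
  shows "fst U \<in> H2a0_sd a" "bend a U \<in> L2_01" "snd U \<in> L2_01"
  using assms H2a0_sdD(8)[OF H2a0_sd[of "fst U" a]] H2a0_sd[of "fst U" a]
  by (auto simp: H0_def bend_def[abs_def])

lemma lincomb_H0: "U \<in> H0 a \<Longrightarrow> V \<in> H0 a \<Longrightarrow> lincomb \<alpha> U \<beta> V \<in> H0 a"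
  by (auto simp: H0_def lincomb_def intro: H2a0_lincomb L2_01_lincomb)

lemma state_diff_H0: "U \<in> H0 a \<Longrightarrow> V \<in> H0 a \<Longrightarrow> state_diff U V \<in> H0 a"
  unfolding state_diff_def by (rule lincomb_H0)

lemma state_eq_refl [simp]: "U \<approx> U"
  by (simp add: state_eq_def)

lemma state_eq_sym: "U \<approx> V \<Longrightarrow> V \<approx> U"
  by (auto simp: state_eq_def elim: AE_mp)

lemma state_eq_trans [trans]: "U \<approx> V \<Longrightarrow> V \<approx> W \<Longrightarrow> U \<approx> W"
  by (auto simp: state_eq_def elim!: AE_mp)

lemma lincomb_cong:
  assumes "U \<approx> U'" "V \<approx> V'" shows "lincomb \<alpha> U \<beta> V \<approx> lincomb \<alpha> U' \<beta> V'"
proof -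
  have "AE x in leb01. snd U x = snd U' x" "AE x in leb01. snd V x = snd V' x"
    using assms by (auto simp: state_eq_def)
  then have "AE x in leb01. \<alpha> * snd U x + \<beta> * snd V x = \<alpha> * snd U' x + \<beta> * snd V' x"
    by eventually_elim simp
  then show ?thesis using assms by (auto simp: state_eq_def lincomb_def)
qed

lemma deriv2_01_cong:
  assumes "\<And>y. y \<in> {0..1} \<Longrightarrow> u y = w y" "x \<in> {0..1}"
  shows "deriv2_01 u x = deriv2_01 w x"
  using assms by (intro deriv01_cong_01 deriv01_cong_01[of u w]) auto

lemma ip_cong:
  assumes "U \<approx> U'" "V \<approx> V'"
  shows "ip a U V = ip a U' V'"
proof -
  have AE: "AE x in leb01. snd U x = snd U' x" "AE x in leb01. snd V x = snd V' x"
    using assms by (auto simp: state_eq_def)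
  have "bend a U x = bend a U' x" "bend a V x = bend a V' x" if "x \<in> {0..1}" for x
    using deriv2_01_cong[of "fst U" "fst U'" x] deriv2_01_cong[of "fst V" "fst V'" x] assms that
    by (simp_all add: bend_def state_eq_def)
  then have "(LINT x|leb01. bend a U x * bend a V x) = (LINT x|leb01. bend a U' x * bend a V' x)"
    by (intro Bochner_Integration.integral_cong) auto
  moreover have "(LINT x|leb01. snd U x * snd V x) = (LINT x|leb01. snd U' x * snd V' x)"
    by (rule integral_leb01_cong_AE) (use AE in eventually_elim, simp)
  ultimately show ?thesis by (simp add: ip_def)
qed

lemma ip_sym: "ip a U V = ip a V U"
  by (simp add: ip_def mult.commute)

lemma AE_bend_lincomb:
  assumes "U \<in> H0 a" "V \<in> H0 a"
  shows "AE x in leb01. bend a (lincomb \<alpha> U \<beta> V) x = \<alpha> * bend a U x + \<beta> * bend a V x"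
  using AE_deriv2_01_lincomb[OF H0D(1)[OF assms(1)] H0D(1)[OF assms(2)], of \<alpha> \<beta>]
  by eventually_elim (simp add: bend_def lincomb_def algebra_simps)

lemma ip_lincomb_left:
  assumes "U \<in> H0 a" "V \<in> H0 a" "W \<in> H0 a"
  shows "ip a (lincomb \<alpha> U \<beta> V) W = \<alpha> * ip a U W + \<beta> * ip a V W"
proof -
  note i = L2_01_mult_integrable[OF H0D(2) H0D(2)] L2_01_mult_integrable[OF H0D(3) H0D(3)]
  have "(LINT x|leb01. bend a (lincomb \<alpha> U \<beta> V) x * bend a W x)
      = (LINT x|leb01. \<alpha> * (bend a U x * bend a W x) + \<beta> * (bend a V x * bend a W x))"
    by (rule integral_leb01_cong_AE)
      (use AE_bend_lincomb[OF assms(1,2), of \<alpha> \<beta>] in eventually_elim, simp add: algebra_simps)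
  also have "\<dots> = \<alpha> * (LINT x|leb01. bend a U x * bend a W x) + \<beta> * (LINT x|leb01. bend a V x * bend a W x)"
    using i assms by simp
  finally have 1: "(LINT x|leb01. bend a (lincomb \<alpha> U \<beta> V) x * bend a W x) = \<dots>" .
  have "(LINT x|leb01. snd (lincomb \<alpha> U \<beta> V) x * snd W x)
      = (LINT x|leb01. \<alpha> * (snd U x * snd W x) + \<beta> * (snd V x * snd W x))"
    by (simp add: lincomb_def algebra_simps)
  also have "\<dots> = \<alpha> * (LINT x|leb01. snd U x * snd W x) + \<beta> * (LINT x|leb01. snd V x * snd W x)"
    using i assms by simp
  finally show ?thesis using 1 by (simp add: ip_def algebra_simps)
qed

lemma ip_lincomb_right:
  assumes "U \<in> H0 a" "V \<in> H0 a" "W \<in> H0 a"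
  shows "ip a W (lincomb \<alpha> U \<beta> V) = \<alpha> * ip a W U + \<beta> * ip a W V"
  using ip_lincomb_left[OF assms] by (simp add: ip_sym)

lemma ip_nonneg: "0 \<le> ip a U U"
  unfolding ip_def by (intro add_nonneg_nonneg Bochner_Integration.integral_nonneg) auto

lemma H0_norm_ip:
  assumes "\<forall>x\<in>{0<..1}. a x > 0"
  shows "H0_norm a U = sqrt (ip a U U)"
proof -
  have "a x * (deriv2_01 (fst U) x)\<^sup>2 = bend a U x * bend a U x" if "x \<in> {0<..<1}" for x
  proof -
    have "0 \<le> a x" using assms that by (auto intro!: less_imp_le)
    then have "sqrt (a x) * sqrt (a x) = a x" by simp
    then show ?thesis unfolding bend_def power2_eq_square by (metis mult.assoc mult.commute)
  qed
  then have "(LINT x|leb01. a x * (deriv2_01 (fst U) x)\<^sup>2) = (LINT x|leb01. bend a U x * bend a U x)"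
    by (intro Bochner_Integration.integral_cong) auto
  then show ?thesis by (simp add: H0_norm_def ip_def power2_eq_square)
qed

locale positive_coefficient =
  fixes a :: "real \<Rightarrow> real"
  assumes pos: "\<forall>x\<in>{0<..1}. a x > 0"
begin

lemma norm_sq: "(H0_norm a U)\<^sup>2 = ip a U U"
  by (simp add: H0_norm_ip[OF pos] ip_nonneg)

lemma norm_nonneg: "0 \<le> H0_norm a U"
  by (simp add: H0_norm_ip[OF pos] ip_nonneg)

lemma norm_cong: "U \<approx> V \<Longrightarrow> H0_norm a U = H0_norm a V"
  by (simp add: H0_norm_ip[OF pos] ip_cong)

lemma norm_sq_lincomb:
  assumes "U \<in> H0 a" "V \<in> H0 a"
  shows "(H0_norm a (lincomb \<alpha> U \<beta> V))\<^sup>2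
    = \<alpha>\<^sup>2 * (H0_norm a U)\<^sup>2 + 2 * \<alpha> * \<beta> * ip a U V + \<beta>\<^sup>2 * (H0_norm a V)\<^sup>2"
  unfolding norm_sq using assms by (simp add: ip_lincomb_left ip_lincomb_right lincomb_H0 ip_sym[of a V U]
      power2_eq_square algebra_simps)

text \<open>The usual discriminant argument; on representatives the norm may vanish for a nonzero
  \<open>V\<close>, which is why that case is treated separately.\<close>

lemma Cauchy_Schwarz:
  assumes "U \<in> H0 a" "V \<in> H0 a"
  shows "\<bar>ip a U V\<bar> \<le> H0_norm a U * H0_norm a V"
proof -
  let ?A = "H0_norm a U" and ?B = "H0_norm a V"
  have nn: "0 \<le> \<alpha>\<^sup>2 * ?A\<^sup>2 + 2 * \<alpha> * \<beta> * ip a U V + \<beta>\<^sup>2 * ?B\<^sup>2" for \<alpha> \<beta>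
    using norm_sq_lincomb[OF assms, of \<alpha> \<beta>] by (metis zero_le_power2)
  have "(ip a U V)\<^sup>2 \<le> (?A * ?B)\<^sup>2"
  proof (cases "?B = 0")
    case False
    then have "0 < ?B\<^sup>2" by simp
    \<comment> \<open>The two coefficients are the minimising combination, cleared of
      denominators.\<close>
    have "0 \<le> ?B\<^sup>2 * (?B\<^sup>2 * ?A\<^sup>2 - (ip a U V)\<^sup>2)"
      using nn[of "?B\<^sup>2" "- ip a U V"] by (simp add: power2_eq_square algebra_simps)
    then have "0 \<le> ?B\<^sup>2 * ?A\<^sup>2 - (ip a U V)\<^sup>2"
      using \<open>0 < ?B\<^sup>2\<close> by (simp add: zero_le_mult_iff)
    then show ?thesis by (simp add: power_mult_distrib mult.commute)
  next
    case True
    have "ip a U V = 0"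
    proof (rule ccontr)
      assume "ip a U V \<noteq> 0"
      have "0 \<le> ?A\<^sup>2 + 2 * \<beta> * ip a U V" for \<beta> using nn[of 1 \<beta>] True by simp
      \<comment> \<open>With this \<open>\<beta>\<close> the affine expression takes the value
        -1.\<close>
      from this[of "- (?A\<^sup>2 + 1) / (2 * ip a U V)"] show False
        using \<open>ip a U V \<noteq> 0\<close> by (simp add: field_simps)
    qed
    then show ?thesis by simp
  qed
  then show ?thesis
    by (metis abs_le_square_iff abs_of_nonneg mult_nonneg_nonneg norm_nonneg)
qed

lemma norm_triangle:
  assumes "U \<in> H0 a" "V \<in> H0 a"
  shows "H0_norm a (lincomb \<alpha> U \<beta> V) \<le> \<bar>\<alpha>\<bar> * H0_norm a U + \<bar>\<beta>\<bar> * H0_norm a V"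
proof (rule power2_le_imp_le)
  have "\<alpha> * \<beta> * ip a U V \<le> \<bar>\<alpha>\<bar> * \<bar>\<beta>\<bar> * \<bar>ip a U V\<bar>" by (metis abs_ge_self abs_mult)
  also have "\<dots> \<le> \<bar>\<alpha>\<bar> * \<bar>\<beta>\<bar> * (H0_norm a U * H0_norm a V)"
    by (intro mult_left_mono Cauchy_Schwarz assms) auto
  finally show "(H0_norm a (lincomb \<alpha> U \<beta> V))\<^sup>2 \<le> (\<bar>\<alpha>\<bar> * H0_norm a U + \<bar>\<beta>\<bar> * H0_norm a V)\<^sup>2"
    unfolding norm_sq_lincomb[OF assms] by (simp add: power2_sum power_mult_distrib algebra_simps)
qed (simp add: norm_nonneg)

end

section \<open>Skew symmetry\<close>

lemma integrable_leb01_integral: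
  fixes f :: "real \<Rightarrow> real"
  assumes "integrable leb01 f"
  shows "f integrable_on {0..1}" "integral\<^sup>L leb01 f = integral {0..1} f"
proof -
  have "f integrable_on {0<..<1}" using assms by (intro integrable_on_lebesgue_on) auto
  then show "f integrable_on {0..1}" by (simp add: integrable_on_Icc_iff_Ioo)
  show "integral\<^sup>L leb01 f = integral {0..1} f"
    using lebesgue_integral_eq_integral[OF assms] by (simp add: integral_open_interval_real)
qed

text \<open>Otherwise \<open>\<bar>g\<bar>\<close> dominates \<open>k / x\<close> near 0, so that
  \<open>g\<close> squared has integral at least \<open>k^2 / (4 s)\<close> over
  \<open>{s<..<2 * s}\<close>, which is unbounded as \<open>s\<close> tends to 0.\<close>

lemma L2_01_liminf_at_0:
  assumes g: "g \<in> L2_01" and "0 < \<eta>" "0 < k"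
  shows "\<exists>c. 0 < c \<and> c < \<eta> \<and> c * \<bar>g c\<bar> < k"
proof (rule ccontr)
  assume contr: "\<not> ?thesis"
  then have ge: "k \<le> c * \<bar>g c\<bar>" if "0 < c" "c < \<eta>" for c using that contr by (meson not_le)
  define I where "I = (LINT x|leb01. (g x)\<^sup>2)"
  have "0 \<le> I" by (simp add: I_def)
  \<comment> \<open>The first bound keeps \<open>{s<..<2 * s}\<close> below both 1 and
    \<open>\<eta>\<close>; the second makes \<open>k^2 / (4 s)\<close> at least
    \<open>I + 1\<close>, contradicting the bound \<open>I\<close>.\<close>
  define s where "s = min (min 1 \<eta> / 2) (k\<^sup>2 / (4 * (I + 1)))"
  have s: "0 < s" "2 * s \<le> 1" "2 * s \<le> \<eta>" "s \<le> k\<^sup>2 / (4 * (I + 1))"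
  proof -
    have "s \<le> min 1 \<eta> / 2" unfolding s_def by (rule min.cobounded1)
    then show "2 * s \<le> 1" "2 * s \<le> \<eta>" by auto
    show "s \<le> k\<^sup>2 / (4 * (I + 1))" unfolding s_def by (rule min.cobounded2)
    have "0 < min 1 \<eta> / 2" "0 < k\<^sup>2 / (4 * (I + 1))" using assms \<open>0 \<le> I\<close> by auto
    then show "0 < s" unfolding s_def by (simp only: min_less_iff_conj)
  qed
  have "(LINT x|leb01. k\<^sup>2 / (4 * s\<^sup>2) * indicator {s<..<2 * s} x) \<le> I"
    unfolding I_def
  proof (rule integral_mono)
    have fin: "finite_measure leb01" by (intro finite_measureI) (simp add: emeasure_restrict_space)
    show "integrable leb01 (\<lambda>x. k\<^sup>2 / (4 * s\<^sup>2) * indicator {s<..<2 * s} x)"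
      using finite_measure.emeasure_finite[OF fin]
      by (intro integrable_mult_right integrable_real_indicator)
        (use s in \<open>auto simp: sets_restrict_space less_top intro!: image_eqI[of _ _ "{s<..<2 * s}"]\<close>)
    show "integrable leb01 (\<lambda>x. (g x)\<^sup>2)" using g by (simp add: L2_01_def)
    fix x assume "x \<in> space leb01"
    show "k\<^sup>2 / (4 * s\<^sup>2) * indicator {s<..<2 * s} x \<le> (g x)\<^sup>2"
    proof (cases "x \<in> {s<..<2 * s}")
      case True
      then have "k \<le> x * \<bar>g x\<bar>" using s by (intro ge) auto
      also have "\<dots> \<le> 2 * s * \<bar>g x\<bar>" using True by (intro mult_right_mono) auto
      finally have "k / (2 * s) \<le> \<bar>g x\<bar>" using s by (simp add: field_simps)
      then have "(k / (2 * s))\<^sup>2 \<le> \<bar>g x\<bar>\<^sup>2" using s assms by (intro power_mono) auto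
      then show ?thesis using True by (simp add: power_divide power_mult_distrib)
    qed simp
  qed
  moreover have "(LINT x|leb01. k\<^sup>2 / (4 * s\<^sup>2) * indicator {s<..<2 * s} x) = k\<^sup>2 / (4 * s\<^sup>2) * s"
  proof -
    have "{s<..<2 * s} \<inter> {0<..<1} = {s<..<2 * s}" using s by auto
    then have "measure leb01 ({s<..<2 * s} \<inter> {0<..<1}) = s"
      using s by (subst measure_restrict_space) auto
    then show ?thesis by simp
  qed
  ultimately have "k\<^sup>2 / (4 * s\<^sup>2) * s \<le> I" by (simp only:)
  then have "k\<^sup>2 / (4 * s) \<le> I" using s(1) by (simp add: power2_eq_square field_simps)
  then have "k\<^sup>2 \<le> 4 * s * I" using s by (simp add: field_simps)
  moreover have "4 * s * (I + 1) \<le> k\<^sup>2" using s \<open>0 \<le> I\<close> by (simp add: field_simps)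
  ultimately show False using s by (simp add: algebra_simps)
qed

lemma AE_flux_rep:
  assumes "u \<in> domA a"
  shows "H2_rep (\<lambda>x. a x * deriv2_01 u x) (flux a u)"
proof -
  have "\<exists>p. H2_rep (\<lambda>x. a x * deriv2_01 u x) p" using assms by (simp add: domA_def)
  then show ?thesis unfolding flux_def by (rule someI_ex)
qed

lemma H2_01D:
  assumes "p \<in> H2_01"
  shows "abs_cont_on 0 1 p" "deriv01 p \<in> L2_01" "diff01_on {0..1} p" "abs_cont_on 0 1 (deriv01 p)" "deriv2_01 p \<in> L2_01"
  using assms by (auto simp: H2_01_def H1_01_def)

text \<open>Writing \<open>p = a u''\<close>, one has \<open>(v' p - v p')' = v'' p - v p''\<close>, so only the boundary term \<open>v' p\<close> at 0
  matters. In the strongly degenerate case \<open>p x = O(x)\<close>, and a nonzero limit of \<open>v' p\<close> would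
  force \<open>v'\<close> to grow like \<open>1 / x\<close>, contradicting its square integrability.\<close>

lemma opA_symmetric:
  assumes deg: "weakly_degenerate a \<or> strongly_degenerate a" and pos: "\<forall>x\<in>{0<..1}. a x > 0"
    and u: "u \<in> domA a" and v: "v \<in> H2a0 a"
  shows "(LINT x|leb01. (sqrt (a x) * deriv2_01 u x) * (sqrt (a x) * deriv2_01 v x)) = (LINT x|leb01. v x * opA a u x)"
proof -
  define p where "p = flux a u"
  have p: "p \<in> H2_01" "AE x in leb01. p x = a x * deriv2_01 u x"
    using AE_flux_rep[OF u] by (auto simp: p_def H2_rep_def)
  note P = H2_01D[OF p(1)]
  note V = H2a0_sdD[OF H2a0_sd[OF v]]
  have U: "u \<in> H2a0_sd a" using u by (auto simp: domA_def intro: H2a0_sd)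
  define F1 where "F1 = (\<lambda>x. deriv2_01 v x * p x)"
  define F2 where "F2 = (\<lambda>x. v x * deriv2_01 p x)"
  define F where "F = (\<lambda>x. F1 x - F2 x)"
  have F1eq: "AE x in leb01. (sqrt (a x) * deriv2_01 u x) * (sqrt (a x) * deriv2_01 v x) = F1 x"
  proof -
    have "AE x in leb01. x \<in> {0<..<1}" by (rule AE_I2) simp
    with p(2) show ?thesis
    proof eventually_elim
      case (elim x)
      then have "0 \<le> a x" using pos by (auto intro!: less_imp_le)
      then have "sqrt (a x) * sqrt (a x) = a x" by simp
      then show ?case unfolding F1_def elim(1) by (metis mult.assoc mult.commute)
    qed
  qed
  have i1: "integrable leb01 F1"
    by (rule integrable_leb01_cong_AE[OF L2_01_mult_integrable[OF H2a0_sdD(8)[OF U] V(8)] F1eq])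
  have i2: "integrable leb01 F2"
    unfolding F2_def by (rule L2_01_mult_integrable[OF L2_01_continuous[OF abs_cont_on_imp_continuous[OF V(1)]] P(5)])
  have iF: "integrable leb01 F" unfolding F_def using i1 i2 by simp
  \<comment> \<open>The antiderivative \<open>v' p - v p'\<close> of \<open>F\<close>, written with
    explicit coefficients to fit \<open>abs_cont_on_lincomb\<close>. It is absolutely continuous
    only on \<open>{c..1}\<close> with \<open>c > 0\<close>, hence the limit towards 0
    below.\<close>
  define W where "W = (\<lambda>x. 1 * (deriv01 v x * p x) + (-1) * (v x * deriv01 p x))"
  have W1: "W 1 = 0" using V by (simp add: W_def)
  have intF: "(F has_integral - W c) {c..1}" if c: "c \<in> {0<..<1}" for c
  proof -
    have "abs_cont_on c 1 W"
      unfolding W_def using c V(1,6) P(1,4)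
      by (intro abs_cont_on_lincomb abs_cont_on_mult) (auto intro: abs_cont_on_subset)
    from abs_cont_on_deriv01(2)[OF _ _ _ this, of 1] have *: "(deriv01 W has_integral W 1 - W c) {c..1}"
      using c by auto
    obtain N where N: "negligible N" "\<And>x. x \<in> {0<..<1} - N \<Longrightarrow> (deriv01 v has_real_derivative deriv2_01 v x) (at x)"
      using H2a0_sd_AE_deriv2[OF H2a0_sd[OF v]] by blast
    obtain M where M: "negligible M" "\<And>x. x \<in> {0<..<1} - M \<Longrightarrow> (deriv01 p has_real_derivative deriv2_01 p x) (at x)"
      using abs_cont_on_deriv01(3)[OF _ _ _ P(4)] by auto
    have "F x = deriv01 W x" if x: "x \<in> {c..1} - (N \<union> M \<union> {1})" for x
    proof -
      have x': "x \<in> {0<..<1}" using x c by auto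
      have "(W has_real_derivative F x) (at x)"
        unfolding W_def F_def F1_def F2_def
        using x x' N(2)[of x] M(2)[of x] diff01_on_DERIV[OF V(5), of x] diff01_on_DERIV[OF P(3), of x]
        by (auto intro!: derivative_eq_intros simp: algebra_simps)
      then show ?thesis using x' by (intro deriv01_DERIV[symmetric]) auto
    qed
    moreover have "negligible (N \<union> M \<union> {1})" using N(1) M(1) by simp
    moreover have "(deriv01 W has_integral - W c) {c..1}" using * W1 by simp
    ultimately show ?thesis by (metis has_integral_spike)
  qed
  have contI: "continuous_on {0..1} (\<lambda>c. integral {c..1} F)"
    using integrable_leb01_integral(1)[OF iF] by (rule indefinite_integral_continuous_1')
  \<comment> \<open>Integrability of \<open>F\<close> alone yields a limit of \<open>W\<close> at 0.
    The limit is also that of \<open>v' p\<close>, because \<open>v\<close> vanishes at 0; the claim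
    is equivalent to \<open>L = 0\<close>.\<close>
  define L where "L = - integral {0..1} F"
  have "((\<lambda>c. - integral {c..1} F) \<longlongrightarrow> L) (at_right 0)"
    using contI unfolding continuous_on_Icc_at_rightD L_def
    by (intro tendsto_minus continuous_on_Icc_at_rightD[OF contI]) auto
  then have "(W \<longlongrightarrow> L) (at_right 0)"
  proof (rule Lim_transform_eventually)
    have "eventually (\<lambda>c. c \<in> {0<..<1::real}) (at_right 0)"
      by (rule eventually_at_right_real) simp
    then show "eventually (\<lambda>c. - integral {c..1} F = W c) (at_right 0)"
      by eventually_elim (simp add: integral_unique[OF intF])
  qed
  moreover have "((\<lambda>c. v c * deriv01 p c) \<longlongrightarrow> v 0 * deriv01 p 0) (at_right 0)"
    by (intro tendsto_mult continuous_on_Icc_at_rightD[of 0 1] abs_cont_on_imp_continuous V P) auto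
  ultimately have "((\<lambda>c. W c + v c * deriv01 p c) \<longlongrightarrow> L + 0) (at_right 0)"
    using V(3) by (intro tendsto_add) auto
  then have lim: "((\<lambda>c. deriv01 v c * p c) \<longlongrightarrow> L) (at_right 0)" by (simp add: W_def)
  have "L = 0"
  proof (cases "weakly_degenerate a")
    case True
    then have "v \<in> H2a0_wd a" using v by (simp add: H2a0_def)
    note Vw = H2a0_wdD[OF this]
    have "((\<lambda>c. deriv01 v c * p c) \<longlongrightarrow> deriv01 v 0 * p 0) (at_right 0)"
      by (intro tendsto_mult continuous_on_Icc_at_rightD[of 0 1] abs_cont_on_imp_continuous Vw P) auto
    then show ?thesis using lim Vw(4) tendsto_unique[OF _ lim] by fastforce
  next
    case False
    then have p0: "p 0 = 0" using u deg by (auto simp: domA_def p_def)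
    have "bounded (deriv01 p ` {0..1})"
      by (intro compact_imp_bounded compact_continuous_image abs_cont_on_imp_continuous P) auto
    then obtain M where M: "\<And>x. x \<in> {0..1} \<Longrightarrow> \<bar>deriv01 p x\<bar> \<le> M"
      by (auto simp: bounded_iff simp del: atLeastAtMost_iff)
    then have "0 \<le> M" by (meson abs_ge_zero atLeastAtMost_iff order_refl order_trans zero_le_one)
    have pb: "\<bar>p c\<bar> \<le> M * c" if "c \<in> {0..1}" for c
    proof -
      have "(deriv01 p has_integral p c - p 0) {0..c}"
        using that by (intro abs_cont_on_deriv01(2)[OF _ _ _ P(1)]) auto
      from has_integral_bound_real[OF \<open>0 \<le> M\<close> finite.emptyI this] show ?thesis using M that p0 by auto
    qed
    show ?thesis
    proof (rule ccontr)
      assume "L \<noteq> 0"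
      then have "eventually (\<lambda>c. dist (deriv01 v c * p c) L < \<bar>L\<bar> / 2) (at_right 0)"
        using lim by (intro tendstoD) auto
      then obtain b where b: "b > 0" "\<And>c. 0 < c \<Longrightarrow> c < b \<Longrightarrow> dist (deriv01 v c * p c) L < \<bar>L\<bar> / 2"
        by (auto simp: eventually_at_right_field)
      \<comment> \<open>At such a point \<open>\<bar>p c\<bar> \<le> M * c\<close> bounds the
        product by \<open>\<bar>L\<bar> / 2\<close>, too small to lie within less than
        \<open>\<bar>L\<bar> / 2\<close> of \<open>L\<close>.\<close>
      obtain c where c: "0 < c" "c < min b 1" "c * \<bar>deriv01 v c\<bar> < \<bar>L\<bar> / (2 * (M + 1))"
        using L2_01_liminf_at_0[OF V(2), of "min b 1" "\<bar>L\<bar> / (2 * (M + 1))"] b \<open>L \<noteq> 0\<close> \<open>0 \<le> M\<close> by auto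
      have "\<bar>deriv01 v c * p c\<bar> \<le> \<bar>deriv01 v c\<bar> * (M * c)"
        unfolding abs_mult using pb c by (intro mult_left_mono) auto
      also have "\<dots> = M * (c * \<bar>deriv01 v c\<bar>)" by simp
      also have "\<dots> \<le> M * (\<bar>L\<bar> / (2 * (M + 1)))" using c \<open>0 \<le> M\<close> by (intro mult_left_mono) auto
      also have "\<dots> \<le> \<bar>L\<bar> / 2" using \<open>0 \<le> M\<close> by (simp add: field_simps)
      finally have "\<bar>deriv01 v c * p c\<bar> \<le> \<bar>L\<bar> / 2" .
      moreover have "dist (deriv01 v c * p c) L < \<bar>L\<bar> / 2" using b(2)[of c] c by simp
      ultimately show False unfolding dist_real_def by linarith
    qed
  qed
  then have "(LINT x|leb01. F1 x) = (LINT x|leb01. F2 x)"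
    using integrable_leb01_integral(2)[OF iF] i1 i2 by (simp add: L_def F_def)
  moreover have "(LINT x|leb01. (sqrt (a x) * deriv2_01 u x) * (sqrt (a x) * deriv2_01 v x)) = (LINT x|leb01. F1 x)"
    by (rule integral_leb01_cong_AE[OF F1eq])
  ultimately show ?thesis by (simp add: F2_def opA_def p_def)
qed

lemma degenerate_pos:
  "weakly_degenerate a \<or> strongly_degenerate a \<Longrightarrow> \<forall>x\<in>{0<..1}. a x > 0"
  by (auto simp: weakly_degenerate_def strongly_degenerate_def)

lemma calA_H0:
  assumes "U \<in> dom_calA a"
  shows "U \<in> H0 a" "calA a U \<in> H0 a"
proof -
  have u: "fst U \<in> domA a" "snd U \<in> H2a0 a" using assms by (auto simp: dom_calA_def)
  have "snd U \<in> L2_01"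
    using H2a0_sdD(1)[OF H2a0_sd[OF u(2)]] by (intro L2_01_continuous abs_cont_on_imp_continuous)
  then show "U \<in> H0 a" using u by (auto simp: H0_def domA_def mem_Times_iff)
  have "opA a (fst U) \<in> L2_01"
    using AE_flux_rep[OF u(1)] H2_01D(5) by (auto simp: H2_rep_def opA_def)
  then have "(\<lambda>x. - opA a (fst U) x) \<in> L2_01" using L2_01_lincomb[of _ _ "-1" 0] by fastforce
  then show "calA a U \<in> H0 a" using u by (simp add: H0_def calA_def)
qed

text \<open>For \<open>U = (u, v)\<close> the two summands are the integrals of
  \<open>a u'' v''\<close> and of \<open>- v\<close> times \<open>opA a u\<close>, which cancel by
  \<open>opA_symmetric\<close>.\<close>

lemma ip_calA:
  assumes "weakly_degenerate a \<or> strongly_degenerate a" "U \<in> dom_calA a"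
  shows "ip a U (calA a U) = 0"
  using opA_symmetric[OF assms(1) degenerate_pos[OF assms(1)], of "fst U" "snd U"] assms(2)
  by (auto simp: ip_def calA_def bend_def dom_calA_def)

section \<open>Conservation of the norm\<close>

locale beam_semigroup = positive_coefficient +
  fixes T :: "real \<Rightarrow> state \<Rightarrow> state"
  assumes deg: "weakly_degenerate a \<or> strongly_degenerate a"
    and csg: "contraction_semigroup a T" and gen: "generated_by_calA a T"
begin

lemma T_H0: "0 \<le> t \<Longrightarrow> U \<in> H0 a \<Longrightarrow> T t U \<in> H0 a"
  and T_lincomb: "0 \<le> t \<Longrightarrow> U \<in> H0 a \<Longrightarrow> V \<in> H0 a \<Longrightarrow>
        T t (lincomb \<alpha> U \<beta> V) \<approx> lincomb \<alpha> (T t U) \<beta> (T t V)"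
  and T_0: "U \<in> H0 a \<Longrightarrow> T 0 U \<approx> U"
  and T_add: "0 \<le> s \<Longrightarrow> 0 \<le> t \<Longrightarrow> U \<in> H0 a \<Longrightarrow> T (s + t) U \<approx> T s (T t U)"
  and T_norm: "0 \<le> t \<Longrightarrow> U \<in> H0 a \<Longrightarrow> H0_norm a (T t U) \<le> H0_norm a U"
  using csg unfolding contraction_semigroup_def by blast+

lemma generator:
  assumes "U \<in> H0 a" "V \<in> H0 a"
  shows "generator_limit a T U V \<longleftrightarrow> (\<exists>U'\<in>dom_calA a. U \<approx> U' \<and> V \<approx> calA a U')"
  using gen assms unfolding generated_by_calA_def by blast

text \<open>The error of the forward difference quotient against a candidate derivative
  \<open>V\<close>, kept literally equal to the state inside \<open>generator_limit\<close>.\<close>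

definition residual :: "state \<Rightarrow> state \<Rightarrow> real \<Rightarrow> state" where
  "residual U V h = state_diff (lincomb (1 / h) (T h U) (- (1 / h)) U) V"

lemma residual_H0: "U \<in> H0 a \<Longrightarrow> V \<in> H0 a \<Longrightarrow> 0 \<le> h \<Longrightarrow> residual U V h \<in> H0 a"
  unfolding residual_def by (intro state_diff_H0 lincomb_H0 T_H0)

text \<open>\<open>T t\<close> is linear and commutes with \<open>T h\<close>, both modulo
  \<open>\<approx>\<close>.\<close>

lemma residual_T:
  assumes UV: "U \<in> H0 a" "V \<in> H0 a" and th: "0 \<le> t" "0 \<le> h"
  shows "residual (T t U) (T t V) h \<approx> T t (residual U V h)"
proof -
  have "T h (T t U) \<approx> T (h + t) U" using UV th by (intro state_eq_sym[OF T_add])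
  also have "T (h + t) U \<approx> T t (T h U)" using T_add[OF th UV(1)] by (simp add: add.commute)
  finally have 1: "T h (T t U) \<approx> T t (T h U)" .
  have "lincomb (1 / h) (T h (T t U)) (- (1 / h)) (T t U) \<approx> lincomb (1 / h) (T t (T h U)) (- (1 / h)) (T t U)"
    by (intro lincomb_cong 1) simp
  also have "\<dots> \<approx> T t (lincomb (1 / h) (T h U) (- (1 / h)) U)"
    using UV th by (intro state_eq_sym[OF T_lincomb] T_H0)
  finally have "residual (T t U) (T t V) h \<approx> lincomb 1 (T t (lincomb (1 / h) (T h U) (- (1 / h)) U)) (-1) (T t V)"
    unfolding residual_def state_diff_def by (rule lincomb_cong) (rule state_eq_refl)
  also have "\<dots> \<approx> T t (residual U V h)"
    unfolding residual_def state_diff_def using UV th by (intro state_eq_sym[OF T_lincomb] T_H0 lincomb_H0)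
  finally show ?thesis .
qed

lemma norm_residual_T:
  assumes UV: "U \<in> H0 a" "V \<in> H0 a" and th: "0 \<le> t" "0 \<le> h"
  shows "H0_norm a (residual (T t U) (T t V) h) \<le> H0_norm a (residual U V h)"
  using T_norm[OF th(1) residual_H0[OF UV th(2)]] norm_cong[OF residual_T[OF assms]] by simp

text \<open>Since residuals do not grow along the orbit, \<open>T t U\<close> has the generator
  limit \<open>T t (calA a U)\<close>. It thus has a representative in the domain, and skew symmetry
  applies to that representative.\<close>

lemma ip_generator_orbit:
  assumes U: "U \<in> dom_calA a" and t: "0 \<le> t"
  shows "ip a (T t U) (T t (calA a U)) = 0"
proof -
  note H = calA_H0[OF U]
  have "generator_limit a T U (calA a U)" using generator[OF H] U state_eq_refl by blast
  then have lim: "((\<lambda>h. H0_norm a (residual U (calA a U) h)) \<longlongrightarrow> 0) (at_right 0)"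
    unfolding generator_limit_def residual_def .
  have "((\<lambda>h. H0_norm a (residual (T t U) (T t (calA a U)) h)) \<longlongrightarrow> 0) (at_right 0)"
  proof (rule tendsto_sandwich[OF _ _ tendsto_const lim])
    have pos: "eventually (\<lambda>h::real. 0 < h) (at_right 0)" by (rule eventually_at_right_less)
    show "\<forall>\<^sub>F h in at_right 0. H0_norm a (residual (T t U) (T t (calA a U)) h) \<le> H0_norm a (residual U (calA a U) h)"
      using pos by eventually_elim (use H t in \<open>auto intro: norm_residual_T\<close>)
  qed (simp add: norm_nonneg)
  then have "generator_limit a T (T t U) (T t (calA a U))"
    unfolding generator_limit_def residual_def .
  then obtain U' where U': "U' \<in> dom_calA a" "T t U \<approx> U'" "T t (calA a U) \<approx> calA a U'"
    using generator T_H0 H t by blast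
  then show ?thesis using ip_cong[OF U'(2,3)] ip_calA[OF deg U'(1)] by simp
qed

text \<open>Since the residual of the difference quotient at \<open>T t U\<close> is the image under \<open>T t\<close> of the residual
  at \<open>U\<close>, the energy changes by \<open>o(h)\<close> over a time step \<open>h\<close>, uniformly in the starting time.\<close>

lemma energy_step:
  assumes U: "U \<in> dom_calA a" and t: "0 \<le> t" and h: "0 < h"
  defines "\<rho> \<equiv> H0_norm a (residual U (calA a U) h)"
  shows "\<bar>(H0_norm a (T (t + h) U))\<^sup>2 - (H0_norm a (T t U))\<^sup>2\<bar>
    \<le> h * (2 * H0_norm a U * \<rho> + h * (H0_norm a (calA a U) + \<rho>)\<^sup>2)"
proof -
  note H = calA_H0[OF U]
  let ?V = "calA a U"
  define W where "W = T t U"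
  define V where "V = T t ?V"
  define R where "R = residual W V h"
  have WV: "W \<in> H0 a" "V \<in> H0 a" using H t by (auto simp: W_def V_def intro: T_H0)
  have R: "R \<in> H0 a" using WV h by (auto simp: R_def intro: residual_H0)
  \<comment> \<open>Solving the definition of the residual for \<open>T h W\<close> shows that
    \<open>D\<close> is the exact increment of the orbit over the step.\<close>
  define D where "D = lincomb h V h R"
  have D: "D \<in> H0 a" unfolding D_def by (intro lincomb_H0 WV R)
  have "T (h + t) U \<approx> T h W" unfolding W_def using H t h by (intro T_add) auto
  also have "T h W \<approx> lincomb 1 W 1 D"
    using h by (auto simp: state_eq_def lincomb_def D_def R_def residual_def state_diff_def field_simps)
  finally have "H0_norm a (T (t + h) U) = H0_norm a (lincomb 1 W 1 D)"
    using norm_cong by (simp add: add.commute)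
  then have "(H0_norm a (T (t + h) U))\<^sup>2 = (H0_norm a W)\<^sup>2 + 2 * ip a W D + (H0_norm a D)\<^sup>2"
    using norm_sq_lincomb[OF WV(1) D, of 1 1] by simp
  \<comment> \<open>Orthogonality of \<open>W\<close> and \<open>V\<close> removes the term of first
    order; only the residual remains.\<close>
  also have "ip a W D = h * ip a W R"
    unfolding D_def using ip_lincomb_right[OF WV(2) R WV(1)] ip_generator_orbit[OF U t]
    by (simp add: W_def V_def)
  finally have eq: "(H0_norm a (T (t + h) U))\<^sup>2 - (H0_norm a W)\<^sup>2 = h * (2 * ip a W R) + (H0_norm a D)\<^sup>2" by simp
  have rho: "H0_norm a R \<le> \<rho>"
    unfolding R_def W_def V_def \<rho>_def using h t H by (intro norm_residual_T) auto
  have "\<bar>ip a W R\<bar> \<le> H0_norm a W * H0_norm a R" by (rule Cauchy_Schwarz[OF WV(1) R])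
  also have "\<dots> \<le> H0_norm a U * \<rho>"
    using rho T_norm[OF t H(1)] by (intro mult_mono) (auto simp: W_def norm_nonneg)
  finally have 1: "\<bar>h * (2 * ip a W R)\<bar> \<le> h * (2 * H0_norm a U * \<rho>)"
    using h by (simp add: abs_mult)
  have "H0_norm a D \<le> h * H0_norm a V + h * H0_norm a R"
    unfolding D_def using norm_triangle[OF WV(2) R, of h h] h by simp
  also have "\<dots> \<le> h * H0_norm a ?V + h * \<rho>"
    using h rho T_norm[OF t H(2)] by (intro add_mono mult_left_mono) (auto simp: V_def)
  finally have "(H0_norm a D)\<^sup>2 \<le> (h * (H0_norm a ?V + \<rho>))\<^sup>2"
    by (intro power_mono) (auto simp: norm_nonneg algebra_simps)
  then have 2: "(H0_norm a D)\<^sup>2 \<le> h * (h * (H0_norm a ?V + \<rho>)\<^sup>2)"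
    by (simp add: power2_eq_square algebra_simps)
  have "\<bar>(H0_norm a (T (t + h) U))\<^sup>2 - (H0_norm a W)\<^sup>2\<bar> \<le> h * (2 * H0_norm a U * \<rho>) + h * (h * (H0_norm a ?V + \<rho>)\<^sup>2)"
    unfolding eq using 1 2 zero_le_power2[of "H0_norm a D"] by linarith
  then show ?thesis unfolding W_def by (simp add: distrib_left)
qed

lemma norm_conserved_domain:
  assumes U: "U \<in> dom_calA a" and t: "0 \<le> t"
  shows "H0_norm a (T t U) = H0_norm a U"
proof (cases "t = 0")
  case True
  then show ?thesis using norm_cong[OF T_0[OF calA_H0(1)[OF U]]] by simp
next
  case False
  then have t: "0 < t" using t by simp
  note H = calA_H0[OF U]
  define E where "E = (\<lambda>s. (H0_norm a (T s U))\<^sup>2)"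
  define \<omega> where "\<omega> h = 2 * H0_norm a U * H0_norm a (residual U (calA a U) h)
     + h * (H0_norm a (calA a U) + H0_norm a (residual U (calA a U) h))\<^sup>2" for h
  have "generator_limit a T U (calA a U)" using generator[OF H] U state_eq_refl by blast
  then have lim: "((\<lambda>h. H0_norm a (residual U (calA a U) h)) \<longlongrightarrow> 0) (at_right 0)"
    unfolding generator_limit_def residual_def .
  have "(\<omega> \<longlongrightarrow> 2 * H0_norm a U * 0 + 0 * (H0_norm a (calA a U) + 0)\<^sup>2) (at_right 0)"
    unfolding \<omega>_def[abs_def] by (intro tendsto_intros lim tendsto_ident_at)
  then have \<omega>: "(\<omega> \<longlongrightarrow> 0) (at_right 0)" by simp
  \<comment> \<open>Telescoping over \<open>Suc n\<close> steps of length
    \<open>h = t / Suc n\<close>: each costs at most \<open>h * \<omega> h\<close>, together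
    \<open>t * \<omega> h\<close>.\<close>
  have bound: "\<bar>E t - E 0\<bar> \<le> t * \<omega> (t / real (Suc n))" for n
  proof -
    define h where "h = t / real (Suc n)"
    have h: "0 < h" "real (Suc n) * h = t" using t by (auto simp: h_def)
    have "\<bar>E (real k * h) - E 0\<bar> \<le> real k * (h * \<omega> h)" for k
    proof (induction k)
      case (Suc k)
      have "\<bar>E (real k * h + h) - E (real k * h)\<bar> \<le> h * \<omega> h"
        unfolding E_def \<omega>_def using energy_step[OF U _ h(1), of "real k * h"] h(1) by simp
      then show ?case using Suc by (simp add: algebra_simps)
    qed simp
    from this[of "Suc n"] show ?thesis unfolding h(2) using h(2)
      by (metis h_def mult.assoc)
  qed
  have "((\<lambda>n. \<omega> (t / real (Suc n))) \<longlongrightarrow> 0) sequentially"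
  proof (rule filterlim_compose[OF \<omega>])
    have "(\<lambda>n. t / real (Suc n)) \<longlonglongrightarrow> 0"
      by (intro LIMSEQ_Suc[OF lim_const_over_n])
    then show "filterlim (\<lambda>n. t / real (Suc n)) (at_right 0) sequentially"
      using t by (auto simp: filterlim_at intro!: always_eventually)
  qed
  then have "((\<lambda>n. t * \<omega> (t / real (Suc n))) \<longlongrightarrow> t * 0) sequentially" by (intro tendsto_intros)
  then have "\<bar>E t - E 0\<bar> \<le> t * 0"
    using bound by (intro tendsto_lowerbound) auto
  then have "E t = E 0" by simp
  moreover have "E 0 = (H0_norm a U)\<^sup>2" using norm_cong[OF T_0[OF H(1)]] by (simp add: E_def)
  ultimately show ?thesis by (simp add: E_def norm_nonneg)
qed

text \<open>A contraction gives one inequality. For the other, \<open>U\<close> is compared with a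
  nearby \<open>U'\<close> in the domain, whose norm is conserved.\<close>

lemma norm_conserved:
  assumes dense: "\<And>\<epsilon>. 0 < \<epsilon> \<Longrightarrow> \<exists>U'\<in>dom_calA a. H0_norm a (state_diff U U') < \<epsilon>"
    and U: "U \<in> H0 a" and t: "0 \<le> t"
  shows "H0_norm a (T t U) = H0_norm a U"
proof (rule antisym[OF T_norm[OF t U]], rule field_le_epsilon)
  fix e :: real assume "0 < e"
  \<comment> \<open>The distance is paid twice, at time 0 and, by contractivity, at time
    \<open>t\<close>.\<close>
  then obtain U' where U': "U' \<in> dom_calA a" "H0_norm a (state_diff U U') < e / 2"
    using dense[of "e / 2"] by auto
  note H' = calA_H0(1)[OF U'(1)]
  have tri: "H0_norm a X \<le> H0_norm a (state_diff X Y) + H0_norm a Y" if "X \<in> H0 a" "Y \<in> H0 a" for X Y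
  proof -
    have "X \<approx> lincomb 1 (state_diff X Y) 1 Y"
      by (auto simp: state_eq_def lincomb_def state_diff_def)
    from norm_cong[OF this] show ?thesis
      using norm_triangle[OF state_diff_H0[OF that] that(2), of 1 1] by simp
  qed
  have swap: "H0_norm a (state_diff X Y) = H0_norm a (state_diff Y X)" if "X \<in> H0 a" "Y \<in> H0 a" for X Y
  proof -
    have "(H0_norm a (state_diff X Y))\<^sup>2 = (H0_norm a (state_diff Y X))\<^sup>2"
      unfolding state_diff_def norm_sq_lincomb[OF that] norm_sq_lincomb[OF that(2,1)]
      by (simp add: ip_sym[of a X Y])
    then show ?thesis by (simp add: norm_nonneg)
  qed
  have "T t (state_diff U' U) \<approx> state_diff (T t U') (T t U)"
    unfolding state_diff_def by (rule T_lincomb[OF t H' U])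
  then have d: "H0_norm a (state_diff (T t U') (T t U)) \<le> H0_norm a (state_diff U' U)"
    using norm_cong T_norm[OF t state_diff_H0[OF H' U]] by metis
  have "H0_norm a U \<le> H0_norm a (state_diff U U') + H0_norm a U'" by (rule tri[OF U H'])
  also have "H0_norm a U' = H0_norm a (T t U')" using norm_conserved_domain[OF U'(1) t] by simp
  also have "\<dots> \<le> H0_norm a (state_diff (T t U') (T t U)) + H0_norm a (T t U)"
    by (intro tri T_H0 t H' U)
  finally show "H0_norm a U \<le> H0_norm a (T t U) + e"
    using d U'(2) swap[OF U H'] by linarith
qed

end

section \<open>Approximation in the Lebesgue space\<close>

text \<open>The squared distance avoids square roots; the price is the factor 2 in
  \<open>dist2_triangle\<close>.\<close>

definition dist2 :: "(real \<Rightarrow> real) \<Rightarrow> (real \<Rightarrow> real) \<Rightarrow> real" where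
  "dist2 f g = (LINT x|leb01. (f x - g x)\<^sup>2)"

lemma finite_measure_leb01: "finite_measure leb01"
  by (intro finite_measureI) (simp add: emeasure_restrict_space)

lemma measure_leb01: "measure leb01 (space leb01) = 1"
  by (simp add: measure_restrict_space)

lemma L2_01_diff: "f \<in> L2_01 \<Longrightarrow> g \<in> L2_01 \<Longrightarrow> (\<lambda>x. f x - g x) \<in> L2_01"
  using L2_01_lincomb[of f g 1 "-1"] by simp

lemma L2_01_D: "f \<in> L2_01 \<Longrightarrow> f \<in> borel_measurable leb01" "f \<in> L2_01 \<Longrightarrow> integrable leb01 (\<lambda>x. (f x)\<^sup>2)"
  by (auto simp: L2_01_def)

lemma dist2_triangle:
  assumes "f \<in> L2_01" "g \<in> L2_01" "h \<in> L2_01"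
  shows "dist2 f h \<le> 2 * dist2 f g + 2 * dist2 g h"
proof -
  note I = L2_01_D(2)[OF L2_01_diff]
  have "dist2 f h \<le> (LINT x|leb01. 2 * (f x - g x)\<^sup>2 + 2 * (g x - h x)\<^sup>2)"
    unfolding dist2_def
  proof (rule integral_mono)
    fix x
    have "0 \<le> ((f x - g x) - (g x - h x))\<^sup>2" by simp
    then show "(f x - h x)\<^sup>2 \<le> 2 * (f x - g x)\<^sup>2 + 2 * (g x - h x)\<^sup>2"
      by (simp add: power2_eq_square algebra_simps)
  qed (use I assms in auto)
  also have "\<dots> = 2 * dist2 f g + 2 * dist2 g h"
    unfolding dist2_def using I assms by simp
  finally show ?thesis .
qed

lemma dist2_bounded_mult:
  assumes fg: "f \<in> L2_01" "g \<in> L2_01" and hk: "\<And>x. x \<in> {0<..<1} \<Longrightarrow> \<bar>h x - k x\<bar> \<le> C * \<bar>f x - g x\<bar>"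
  shows "dist2 h k \<le> C\<^sup>2 * dist2 f g"
proof -
  have le: "(h x - k x)\<^sup>2 \<le> C\<^sup>2 * (f x - g x)\<^sup>2" if "x \<in> {0<..<1}" for x
  proof -
    have "\<bar>h x - k x\<bar>\<^sup>2 \<le> (C * \<bar>f x - g x\<bar>)\<^sup>2" using hk[OF that] by (intro power_mono) auto
    then show ?thesis by (simp add: power_mult_distrib)
  qed
  have "dist2 h k \<le> (LINT x|leb01. C\<^sup>2 * (f x - g x)\<^sup>2)"
  proof (cases "integrable leb01 (\<lambda>x. (h x - k x)\<^sup>2)")
    case True
    then show ?thesis unfolding dist2_def
      using L2_01_D(2)[OF L2_01_diff[OF fg]] le by (intro integral_mono) auto
  next
    \<comment> \<open>A non-integrable integrand has integral 0 by convention, so \<open>h\<close>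
      and \<open>k\<close> require no measurability.\<close>
    case False
    then show ?thesis unfolding dist2_def by (simp add: not_integrable_integral_eq)
  qed
  then show ?thesis by (simp add: dist2_def)
qed

lemma dist2_dominated:
  assumes f: "f \<in> L2_01" and F: "\<And>n. F n \<in> L2_01" and b: "b \<in> L2_01"
    and lim: "AE x in leb01. (\<lambda>n. F n x) \<longlonglongrightarrow> f x"
    and dom: "\<And>n. AE x in leb01. \<bar>F n x - f x\<bar> \<le> \<bar>b x\<bar>"
  shows "(\<lambda>n. dist2 (F n) f) \<longlonglongrightarrow> 0"
proof -
  have "(\<lambda>n. LINT x|leb01. (F n x - f x)\<^sup>2) \<longlonglongrightarrow> (LINT x|leb01. 0)"
  proof (rule integral_dominated_convergence)
    show "integrable leb01 (\<lambda>x. (b x)\<^sup>2)" using b by (rule L2_01_D)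
    show "AE x in leb01. (\<lambda>n. (F n x - f x)\<^sup>2) \<longlonglongrightarrow> 0"
      using lim
    proof eventually_elim
      case (elim x)
      then have "(\<lambda>n. (F n x - f x)\<^sup>2) \<longlonglongrightarrow> (f x - f x)\<^sup>2" by (intro tendsto_intros)
      then show ?case by simp
    qed
    show "AE x in leb01. norm ((F n x - f x)\<^sup>2) \<le> (b x)\<^sup>2" for n
      using dom[of n] by eventually_elim (simp add: abs_le_square_iff)
  qed (use L2_01_D(1)[OF f] L2_01_D(1)[OF F] in auto)
  then show ?thesis by (simp add: dist2_def)
qed

lemma dist2_tendsto_obtain:
  assumes "(\<lambda>n. dist2 (F n) f) \<longlonglongrightarrow> 0" "0 < \<epsilon>"
  obtains n where "dist2 (F n) f < \<epsilon>"
  using order_tendstoD(2)[OF assms] by (auto simp: eventually_sequentially)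

lemma L2_01_bounded_approx:
  assumes f: "f \<in> L2_01" and "0 < \<epsilon>"
  obtains g M where "g \<in> borel_measurable leb01" "\<And>x. \<bar>g x\<bar> \<le> M" "dist2 g f < \<epsilon>"
proof -
  define F where "F = (\<lambda>n x. max (- real n) (min (real n) (f x)))"
  have Fm: "F n \<in> borel_measurable leb01" for n
    unfolding F_def using L2_01_D(1)[OF f] by measurable
  have Fb: "\<bar>F n x\<bar> \<le> real n" for n x unfolding F_def by (auto simp: abs_le_iff)
  have "(\<lambda>n. dist2 (F n) f) \<longlonglongrightarrow> 0"
  proof (rule dist2_dominated[OF f _ f])
    show "F n \<in> L2_01" for n by (rule L2_01_bounded[OF Fm Fb])
    have "(\<lambda>n. F n x) \<longlonglongrightarrow> f x" for x
    proof (rule tendsto_eventually)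
      obtain m where "\<bar>f x\<bar> \<le> real m" using real_arch_simple by blast
      then have "F n x = f x" if "m \<le> n" for n
        using that by (auto simp: F_def max_def min_def abs_le_iff)
      then show "\<forall>\<^sub>F n in sequentially. F n x = f x" by (auto simp: eventually_sequentially)
    qed
    then show "AE x in leb01. (\<lambda>n. F n x) \<longlonglongrightarrow> f x" by simp
    have "\<bar>F n x - f x\<bar> \<le> \<bar>f x\<bar>" for n x by (auto simp: F_def)
    then show "AE x in leb01. \<bar>F n x - f x\<bar> \<le> \<bar>f x\<bar>" for n by simp
  qed
  then obtain n where "dist2 (F n) f < \<epsilon>" using dist2_tendsto_obtain \<open>0 < \<epsilon>\<close> by blast
  then show thesis using that Fm Fb by blast
qed

text \<open>A measurable function is an almost everywhere limit of continuous ones; clipping them at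
  \<open>M\<close> supplies the constant dominating function.\<close>

lemma L2_01_continuous_approx:
  assumes f: "f \<in> borel_measurable leb01" "\<And>x. \<bar>f x\<bar> \<le> M" and "0 < \<epsilon>"
  obtains g where "continuous_on UNIV g" "dist2 g f < \<epsilon>"
proof -
  have "f measurable_on {0<..<1}" using f(1) by (simp add: measurable_on_iff_borel_measurable)
  then obtain N G where N: "negligible N" and G: "\<And>n. continuous_on UNIV (G n)"
    "\<And>x. x \<notin> N \<Longrightarrow> (\<lambda>n. G n x) \<longlonglongrightarrow> (if x \<in> {0<..<1} then f x else 0)"
    unfolding measurable_on_def by blast
  define F where "F = (\<lambda>n x. max (- M) (min M (G n x)))"
  have "0 \<le> M" using f(2)[of 0] by (meson abs_ge_zero order_trans)
  have Fb: "\<bar>F n x\<bar> \<le> M" for n x using \<open>0 \<le> M\<close> by (auto simp: F_def abs_le_iff)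
  have Fc: "continuous_on UNIV (F n)" for n unfolding F_def using G(1) by (intro continuous_intros)
  have "(\<lambda>n. dist2 (F n) f) \<longlonglongrightarrow> 0"
  proof (rule dist2_dominated[where b = "\<lambda>_. 2 * M"])
    show "f \<in> L2_01" using f by (intro L2_01_bounded) auto
    show "F n \<in> L2_01" for n by (intro L2_01_continuous continuous_on_subset[OF Fc]) auto
    show "(\<lambda>_. 2 * M) \<in> L2_01" by (intro L2_01_continuous continuous_intros)
    show "AE x in leb01. (\<lambda>n. F n x) \<longlonglongrightarrow> f x"
    proof (rule AE_leb01_negligible[OF N])
      fix x assume x: "x \<in> {0<..<1} - N"
      then have "(\<lambda>n. G n x) \<longlonglongrightarrow> f x" using G(2)[of x] by simp
      then have "(\<lambda>n. F n x) \<longlonglongrightarrow> max (- M) (min M (f x))"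
        unfolding F_def by (intro tendsto_intros)
      then show "(\<lambda>n. F n x) \<longlonglongrightarrow> f x" using f(2)[of x] by (simp add: abs_le_iff)
    qed
    have "\<bar>F n x - f x\<bar> \<le> \<bar>2 * M\<bar>" for n x using Fb[of n x] f(2)[of x] by linarith
    then show "AE x in leb01. \<bar>F n x - f x\<bar> \<le> \<bar>2 * M\<bar>" for n by simp
  qed
  then obtain n where "dist2 (F n) f < \<epsilon>" using dist2_tendsto_obtain \<open>0 < \<epsilon>\<close> by blast
  then show thesis using that Fc by blast
qed

lemma real_polynomial_function_L2_01: "real_polynomial_function q \<Longrightarrow> q \<in> L2_01"
  by (intro L2_01_continuous continuous_on_polymonial_function) (simp add: real_polynomial_function_eq)

lemma L2_01_polynomial_approx:
  assumes f: "f \<in> L2_01" and "0 < \<epsilon>"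
  obtains q where "real_polynomial_function q" "dist2 q f < \<epsilon>"
proof -
  \<comment> \<open>Two uses of \<open>dist2_triangle\<close>:
    \<open>2 * (2 * e + 2 * e) + 2 * e = 10 * e\<close>.\<close>
  define e where "e = \<epsilon> / 10"
  have "e > 0" using \<open>0 < \<epsilon>\<close> by (simp add: e_def)
  obtain g M where g: "g \<in> borel_measurable leb01" "\<And>x. \<bar>g x\<bar> \<le> M" "dist2 g f < e"
    using L2_01_bounded_approx[OF f \<open>e > 0\<close>] by blast
  obtain h where h: "continuous_on UNIV h" "dist2 h g < e"
    using L2_01_continuous_approx[OF g(1,2) \<open>e > 0\<close>] by blast
  \<comment> \<open>A uniform error below both 1 and \<open>e\<close> has a square of at most
    \<open>1 * e\<close>.\<close>
  have "0 < min 1 e" using \<open>e > 0\<close> by simp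
  then obtain q where q: "real_polynomial_function q" "\<And>x. x \<in> {0..1} \<Longrightarrow> \<bar>h x - q x\<bar> < min 1 e"
    using Stone_Weierstrass_real_polynomial_function[of "{0..1}" h "min 1 e"] continuous_on_subset[OF h(1)]
    by (metis compact_Icc subset_UNIV)
  have L2: "g \<in> L2_01" "h \<in> L2_01" "q \<in> L2_01"
    using g(1,2) h(1) q(1)
    by (auto intro: L2_01_bounded L2_01_continuous continuous_on_subset real_polynomial_function_L2_01)
  have "dist2 q h \<le> (LINT x|leb01. e)"
    unfolding dist2_def
  proof (rule integral_mono)
    show "integrable leb01 (\<lambda>x. e)" by (rule finite_measure.integrable_const[OF finite_measure_leb01])
    fix x assume "x \<in> space leb01"
    then have *: "\<bar>h x - q x\<bar> < min 1 e" by (intro q) auto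
    have "(q x - h x)\<^sup>2 = \<bar>h x - q x\<bar> * \<bar>h x - q x\<bar>" by (simp add: power2_eq_square algebra_simps)
    also have "\<dots> \<le> 1 * e" using * by (intro mult_mono) auto
    finally show "(q x - h x)\<^sup>2 \<le> e" by simp
  qed (use L2_01_D(2)[OF L2_01_diff[OF L2(3,2)]] in simp)
  also have "\<dots> = e" using measure_leb01 by simp
  finally have "dist2 q h \<le> e" .
  moreover have "dist2 q g \<le> 2 * dist2 q h + 2 * dist2 h g" by (rule dist2_triangle[OF L2(3,2,1)])
  moreover have "dist2 q f \<le> 2 * dist2 q g + 2 * dist2 g f" by (rule dist2_triangle[OF L2(3,1) f])
  ultimately have "dist2 q f < 8 * e + 2 * e" using g(3) h(2) \<open>e > 0\<close> by linarith
  then have "dist2 q f < \<epsilon>" by (simp add: e_def)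
  then show thesis by (rule that[OF q(1)])
qed

section \<open>Twice continuously differentiable functions with compact support\<close>

text \<open>These functions serve as fluxes \<open>a u''\<close>: two continuous derivatives place
  them in \<open>H2_01\<close>, and support away from 0 makes division by \<open>a\<close>
  harmless.\<close>

definition bump :: "(real \<Rightarrow> real) \<Rightarrow> bool" where
  "bump p \<longleftrightarrow> (\<exists>p' p''. (\<forall>x. (p has_real_derivative p' x) (at x)) \<and>
     (\<forall>x. (p' has_real_derivative p'' x) (at x)) \<and> continuous_on UNIV p'') \<and>
     (\<exists>\<delta>>0. \<forall>x. x \<notin> {\<delta>..1 - \<delta>} \<longrightarrow> p x = 0)"

lemma DERIV_max_0_power:
  "((\<lambda>s::real. max 0 s ^ Suc (Suc n)) has_real_derivative real (Suc (Suc n)) * max 0 s ^ Suc n) (at s)"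
proof (cases s "0::real" rule: linorder_cases)
  case less
  have "((\<lambda>s::real. 0) has_real_derivative 0) (at s)" by simp
  then have "((\<lambda>s::real. max 0 s ^ Suc (Suc n)) has_real_derivative 0) (at s)"
    by (rule has_field_derivative_transform_within_open[of _ _ _ "{..<0}"]) (use less in auto)
  then show ?thesis using less by simp
next
  case greater
  have "((\<lambda>s::real. s ^ Suc (Suc n)) has_real_derivative real (Suc (Suc n)) * s ^ Suc n) (at s)"
    using DERIV_pow[of "Suc (Suc n)" s UNIV] by simp
  then have "((\<lambda>s::real. max 0 s ^ Suc (Suc n)) has_real_derivative real (Suc (Suc n)) * s ^ Suc n) (at s)"
    by (rule has_field_derivative_transform_within_open[of _ _ _ "{0<..}"]) (use greater in auto)
  then show ?thesis using greater by simp
next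
  case equal
  have "((\<lambda>h::real. max 0 h ^ Suc (Suc n) / h) \<longlongrightarrow> 0) (at 0)"
  proof (rule Lim_null_comparison)
    show "\<forall>\<^sub>F h::real in at 0. norm (max 0 h ^ Suc (Suc n) / h) \<le> \<bar>h\<bar> ^ Suc n"
    proof (rule always_eventually, rule allI)
      fix h :: real
      show "norm (max 0 h ^ Suc (Suc n) / h) \<le> \<bar>h\<bar> ^ Suc n"
      proof (cases "0 < h")
        case False
        then have "norm (max 0 h ^ Suc (Suc n) / h) = 0" by simp
        then show ?thesis by (metis abs_ge_zero zero_le_power)
      qed simp
    qed
    show "((\<lambda>h::real. \<bar>h\<bar> ^ Suc n) \<longlongrightarrow> 0) (at 0)"
      by (rule tendsto_eq_intros refl | simp)+
  qed
  then show ?thesis using equal by (simp add: DERIV_def)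
qed

lemma bump_exists:
  assumes "0 < \<delta>" "\<delta> < 1 / 2"
  obtains B where "bump B" "\<And>x. x \<in> {\<delta><..<1 - \<delta>} \<Longrightarrow> 0 < B x" "\<And>x. x \<notin> {\<delta>..1 - \<delta>} \<Longrightarrow> B x = 0" "\<And>x. 0 \<le> B x"
proof
  \<comment> \<open>\<open>r\<close> is positive exactly between \<open>\<delta>\<close> and
    \<open>1 - \<delta>\<close>. The cube is taken because the third power of a positive part is
    twice continuously differentiable.\<close>
  define r where "r = (\<lambda>x::real. (x - \<delta>) * (1 - \<delta> - x))"
  let ?B = "\<lambda>x. max 0 (r x) ^ 3"
  have r: "(r has_real_derivative 1 - 2 * x) (at x)" for x
    unfolding r_def by (auto intro!: derivative_eq_intros)
  have D1: "(?B has_real_derivative 3 * max 0 (r x) ^ 2 * (1 - 2 * x)) (at x)" for x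
    using DERIV_chain2[OF DERIV_max_0_power[of 1 "r x"] r[of x]] by (simp add: numeral_eq_Suc)
  have D2: "((\<lambda>x. max 0 (r x) ^ 2) has_real_derivative 2 * max 0 (r x) * (1 - 2 * x)) (at x)" for x
    using DERIV_chain2[OF DERIV_max_0_power[of 0 "r x"] r[of x]] by (simp add: numeral_eq_Suc)
  have D3: "((\<lambda>x. 3 * max 0 (r x) ^ 2 * (1 - 2 * x)) has_real_derivative
     3 * (2 * max 0 (r x) * (1 - 2 * x)) * (1 - 2 * x) + 3 * max 0 (r x) ^ 2 * (- 2)) (at x)" for x
    by (rule derivative_eq_intros D2 refl | simp)+
  have zero: "?B x = 0" if "x \<notin> {\<delta>..1 - \<delta>}" for x
  proof -
    have "r x \<le> 0" unfolding r_def using that assms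
      by (auto simp: mult_le_0_iff)
    then show ?thesis by simp
  qed
  show "bump ?B"
    unfolding bump_def
  proof (intro conjI exI allI)
    show "continuous_on UNIV (\<lambda>x. 3 * (2 * max 0 (r x) * (1 - 2 * x)) * (1 - 2 * x) + 3 * max 0 (r x) ^ 2 * (- 2))"
      unfolding r_def by (intro continuous_intros)
  qed (use D1 D3 zero assms in blast)+
  show "0 < ?B x" if "x \<in> {\<delta><..<1 - \<delta>}" for x using that by (simp add: r_def)
  show "?B x = 0" if "x \<notin> {\<delta>..1 - \<delta>}" for x using zero that .
  show "0 \<le> ?B x" for x by simp
qed

lemma bump_mult_polynomial:
  assumes "bump B" "real_polynomial_function q"
  shows "bump (\<lambda>x. B x * q x)"
proof -
  obtain B' B'' \<delta> where B: "\<And>x. (B has_real_derivative B' x) (at x)" "\<And>x. (B' has_real_derivative B'' x) (at x)"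
    "continuous_on UNIV B''" and z: "\<delta> > 0" "\<And>x. x \<notin> {\<delta>..1 - \<delta>} \<Longrightarrow> B x = 0"
    using assms(1) unfolding bump_def by blast
  obtain q' where q': "real_polynomial_function q'" "\<And>x. (q has_real_derivative q' x) (at x)"
    using has_real_derivative_polynomial_function[OF assms(2)] by blast
  obtain q'' where q'': "real_polynomial_function q''" "\<And>x. (q' has_real_derivative q'' x) (at x)"
    using has_real_derivative_polynomial_function[OF q'(1)] by blast
  have c: "continuous_on UNIV q''"
    using q''(1) by (intro continuous_on_polymonial_function) (simp add: real_polynomial_function_eq)
  note cont = DERIV_continuous_on[OF DERIV_subset[OF B(1)]] DERIV_continuous_on[OF DERIV_subset[OF B(2)]]
    DERIV_continuous_on[OF DERIV_subset[OF q'(2)]] DERIV_continuous_on[OF DERIV_subset[OF q''(2)]]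
  show ?thesis
    unfolding bump_def
  proof (intro conjI exI allI)
    show "((\<lambda>x. B x * q x) has_real_derivative (B' x * q x + B x * q' x)) (at x)" for x
      by (rule derivative_eq_intros B q' refl | simp)+
    show "((\<lambda>x. B' x * q x + B x * q' x) has_real_derivative
       (B'' x * q x + B' x * q' x) + (B' x * q' x + B x * q'' x)) (at x)" for x
      by (rule derivative_eq_intros B q' q'' refl | simp)+
    show "continuous_on UNIV (\<lambda>x. (B'' x * q x + B' x * q' x) + (B' x * q' x + B x * q'' x))"
      by (intro continuous_intros cont c B(3)) auto
    show "0 < \<delta>" by (fact z)
    show "x \<notin> {\<delta>..1 - \<delta>} \<longrightarrow> B x * q x = 0" for x using z(2)[of x] by simp
  qed
qed

lemma bump_diff:
  assumes "bump p" "bump q"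
  shows "bump (\<lambda>x. p x - q x)"
proof -
  obtain p' p'' \<delta> where p: "\<And>x. (p has_real_derivative p' x) (at x)" "\<And>x. (p' has_real_derivative p'' x) (at x)"
    "continuous_on UNIV p''" "\<delta> > 0" "\<And>x. x \<notin> {\<delta>..1 - \<delta>} \<Longrightarrow> p x = 0"
    using assms(1) unfolding bump_def by blast
  obtain q' q'' \<eta> where q: "\<And>x. (q has_real_derivative q' x) (at x)" "\<And>x. (q' has_real_derivative q'' x) (at x)"
    "continuous_on UNIV q''" "\<eta> > 0" "\<And>x. x \<notin> {\<eta>..1 - \<eta>} \<Longrightarrow> q x = 0"
    using assms(2) unfolding bump_def by blast
  show ?thesis
    unfolding bump_def
  proof (intro conjI)
    show "\<exists>\<delta>>0. \<forall>x. x \<notin> {\<delta>..1 - \<delta>} \<longrightarrow> p x - q x = 0"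
    proof (intro exI conjI allI impI)
      show "0 < min \<delta> \<eta>" using p(4) q(4) by simp
      show "p x - q x = 0" if "x \<notin> {min \<delta> \<eta>..1 - min \<delta> \<eta>}" for x
      proof -
        have "x \<notin> {\<delta>..1 - \<delta>}" "x \<notin> {\<eta>..1 - \<eta>}" using that by auto
        then show ?thesis by (simp add: p(5) q(5))
      qed
    qed
    show "\<exists>d d'. (\<forall>x. ((\<lambda>x. p x - q x) has_real_derivative d x) (at x)) \<and>
        (\<forall>x. (d has_real_derivative d' x) (at x)) \<and> continuous_on UNIV d'"
      using p q by (intro exI[of _ "\<lambda>x. p' x - q' x"] exI[of _ "\<lambda>x. p'' x - q'' x"])
        (auto intro!: derivative_intros continuous_intros)
  qed
qed

lemma continuous_on_bump: "bump p \<Longrightarrow> continuous_on S p"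
  unfolding bump_def by (meson DERIV_continuous_on DERIV_subset subset_UNIV)

text \<open>With a bump \<open>B\<close> positive on the support of \<open>z\<close>, a polynomial
  \<open>q\<close> approximating \<open>s z / B\<close> gives \<open>B q / s\<close> close to
  \<open>z\<close>: multiplication by the bounded function \<open>B / s\<close> preserves
  closeness.\<close>

lemma bump_weighted_approx:
  assumes z: "z \<in> L2_01" "0 < \<delta>" "\<delta> < 1 / 2" "\<And>x. x \<notin> {\<delta>..1 - \<delta>} \<Longrightarrow> z x = 0"
    and s: "continuous_on {0<..<1} s" "\<And>x. x \<in> {0<..<1} \<Longrightarrow> 0 < s x" and "0 < \<epsilon>"
  obtains p where "bump p" "dist2 (\<lambda>x. p x / s x) z < \<epsilon>"
proof -
  \<comment> \<open>The bump lives on a larger interval, so that it is bounded away from 0 on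
    \<open>{\<delta>..1 - \<delta>}\<close>.\<close>
  have "0 < \<delta> / 2" "\<delta> / 2 < 1 / 2" using z by auto
  then obtain B where B: "bump B" "\<And>x. x \<in> {\<delta> / 2<..<1 - \<delta> / 2} \<Longrightarrow> 0 < B x"
      "\<And>x. x \<notin> {\<delta> / 2..1 - \<delta> / 2} \<Longrightarrow> B x = 0" "\<And>x. 0 \<le> B x"
    using bump_exists by blast
  have "bounded ((\<lambda>x. s x / B x) ` {\<delta>..1 - \<delta>})"
  proof (intro compact_imp_bounded compact_continuous_image continuous_intros)
    show "continuous_on {\<delta>..1 - \<delta>} s" using z by (intro continuous_on_subset[OF s(1)]) auto
    show "\<forall>x\<in>{\<delta>..1 - \<delta>}. B x \<noteq> 0"
    proof
      fix x assume "x \<in> {\<delta>..1 - \<delta>}"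
      then show "B x \<noteq> 0" using B(2)[of x] z(2) by simp
    qed
  qed (auto intro: continuous_on_bump B)
  then obtain C where C: "\<And>x. x \<in> {\<delta>..1 - \<delta>} \<Longrightarrow> \<bar>s x / B x\<bar> \<le> C"
    by (auto simp: bounded_iff simp del: atLeastAtMost_iff)
  have "bounded ((\<lambda>x. B x / s x) ` {\<delta> / 2..1 - \<delta> / 2})"
  proof (intro compact_imp_bounded compact_continuous_image continuous_intros)
    show "continuous_on {\<delta> / 2..1 - \<delta> / 2} s" using z by (intro continuous_on_subset[OF s(1)]) auto
    show "\<forall>x\<in>{\<delta> / 2..1 - \<delta> / 2}. s x \<noteq> 0"
    proof
      fix x assume "x \<in> {\<delta> / 2..1 - \<delta> / 2}"
      then show "s x \<noteq> 0" using s(2)[of x] z(2) by simp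
    qed
  qed (auto intro: continuous_on_bump B)
  then obtain D where D: "\<And>x. x \<in> {\<delta> / 2..1 - \<delta> / 2} \<Longrightarrow> \<bar>B x / s x\<bar> \<le> D"
    by (auto simp: bounded_iff simp del: atLeastAtMost_iff)
  have "1 / 2 \<in> {\<delta> / 2..1 - \<delta> / 2}" "1 / 2 \<in> {\<delta>..1 - \<delta>}" using z by auto
  then have "0 \<le> C" "0 \<le> D" using C D by (meson abs_ge_zero order_trans)+
  have D': "\<bar>B x / s x\<bar> \<le> D" for x using D[of x] B(3)[of x] \<open>0 \<le> D\<close> by (cases "x \<in> {\<delta> / 2..1 - \<delta> / 2}") auto
  define k where "k = (\<lambda>x. indicator {\<delta>..1 - \<delta>} x * (s x / B x))"
  have f: "(\<lambda>x. k x * z x) \<in> L2_01"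
  proof (rule L2_01_bounded_mult[OF z(1)])
    have "s \<in> borel_measurable leb01" "B \<in> borel_measurable leb01"
      using s B by (auto intro: borel_measurable_leb01_continuous continuous_on_bump)
    moreover have "(indicator {\<delta>..1 - \<delta>} :: real \<Rightarrow> real) \<in> borel_measurable leb01"
      by (intro measurable_restrict_space1 borel_measurable_indicator) simp
    ultimately show "k \<in> borel_measurable leb01" unfolding k_def by simp
    show "\<bar>k x\<bar> \<le> C" for x using C[of x] \<open>0 \<le> C\<close> by (cases "x \<in> {\<delta>..1 - \<delta>}") (auto simp: k_def)
  qed
  \<comment> \<open>The added 1 prevents division by zero and makes the final inequality
    strict.\<close>
  have "0 < \<epsilon> / (D\<^sup>2 + 1)" using \<open>0 < \<epsilon>\<close> by (simp add: add_nonneg_pos)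
  then obtain q where q: "real_polynomial_function q" "dist2 q (\<lambda>x. k x * z x) < \<epsilon> / (D\<^sup>2 + 1)"
    using L2_01_polynomial_approx[OF f] by blast
  have "dist2 (\<lambda>x. (B x * q x) / s x) z \<le> D\<^sup>2 * dist2 q (\<lambda>x. k x * z x)"
  proof (rule dist2_bounded_mult[OF real_polynomial_function_L2_01[OF q(1)] f])
    fix x :: real assume x: "x \<in> {0<..<1}"
    have "z x = (B x / s x) * (k x * z x)"
    proof (cases "x \<in> {\<delta>..1 - \<delta>}")
      case True
      then have "B x \<noteq> 0" "s x \<noteq> 0" using B(2)[of x] s(2)[OF x] z(2) by force+
      then show ?thesis using True by (simp add: k_def)
    qed (simp add: z)
    then have "(B x * q x) / s x - z x = (B x / s x) * (q x - k x * z x)"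
      by (simp add: algebra_simps)
    then show "\<bar>(B x * q x) / s x - z x\<bar> \<le> D * \<bar>q x - k x * z x\<bar>"
      using D'[of x] by (simp only: abs_mult mult_right_mono abs_ge_zero)
  qed
  also have "\<dots> \<le> D\<^sup>2 * (\<epsilon> / (D\<^sup>2 + 1))" using q(2) by (intro mult_left_mono) auto
  also have "\<dots> = \<epsilon> * (D\<^sup>2 / (D\<^sup>2 + 1))" by simp
  also have "\<dots> < \<epsilon> * 1"
    using \<open>0 < \<epsilon>\<close> by (intro mult_strict_left_mono) (simp_all add: divide_less_eq add_nonneg_pos)
  finally show thesis using that[OF bump_mult_polynomial[OF B(1) q(1)]] by simp
qed

section \<open>Smooth elements of the domain\<close>

text \<open>A continuous derivative is bounded on the compact interval, so \<open>f\<close> is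
  Lipschitz.\<close>

lemma has_vector_derivative_abs_cont:
  assumes d: "\<And>x. x \<in> {0..1} \<Longrightarrow> (f has_vector_derivative f' x) (at x within {0..1})"
    and c: "continuous_on {0..1} f'"
  shows "abs_cont_on 0 1 (f :: real \<Rightarrow> real)"
proof -
  have "bounded (f' ` {0..1})" by (intro compact_imp_bounded compact_continuous_image c) auto
  then obtain C where C: "\<And>x. x \<in> {0..1} \<Longrightarrow> \<bar>f' x\<bar> \<le> C"
    by (auto simp: bounded_iff simp del: atLeastAtMost_iff)
  then have "0 \<le> C" by (meson abs_ge_zero atLeastAtMost_iff order_refl order_trans zero_le_one)
  show ?thesis
  proof (rule abs_cont_on_lipschitz[OF _ \<open>0 \<le> C\<close>])
    fix x y :: real assume xy: "0 \<le> x" "x \<le> y" "y \<le> 1"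
    have "norm (f y - f x) \<le> C * norm (y - x)"
    proof (rule differentiable_bound[of "{0..1}" f "\<lambda>x h. h * f' x"])
      fix t :: real assume t: "t \<in> {0..1}"
      show "(f has_derivative (\<lambda>h. h * f' t)) (at t within {0..1})"
        using d[OF t] by (simp add: has_vector_derivative_def)
      show "onorm (\<lambda>h. h * f' t) \<le> C"
        by (rule onorm_le) (use mult_left_mono[OF C[OF t] abs_ge_zero] in \<open>simp add: abs_mult mult.commute\<close>)
    qed (use xy in auto)
    then show "\<bar>f y - f x\<bar> \<le> C * (y - x)" using xy by simp
  qed
qed

text \<open>Derivatives are relative to the interval, so antiderivatives constructed only on
  \<open>{0..1}\<close> qualify without extension.\<close>

locale C2_function =
  fixes u u1 u2 :: "real \<Rightarrow> real"
  assumes d1: "\<And>x. x \<in> {0..1} \<Longrightarrow> (u has_vector_derivative u1 x) (at x within {0..1})"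
    and d2: "\<And>x. x \<in> {0..1} \<Longrightarrow> (u1 has_vector_derivative u2 x) (at x within {0..1})"
    and c2: "continuous_on {0..1} u2"
begin

lemma deriv01: "x \<in> {0..1} \<Longrightarrow> deriv01 u x = u1 x"
  by (rule deriv01_eq[OF d1])

lemma deriv2_01: "x \<in> {0..1} \<Longrightarrow> deriv2_01 u x = u2 x"
  using deriv01_cong_01[of "deriv01 u" u1 x] deriv01 deriv01_eq[OF d2] by simp

lemma c1: "continuous_on {0..1} u1"
  unfolding continuous_on_eq_continuous_within using d2 has_vector_derivative_continuous by blast

lemma abs_cont: "abs_cont_on 0 1 u" "abs_cont_on 0 1 (deriv01 u)"
proof -
  show "abs_cont_on 0 1 u" by (rule has_vector_derivative_abs_cont[OF d1 c1])
  have "abs_cont_on 0 1 u1" by (rule has_vector_derivative_abs_cont[OF d2 c2])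
  then show "abs_cont_on 0 1 (deriv01 u)" by (rule abs_cont_on_cong) (simp add: deriv01)
qed

lemma cont_deriv: "continuous_on {0..1} (deriv01 u)" "continuous_on {0..1} (deriv2_01 u)"
  by (rule continuous_on_eq[OF c1], simp add: deriv01) (rule continuous_on_eq[OF c2], simp add: deriv2_01)

lemma diff: "diff01_on {0..1} u" "diff01_on {0..1} (deriv01 u)"
proof -
  show "diff01_on {0..1} u"
    unfolding diff01_on_def using d1 by (blast intro: differentiableI_vector)
  have "(deriv01 u has_vector_derivative u2 x) (at x within {0..1})" if "x \<in> {0..1}" for x
    by (rule has_vector_derivative_transform[OF that _ d2[OF that]]) (simp add: deriv01)
  then show "diff01_on {0..1} (deriv01 u)"
    unfolding diff01_on_def by (blast intro: differentiableI_vector)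
qed

lemma H2_01: "u \<in> H2_01"
  using abs_cont cont_deriv diff by (auto simp: H2_01_def H1_01_def intro: L2_01_continuous)

lemma H2a0:
  assumes a: "continuous_on {0..1} a"
    and bc: "u 0 = 0" "u 1 = 0" "u1 1 = 0" "weakly_degenerate a \<Longrightarrow> u1 0 = 0"
  shows "u \<in> H2a0 a"
proof -
  have "(\<lambda>x. sqrt (a x) * deriv2_01 u x) \<in> L2_01"
    by (intro L2_01_continuous continuous_intros a cont_deriv)
  moreover have "diff01_on {0<..1} u" using diff(1) by (auto simp: diff01_on_def)
  ultimately show ?thesis
    using abs_cont diff cont_deriv bc
    by (auto simp: H2a0_def H2a0_wd_def H2a0_sd_def H10_01_def H1_01_def deriv01
        intro: L2_01_continuous abs_cont_on_subset)
qed

end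

lemma bump_C2:
  assumes "bump p"
  obtains p' p'' where "C2_function p p' p''" "p' 0 = 0" "p' 1 = 0" "p 0 = 0" "p 1 = 0"
proof -
  obtain p' p'' \<delta> where p: "\<And>x. (p has_real_derivative p' x) (at x)" "\<And>x. (p' has_real_derivative p'' x) (at x)"
    "continuous_on UNIV p''" and \<delta>: "\<delta> > 0" "\<And>x. x \<notin> {\<delta>..1 - \<delta>} \<Longrightarrow> p x = 0"
    using assms unfolding bump_def by blast
  have z: "p' x = 0" if "x \<notin> {\<delta>..1 - \<delta>}" for x
  proof -
    have "((\<lambda>_. 0) has_real_derivative 0) (at x)" by simp
    then have "(p has_real_derivative 0) (at x)"
      by (rule has_field_derivative_transform_within_open[of _ _ _ "- {\<delta>..1 - \<delta>}"]) (use that \<delta>(2) in auto)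
    then show ?thesis using p(1) DERIV_unique by blast
  qed
  have "C2_function p p' p''"
    using p by unfold_locales
      (auto simp: has_real_derivative_iff_has_vector_derivative intro: has_vector_derivative_at_within continuous_on_subset)
  then show thesis using that z \<delta> by simp
qed

lemma degenerate_continuous:
  assumes "weakly_degenerate a \<or> strongly_degenerate a"
  shows "continuous_on {0..1} a"
  using assms
proof
  assume "strongly_degenerate a"
  then have "\<forall>x\<in>{0..1}. a differentiable (at x within {0..1})"
    by (simp add: strongly_degenerate_def diff01_on_def)
  then show ?thesis
    by (auto simp: continuous_on_eq_continuous_within intro: differentiable_imp_continuous_within)
qed (simp add: weakly_degenerate_def)

lemma bump_H2a0:
  assumes "weakly_degenerate a \<or> strongly_degenerate a" "bump p"
  shows "p \<in> H2a0 a"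
proof -
  obtain p' p'' where p: "C2_function p p' p''" "p' 0 = 0" "p' 1 = 0" "p 0 = 0" "p 1 = 0"
    using bump_C2[OF assms(2)] .
  show ?thesis
    using C2_function.H2a0[OF p(1) degenerate_continuous[OF assms(1)]] p by simp
qed

text \<open>A nonzero value at 0 would persist on an interval, which is not negligible. This
  identifies the boundary value of a representative chosen by \<open>SOME\<close>.\<close>

lemma continuous_AE_zero:
  assumes f: "continuous_on {0..1} f" and ae: "AE x in leb01. f x = (0 :: real)"
  shows "f 0 = 0"
proof (rule ccontr)
  assume "f 0 \<noteq> 0"
  obtain N where N: "negligible N" "\<And>x. x \<in> {0<..<1} - N \<Longrightarrow> f x = 0"
    using AE_leb01_imp_negligible[OF ae] by blast
  have "(f \<longlongrightarrow> f 0) (at_right 0)" using f by (intro continuous_on_Icc_at_rightD[of 0 1]) auto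
  then have "\<forall>\<^sub>F x in at_right 0. f x \<noteq> 0" using \<open>f 0 \<noteq> 0\<close> by (rule tendsto_imp_eventually_ne)
  then obtain b where b: "0 < b" "\<And>x. 0 < x \<Longrightarrow> x < b \<Longrightarrow> f x \<noteq> 0"
    by (auto simp: eventually_at_right_field)
  have "{0<..<min b 1} \<subseteq> N"
  proof
    fix x assume "x \<in> {0<..<min b 1}"
    then have "f x \<noteq> 0" "x \<in> {0<..<1}" using b(2)[of x] by auto
    then show "x \<in> N" using N(2)[of x] by blast
  qed
  then have "negligible (box 0 (min b 1))" using N(1) negligible_subset by (simp add: box_real)
  then have "box 0 (min b 1) = {}" by (simp only: negligible_interval)
  then show False using b(1) by (simp add: box_real)
qed

text \<open>Near 0 the quotient is identically 0, and elsewhere the denominator is positive.\<close>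

lemma bump_div_continuous:
  assumes p: "bump p" and a: "continuous_on {0..1} a" "\<forall>x\<in>{0<..1}. a x > 0"
  shows "continuous_on {0..1} (\<lambda>x. p x / a x)"
  unfolding continuous_on_eq_continuous_within
proof
  obtain \<delta> where \<delta>: "\<delta> > 0" "\<And>x. x \<notin> {\<delta>..1 - \<delta>} \<Longrightarrow> p x = 0" using p unfolding bump_def by blast
  fix x :: real assume x: "x \<in> {0..1}"
  show "continuous (at x within {0..1}) (\<lambda>x. p x / a x)"
  proof (cases "x = 0")
    case True
    have "continuous (at x within {0..1}) (\<lambda>_. 0 :: real)" by simp
    then show ?thesis
      by (rule continuous_transform_within[OF _ \<delta>(1) x]) (use True \<delta>(2) in \<open>auto simp: dist_real_def\<close>)
  next
    case False
    then have "x \<in> {0<..1}" using x by simp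
    then have "a x \<noteq> 0" using a(2) by fastforce
    then show ?thesis
      using x a(1) continuous_on_bump[OF p, of "{0..1}"]
      by (auto simp: continuous_on_def continuous_within intro!: tendsto_divide)
  qed
qed

text \<open>The function \<open>\<integral>\<^sub>x\<^sup>1 (s - x) z s ds\<close> has second derivative \<open>z\<close>; the vanishing moments of
  \<open>z\<close> give the boundary conditions at 0.\<close>

lemma domA_of_bump:
  assumes deg: "weakly_degenerate a \<or> strongly_degenerate a" and p: "bump p"
    and m1: "(LINT x|leb01. x * (p x / a x)) = 0"
    and m0: "weakly_degenerate a \<Longrightarrow> (LINT x|leb01. p x / a x) = 0"
  obtains u where "u \<in> domA a" "\<And>x. x \<in> {0..1} \<Longrightarrow> deriv2_01 u x = p x / a x"
proof -
  define z where "z = (\<lambda>x. p x / a x)"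
  note pos = degenerate_pos[OF deg] and ca = degenerate_continuous[OF deg]
  have cz: "continuous_on {0..1} z" unfolding z_def by (rule bump_div_continuous[OF p ca pos])
  obtain Z where Z: "\<And>x. x \<in> {0..1} \<Longrightarrow> (Z has_vector_derivative z x) (at x within {0..1})"
    using antiderivative_continuous[OF cz] by blast
  \<comment> \<open>Normalising both antiderivatives at 1 provides the boundary conditions
    there.\<close>
  define u1 where "u1 = (\<lambda>x. Z x - Z 1)"
  have u1: "(u1 has_vector_derivative z x) (at x within {0..1})" if "x \<in> {0..1}" for x
    unfolding u1_def using Z[OF that] by (auto intro!: derivative_eq_intros)
  then have "continuous_on {0..1} u1"
    unfolding continuous_on_eq_continuous_within using has_vector_derivative_continuous by blast
  from antiderivative_continuous[OF this]
  obtain Y where Y: "\<And>x. x \<in> {0..1} \<Longrightarrow> (Y has_vector_derivative u1 x) (at x within {0..1})" by blast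
  define u where "u = (\<lambda>x. Y x - Y 1)"
  have u: "(u has_vector_derivative u1 x) (at x within {0..1})" if "x \<in> {0..1}" for x
    unfolding u_def using Y[OF that] by (auto intro!: derivative_eq_intros)
  interpret C2_function u u1 z by unfold_locales (use u u1 cz in auto)
  have bc1: "u 1 = 0" "u1 1 = 0" by (simp_all add: u_def u1_def)
  have "(z has_integral u1 1 - u1 0) {0..1}"
    by (intro fundamental_theorem_of_calculus u1) auto
  then have "(LINT x|leb01. z x) = - u1 0"
    using integrable_leb01_integral(2)[OF L2_01_integrable[OF L2_01_continuous[OF cz]]] bc1
    by (simp add: integral_unique)
  then have u10: "weakly_degenerate a \<Longrightarrow> u1 0 = 0" using m0 by (simp add: z_def)
  have cxz: "continuous_on {0..1} (\<lambda>x. x * z x)" by (intro continuous_intros cz)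
  \<comment> \<open>\<open>x u' - u\<close> is an antiderivative of \<open>x u''\<close>; the
    conditions at 1 leave only \<open>u 0\<close>.\<close>
  have "((\<lambda>x. x * z x) has_integral (1 * u1 1 - u 1) - (0 * u1 0 - u 0)) {0..1}"
  proof (rule fundamental_theorem_of_calculus)
    fix x :: real assume x: "x \<in> {0..1}"
    show "((\<lambda>x. x * u1 x - u x) has_vector_derivative x * z x) (at x within {0..1})"
      using u[OF x] u1[OF x] by (auto intro!: derivative_eq_intros)
  qed simp
  then have "(LINT x|leb01. x * z x) = u 0"
    using integrable_leb01_integral(2)[OF L2_01_integrable[OF L2_01_continuous[OF cxz]]] bc1
    by (simp add: integral_unique)
  then have u0: "u 0 = 0" using m1 by (simp add: z_def)
  have uH: "u \<in> H2a0 a" by (rule H2a0[OF ca u0 bc1 u10])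
  obtain p' p'' where p2: "C2_function p p' p''" "p 0 = 0" using bump_C2[OF p] by blast
  have rep: "H2_rep (\<lambda>x. a x * deriv2_01 u x) p"
    unfolding H2_rep_def
  proof
    show "p \<in> H2_01" by (rule C2_function.H2_01[OF p2(1)])
    have "p x = a x * deriv2_01 u x" if "x \<in> {0<..<1}" for x
      using that pos by (subst deriv2_01) (force simp: z_def)+
    then show "AE x in leb01. p x = a x * deriv2_01 u x" by (intro AE_I2) simp
  qed
  \<comment> \<open>\<open>flux\<close> is an unspecified representative, but it agrees with
    \<open>p\<close> almost everywhere and both are continuous, so it shares the value of
    \<open>p\<close> at 0.\<close>
  have "flux a u 0 = 0"
  proof -
    have q: "H2_rep (\<lambda>x. a x * deriv2_01 u x) (flux a u)"
      unfolding flux_def by (rule someI[of "H2_rep (\<lambda>x. a x * deriv2_01 u x)" p, OF rep])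
    have "continuous_on {0..1} (\<lambda>x. flux a u x - p x)"
      using q rep by (intro continuous_intros abs_cont_on_imp_continuous H2_01D) (auto simp: H2_rep_def)
    moreover have "AE x in leb01. flux a u x - p x = 0"
    proof -
      have "AE x in leb01. flux a u x = a x * deriv2_01 u x" "AE x in leb01. p x = a x * deriv2_01 u x"
        using q rep by (auto simp: H2_rep_def)
      then show ?thesis by eventually_elim simp
    qed
    ultimately have "flux a u 0 - p 0 = 0" by (rule continuous_AE_zero)
    then show ?thesis using p2 by simp
  qed
  then have "u \<in> domA a" using uH rep by (auto simp: domA_def)
  then show thesis using that deriv2_01 by (auto simp: z_def)
qed

section \<open>Correction of the moments\<close>

text \<open>The exceptional point \<open>m\<close> admits integrands containing a square
  \<open>(x - m)^2\<close>.\<close>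

lemma integral_leb01_pos:
  fixes g :: "real \<Rightarrow> real"
  assumes g: "continuous_on {0..1} g" "\<And>x. x \<in> {0<..<1} \<Longrightarrow> 0 \<le> g x"
    and pos: "0 \<le> l" "l < r" "r \<le> 1" "\<And>x. x \<in> {l<..<r} - {m} \<Longrightarrow> 0 < g x"
  shows "0 < (LINT x|leb01. g x)"
proof -
  have i: "integrable leb01 g" by (rule L2_01_integrable[OF L2_01_continuous[OF g(1)]])
  have nn: "AE x in leb01. 0 \<le> g x" by (rule AE_I2) (use g(2) in simp)
  have "(LINT x|leb01. g x) \<noteq> 0"
  proof
    assume "(LINT x|leb01. g x) = 0"
    then have "AE x in leb01. g x = 0" using integral_nonneg_eq_0_iff_AE[OF i nn] by simp
    then obtain N where N: "negligible N" "\<And>x. x \<in> {0<..<1} - N \<Longrightarrow> g x = 0"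
      using AE_leb01_imp_negligible by blast
    have "{l<..<r} \<subseteq> N \<union> {m}"
    proof
      fix x assume "x \<in> {l<..<r}"
      then show "x \<in> N \<union> {m}" using pos N(2)[of x] by (cases "x = m") force+
    qed
    moreover have "negligible (N \<union> {m})" using N(1) by simp
    ultimately have "negligible {l<..<r}" by (metis negligible_subset)
    then have "negligible (box l r)" by (simp only: box_real)
    then have "box l r = {}" by (simp only: negligible_interval)
    then show False using pos(2) by (simp add: box_real)
  qed
  moreover have "0 \<le> (LINT x|leb01. g x)" by (rule Bochner_Integration.integral_nonneg_AE[OF nn])
  ultimately show ?thesis by simp
qed

text \<open>The corrections are \<open>B x * (c0 + c1 * x)\<close> for a fixed bump \<open>B\<close>; the linear system for \<open>c0\<close>, \<open>c1\<close> is the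
  Gram matrix of 1 and \<open>x\<close> with weight \<open>B / a\<close>, hence solvable.\<close>

lemma moment_correction:
  assumes deg: "weakly_degenerate a \<or> strongly_degenerate a"
  obtains C where "0 \<le> C" "\<And>e0 e1. \<exists>\<kappa>. bump \<kappa> \<and> (LINT x|leb01. \<kappa> x / a x) = e0 \<and>
     (LINT x|leb01. x * (\<kappa> x / a x)) = e1 \<and> (\<forall>x\<in>{0..1}. \<bar>\<kappa> x / a x\<bar> \<le> C * (\<bar>e0\<bar> + \<bar>e1\<bar>))"
proof -
  note pos = degenerate_pos[OF deg] and ca = degenerate_continuous[OF deg]
  obtain B where B: "bump B" "\<And>x. x \<in> {1 / 4<..<1 - 1 / 4} \<Longrightarrow> 0 < B x" "\<And>x. 0 \<le> B x"
    by (rule bump_exists[of "1 / 4"]) (simp, simp, blast)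
  define z where "z = (\<lambda>x. B x / a x)"
  have cz: "continuous_on {0..1} z" unfolding z_def by (rule bump_div_continuous[OF B(1) ca pos])
  have z0: "0 \<le> z x" if "x \<in> {0<..<1}" for x
  proof -
    have "0 < a x" using pos that by simp
    then show ?thesis using B(3)[of x] by (simp add: z_def)
  qed
  have z1: "0 < z x" if "x \<in> {1 / 4<..<3 / 4}" for x
  proof -
    have "0 < a x" using pos that by simp
    then show ?thesis using B(2)[of x] that by (simp add: z_def)
  qed
  define M where "M k = (LINT x|leb01. x ^ k * z x)" for k :: nat
  have iM: "integrable leb01 (\<lambda>x. x ^ k * z x)" for k
    by (intro L2_01_integrable L2_01_continuous continuous_intros cz)
  have M0: "0 < M 0" unfolding M_def
    by (rule integral_leb01_pos[of _ "1 / 4" "3 / 4" 0]) (use cz z0 z1 in auto)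
  define D where "D = M 0 * M 2 - (M 1)\<^sup>2"
  \<comment> \<open>The variance of \<open>x\<close> under the weight \<open>z\<close>; multiplied
    by \<open>M 0\<close> it is the Gram determinant \<open>D\<close>.\<close>
  have "0 < (LINT x|leb01. (x - M 1 / M 0)\<^sup>2 * z x)"
    by (rule integral_leb01_pos[of _ "1 / 4" "3 / 4" "M 1 / M 0"]) (use z0 z1 in \<open>auto intro!: continuous_intros cz\<close>)
  also have "(\<lambda>x. (x - M 1 / M 0)\<^sup>2 * z x) =
      (\<lambda>x. x ^ 2 * z x - 2 * (M 1 / M 0) * (x ^ 1 * z x) + (M 1 / M 0)\<^sup>2 * (x ^ 0 * z x))"
    by (auto simp: power2_eq_square algebra_simps)
  also have "(LINT x|leb01. x ^ 2 * z x - 2 * (M 1 / M 0) * (x ^ 1 * z x) + (M 1 / M 0)\<^sup>2 * (x ^ 0 * z x))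
      = M 2 - 2 * (M 1 / M 0) * M 1 + (M 1 / M 0)\<^sup>2 * M 0"
    unfolding M_def[of 2] M_def[of 1] M_def[of 0]
    using iM[of 2] iM[of 1] iM[of 0] by simp
  finally have "0 < M 0 * (M 2 - 2 * (M 1 / M 0) * M 1 + (M 1 / M 0)\<^sup>2 * M 0)" using M0 by simp
  then have D: "0 < D" using M0 by (simp add: D_def power2_eq_square field_simps)
  have "bounded (z ` {0..1})" by (intro compact_imp_bounded compact_continuous_image cz) auto
  then obtain S where S: "\<And>x. x \<in> {0..1} \<Longrightarrow> \<bar>z x\<bar> \<le> S"
    by (auto simp: bounded_iff simp del: atLeastAtMost_iff)
  then have "0 \<le> S" by (meson abs_ge_zero atLeastAtMost_iff order_refl order_trans zero_le_one)
  \<comment> \<open>Chosen so that every moment is at most \<open>L * D\<close>, which bounds the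
    coefficients below by \<open>L * (\<bar>e0\<bar> + \<bar>e1\<bar>)\<close>.\<close>
  define L where "L = (\<bar>M 0\<bar> + \<bar>M 1\<bar> + \<bar>M 2\<bar>) / D"
  have "0 \<le> L" using D by (simp add: L_def)
  show thesis
  proof (rule that[of "S * (2 * L)"])
    show "0 \<le> S * (2 * L)" using \<open>0 \<le> S\<close> \<open>0 \<le> L\<close> by simp
    fix e0 e1 :: real
    \<comment> \<open>Cramer's rule for the two moment equations.\<close>
    define c0 where "c0 = (M 2 * e0 - M 1 * e1) / D"
    define c1 where "c1 = (M 0 * e1 - M 1 * e0) / D"
    have cL: "\<bar>m * e - n * f\<bar> / D \<le> L * (\<bar>e\<bar> + \<bar>f\<bar>)"
      if "\<bar>m\<bar> \<le> L * D" "\<bar>n\<bar> \<le> L * D" for m n e f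
    proof -
      have "\<bar>m * e - n * f\<bar> \<le> \<bar>m\<bar> * \<bar>e\<bar> + \<bar>n\<bar> * \<bar>f\<bar>" by (metis abs_mult abs_triangle_ineq4)
      also have "\<dots> \<le> (L * D) * \<bar>e\<bar> + (L * D) * \<bar>f\<bar>" using that by (intro add_mono mult_right_mono) auto
      finally show ?thesis using D by (simp add: divide_le_eq algebra_simps)
    qed
    have Mle: "\<bar>M 0\<bar> \<le> L * D" "\<bar>M 1\<bar> \<le> L * D" "\<bar>M 2\<bar> \<le> L * D" using D by (auto simp: L_def)
    have c: "\<bar>c0\<bar> \<le> L * (\<bar>e0\<bar> + \<bar>e1\<bar>)" "\<bar>c1\<bar> \<le> L * (\<bar>e0\<bar> + \<bar>e1\<bar>)"
      using cL[OF Mle(3,2), of e0 e1] cL[OF Mle(1,2), of e1 e0] D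
      by (auto simp: c0_def c1_def add.commute)
    have cD: "c0 * D = M 2 * e0 - M 1 * e1" "c1 * D = M 0 * e1 - M 1 * e0"
      using D by (simp_all add: c0_def c1_def)
    have lin: "c0 * M 0 + c1 * M 1 = e0" "c0 * M 1 + c1 * M 2 = e1"
    proof -
      have "(c0 * M 0 + c1 * M 1) * D = (c0 * D) * M 0 + (c1 * D) * M 1" by (simp add: algebra_simps)
      also have "\<dots> = e0 * D" unfolding cD by (simp add: D_def power2_eq_square algebra_simps)
      finally show "c0 * M 0 + c1 * M 1 = e0" using D by simp
      have "(c0 * M 1 + c1 * M 2) * D = (c0 * D) * M 1 + (c1 * D) * M 2" by (simp add: algebra_simps)
      also have "\<dots> = e1 * D" unfolding cD by (simp add: D_def power2_eq_square algebra_simps)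
      finally show "c0 * M 1 + c1 * M 2 = e1" using D by simp
    qed
    define \<kappa> where "\<kappa> = (\<lambda>x. B x * (c0 + c1 * x))"
    have "real_polynomial_function (\<lambda>x. c0 + c1 * x)"
      by (intro real_polynomial_function.intros bounded_linear_ident)
    then have k: "bump \<kappa>" unfolding \<kappa>_def by (rule bump_mult_polynomial[OF B(1)])
    have kz: "\<kappa> x / a x = c0 * (x ^ 0 * z x) + c1 * (x ^ 1 * z x)" for x
      by (simp add: \<kappa>_def z_def algebra_simps add_divide_distrib)
    have kz1: "x * (\<kappa> x / a x) = c0 * (x ^ 1 * z x) + c1 * (x ^ 2 * z x)" for x
      by (simp add: kz power2_eq_square algebra_simps)
    have "(LINT x|leb01. \<kappa> x / a x) = c0 * M 0 + c1 * M 1"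
      unfolding kz M_def using iM[of 0] iM[of 1] by simp
    also have "\<dots> = e0 * (D / D)" using lin(1) D by simp
    finally have 0: "(LINT x|leb01. \<kappa> x / a x) = e0" using D by simp
    have "(LINT x|leb01. x * (\<kappa> x / a x)) = c0 * M 1 + c1 * M 2"
      unfolding kz1 M_def using iM[of 2] iM[of 1] by simp
    also have "\<dots> = e1 * (D / D)" using lin(2) D by simp
    finally have 1: "(LINT x|leb01. x * (\<kappa> x / a x)) = e1" using D by simp
    have "\<bar>\<kappa> x / a x\<bar> \<le> S * (2 * L) * (\<bar>e0\<bar> + \<bar>e1\<bar>)" if x: "x \<in> {0..1}" for x
    proof -
      have "\<bar>c0 + c1 * x\<bar> \<le> \<bar>c0\<bar> + \<bar>c1\<bar> * \<bar>x\<bar>" by (metis abs_mult abs_triangle_ineq)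
      also have "\<dots> \<le> \<bar>c0\<bar> + \<bar>c1\<bar> * 1" using x by (intro add_left_mono mult_left_mono) auto
      also have "\<dots> \<le> 2 * L * (\<bar>e0\<bar> + \<bar>e1\<bar>)" using c by (simp add: algebra_simps)
      finally have "\<bar>z x\<bar> * \<bar>c0 + c1 * x\<bar> \<le> S * (2 * L * (\<bar>e0\<bar> + \<bar>e1\<bar>))"
        using S[OF x] \<open>0 \<le> S\<close> by (intro mult_mono) auto
      moreover have "\<bar>\<kappa> x / a x\<bar> = \<bar>z x\<bar> * \<bar>c0 + c1 * x\<bar>" by (simp add: \<kappa>_def z_def abs_mult)
      ultimately show ?thesis by (simp only: mult.assoc)
    qed
    then show "\<exists>\<kappa>. bump \<kappa> \<and> (LINT x|leb01. \<kappa> x / a x) = e0 \<and> (LINT x|leb01. x * (\<kappa> x / a x)) = e1 \<and>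
       (\<forall>x\<in>{0..1}. \<bar>\<kappa> x / a x\<bar> \<le> S * (2 * L) * (\<bar>e0\<bar> + \<bar>e1\<bar>))"
      using k 0 1 by blast
  qed
qed

section \<open>Density of the domain\<close>

text \<open>Stated for all small \<open>\<delta>\<close>, not just along a sequence, since
  \<open>small_moments\<close> picks its own \<open>\<delta>\<close>. The cutoff error decreases
  with \<open>\<delta>\<close>, so one good value suffices.\<close>

lemma dist2_restrict:
  assumes f: "f \<in> L2_01" and "0 < \<epsilon>"
  obtains \<delta>0 where "0 < \<delta>0" "\<And>\<delta>. 0 < \<delta> \<Longrightarrow> \<delta> < \<delta>0 \<Longrightarrow> dist2 (\<lambda>x. indicator {\<delta>..1 - \<delta>} x * f x) f < \<epsilon>"
proof -
  have L2: "(\<lambda>x. indicator {\<delta>..1 - \<delta>} x * f x) \<in> L2_01" for \<delta>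
  proof (rule L2_01_bounded_mult[OF f])
    show "(indicator {\<delta>..1 - \<delta>} :: real \<Rightarrow> real) \<in> borel_measurable leb01"
      by (intro measurable_restrict_space1 borel_measurable_indicator) simp
    show "\<bar>indicator {\<delta>..1 - \<delta>} x\<bar> \<le> (1 :: real)" for x by (simp add: indicator_def)
  qed
  define d where "d n = inverse (real (Suc n))" for n
  have "(\<lambda>n. dist2 (\<lambda>x. indicator {d n..1 - d n} x * f x) f) \<longlonglongrightarrow> 0"
  proof (rule dist2_dominated[OF f L2 f])
    have "(\<lambda>n. indicator {d n..1 - d n} x * f x) \<longlonglongrightarrow> f x" if x: "x \<in> {0<..<1}" for x
    proof (rule tendsto_eventually)
      have "\<forall>\<^sub>F n in sequentially. d n < min x (1 - x)"
        using order_tendstoD(2)[OF LIMSEQ_inverse_real_of_nat, of "min x (1 - x)"] x by (simp add: d_def)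
      then show "\<forall>\<^sub>F n in sequentially. indicator {d n..1 - d n} x * f x = f x"
        by eventually_elim simp
    qed
    then show "AE x in leb01. (\<lambda>n. indicator {d n..1 - d n} x * f x) \<longlonglongrightarrow> f x" by (intro AE_I2) simp
    show "AE x in leb01. \<bar>indicator {d n..1 - d n} x * f x - f x\<bar> \<le> \<bar>f x\<bar>" for n
      by (rule AE_I2) (simp add: indicator_def)
  qed
  then obtain n where n: "dist2 (\<lambda>x. indicator {d n..1 - d n} x * f x) f < \<epsilon>"
    using dist2_tendsto_obtain[of "\<lambda>n x. indicator {d n..1 - d n} x * f x" f, OF _ \<open>0 < \<epsilon>\<close>] by blast
  show thesis
  proof (rule that[of "d n"])
    show "0 < d n" by (simp add: d_def)
    fix \<delta> assume \<delta>: "0 < \<delta>" "\<delta> < d n"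
    have "dist2 (\<lambda>x. indicator {\<delta>..1 - \<delta>} x * f x) f \<le> 1\<^sup>2 * dist2 (\<lambda>x. indicator {d n..1 - d n} x * f x) f"
      by (rule dist2_bounded_mult[OF L2 f]) (use \<delta> in \<open>auto simp: indicator_def\<close>)
    then show "dist2 (\<lambda>x. indicator {\<delta>..1 - \<delta>} x * f x) f < \<epsilon>" using n by simp
  qed
qed

lemma bump_L2_dense:
  assumes f: "f \<in> L2_01" and "0 < \<epsilon>"
  obtains p where "bump p" "dist2 p f < \<epsilon>"
proof -
  have "0 < \<epsilon> / 4" using \<open>0 < \<epsilon>\<close> by simp
  then obtain \<delta>0 where \<delta>0: "0 < \<delta>0" "\<And>\<delta>. 0 < \<delta> \<Longrightarrow> \<delta> < \<delta>0 \<Longrightarrow> dist2 (\<lambda>x. indicator {\<delta>..1 - \<delta>} x * f x) f < \<epsilon> / 4"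
    using dist2_restrict[OF f] by blast
  define \<delta> where "\<delta> = min \<delta>0 (1 / 2) / 2"
  have \<delta>: "0 < \<delta>" "\<delta> < \<delta>0" "\<delta> < 1 / 2" using \<delta>0(1) by (auto simp: \<delta>_def min_def)
  let ?z = "\<lambda>x. indicator {\<delta>..1 - \<delta>} x * f x"
  have z: "?z \<in> L2_01"
  proof (rule L2_01_bounded_mult[OF f])
    show "(indicator {\<delta>..1 - \<delta>} :: real \<Rightarrow> real) \<in> borel_measurable leb01"
      by (intro measurable_restrict_space1 borel_measurable_indicator) simp
    show "\<bar>indicator {\<delta>..1 - \<delta>} x\<bar> \<le> (1 :: real)" for x by (simp add: indicator_def)
  qed
  obtain p where p: "bump p" "dist2 (\<lambda>x. p x / 1) ?z < \<epsilon> / 4"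
    by (rule bump_weighted_approx[OF z \<delta>(1,3), of "\<lambda>_. 1" "\<epsilon> / 4"]) (use \<open>0 < \<epsilon>\<close> in auto)
  have "p \<in> L2_01" by (intro L2_01_continuous continuous_on_bump p)
  from dist2_triangle[OF this z f] show thesis
    using that[OF p(1)] p(2) \<delta>0(2)[OF \<delta>(1,2)] by simp
qed

text \<open>The variance is nonnegative, and the interval has measure 1.\<close>

lemma integral_leb01_sq_le:
  assumes "f \<in> L2_01"
  shows "(LINT x|leb01. f x)\<^sup>2 \<le> (LINT x|leb01. (f x)\<^sup>2)"
proof -
  define m where "m = (LINT x|leb01. f x)"
  note i = L2_01_integrable[OF assms] L2_01_D(2)[OF assms]
    finite_measure.integrable_const[OF finite_measure_leb01]
  have "0 \<le> (LINT x|leb01. (f x - m)\<^sup>2)" by simp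
  also have "(\<lambda>x. (f x - m)\<^sup>2) = (\<lambda>x. (f x)\<^sup>2 - 2 * m * f x + m\<^sup>2)"
    by (auto simp: power2_eq_square algebra_simps)
  also have "(LINT x|leb01. (f x)\<^sup>2 - 2 * m * f x + m\<^sup>2) = (LINT x|leb01. (f x)\<^sup>2) - 2 * m * m + m\<^sup>2"
  proof -
    have "integrable leb01 (\<lambda>x. 2 * m * f x)" "(LINT x|leb01. 2 * m * f x) = 2 * m * m"
      using i(1) by (simp_all add: m_def)
    moreover have "integrable leb01 (\<lambda>_. m\<^sup>2)" "(LINT x|leb01. m\<^sup>2) = m\<^sup>2"
      using i(3) measure_leb01 by simp_all
    ultimately show ?thesis
      using i(2) by (simp only: Bochner_Integration.integral_add Bochner_Integration.integral_diff
          Bochner_Integration.integrable_diff)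
  qed
  finally show ?thesis by (simp add: m_def power2_eq_square)
qed

lemma abs_integral_diff_le:
  assumes fg: "f \<in> L2_01" "g \<in> L2_01" and k: "continuous_on {0..1} k" "\<And>x. x \<in> {0<..<1} \<Longrightarrow> \<bar>k x\<bar> \<le> 1"
    and d: "dist2 f g \<le> \<eta>\<^sup>2" "0 \<le> \<eta>"
  shows "\<bar>(LINT x|leb01. k x * f x) - (LINT x|leb01. k x * g x)\<bar> \<le> \<eta>"
proof -
  have km: "k \<in> borel_measurable leb01" using L2_01_D(1)[OF L2_01_continuous[OF k(1)]] .
  note kf = L2_01_bounded_mult[OF fg(1) km k(2)] and kg = L2_01_bounded_mult[OF fg(2) km k(2)]
  have "((LINT x|leb01. k x * f x) - (LINT x|leb01. k x * g x))\<^sup>2 = (LINT x|leb01. k x * f x - k x * g x)\<^sup>2"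
    using L2_01_integrable[OF kf] L2_01_integrable[OF kg] by simp
  also have "\<dots> \<le> dist2 (\<lambda>x. k x * f x) (\<lambda>x. k x * g x)"
    unfolding dist2_def by (rule integral_leb01_sq_le[OF L2_01_diff[OF kf kg]])
  also have "\<dots> \<le> 1\<^sup>2 * dist2 f g"
  proof (rule dist2_bounded_mult[OF fg])
    fix x :: real assume x: "x \<in> {0<..<1}"
    have "\<bar>k x * f x - k x * g x\<bar> = \<bar>k x\<bar> * \<bar>f x - g x\<bar>" by (simp add: abs_mult[symmetric] algebra_simps)
    also have "\<dots> \<le> 1 * \<bar>f x - g x\<bar>" using k(2)[OF x] by (intro mult_right_mono) auto
    finally show "\<bar>k x * f x - k x * g x\<bar> \<le> 1 * \<bar>f x - g x\<bar>" .
  qed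
  also have "\<dots> \<le> \<eta>\<^sup>2" using d by simp
  finally show ?thesis using d(2) by (metis abs_le_square_iff abs_of_nonneg)
qed

text \<open>Cutting off the second derivative of an element of the space destroys the boundary conditions
  only by a small amount. For strongly degenerate coefficients this uses that \<open>\<delta> u' \<delta>\<close> tends to 0
  along a sequence, as \<open>u'\<close> is square integrable.\<close>

lemma small_moments:
  assumes u: "u \<in> H2a0 a" and "0 < \<epsilon>" "0 < \<delta>0"
  obtains \<delta> where "0 < \<delta>" "\<delta> < \<delta>0" "\<delta> < 1 / 2"
    "\<bar>LINT x|leb01. x * (indicator {\<delta>..1 - \<delta>} x * deriv2_01 u x)\<bar> \<le> \<epsilon>"
    "weakly_degenerate a \<Longrightarrow> \<bar>LINT x|leb01. 1 * (indicator {\<delta>..1 - \<delta>} x * deriv2_01 u x)\<bar> \<le> \<epsilon>"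
proof -
  note U = H2a0_sdD[OF H2a0_sd[OF u]]
  \<comment> \<open>Four boundary terms, each at most \<open>e\<close>.\<close>
  define e where "e = \<epsilon> / 4"
  have "e > 0" using \<open>0 < \<epsilon>\<close> by (simp add: e_def)
  have cu: "continuous_on {0..1} u" by (rule abs_cont_on_imp_continuous[OF U(1)])
  have cd: "continuous_on {1/2..1} (deriv01 u)" by (rule abs_cont_on_imp_continuous[OF U(6)]) simp
  have lims: "(u \<longlongrightarrow> 0) (at_right 0)" "(u \<longlongrightarrow> 0) (at_left 1)" "(deriv01 u \<longlongrightarrow> 0) (at_left 1)"
    using continuous_on_Icc_at_rightD[OF cu] continuous_on_Icc_at_leftD[OF cu] continuous_on_Icc_at_leftD[OF cd] U
    by auto
  have "\<forall>\<^sub>F x in at_right 0. \<bar>u x\<bar> < e" using tendstoD[OF lims(1) \<open>e > 0\<close>] by simp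
  then obtain b1 where b1: "0 < b1" "\<And>x. 0 < x \<Longrightarrow> x < b1 \<Longrightarrow> \<bar>u x\<bar> < e"
    by (auto simp: eventually_at_right_field)
  have "\<forall>\<^sub>F x in at_left 1. \<bar>u x\<bar> < e \<and> \<bar>deriv01 u x\<bar> < e"
    using tendstoD[OF lims(2) \<open>e > 0\<close>] tendstoD[OF lims(3) \<open>e > 0\<close>] by eventually_elim simp
  then obtain b2 where b2: "b2 < 1" "\<And>x. b2 < x \<Longrightarrow> x < 1 \<Longrightarrow> \<bar>u x\<bar> < e \<and> \<bar>deriv01 u x\<bar> < e"
    by (auto simp: eventually_at_left_field)
  have "\<exists>b3>0. weakly_degenerate a \<longrightarrow> (\<forall>x. 0 < x \<and> x < b3 \<longrightarrow> \<bar>deriv01 u x\<bar> < e)"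
  proof (cases "weakly_degenerate a")
    case True
    then have wd: "u \<in> H2a0_wd a" using u by (simp add: H2a0_def)
    have "(deriv01 u \<longlongrightarrow> deriv01 u 0) (at_right 0)"
      using H2a0_wdD(3)[OF wd] by (intro continuous_on_Icc_at_rightD[of 0 1] abs_cont_on_imp_continuous) auto
    then have "\<forall>\<^sub>F x in at_right 0. \<bar>deriv01 u x\<bar> < e"
      using tendstoD[OF _ \<open>e > 0\<close>] H2a0_wdD(4)[OF wd] by fastforce
    then show ?thesis by (auto simp: eventually_at_right_field)
  qed (auto intro: exI[of _ 1])
  then obtain b3 where b3: "0 < b3" "\<And>x. weakly_degenerate a \<Longrightarrow> 0 < x \<Longrightarrow> x < b3 \<Longrightarrow> \<bar>deriv01 u x\<bar> < e"
    by blast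
  define b where "b = min (min \<delta>0 (1 / 2)) (min b1 (min (1 - b2) b3))"
  have "0 < b" using b1 b2 b3 \<open>0 < \<delta>0\<close> by (simp add: b_def)
  then obtain \<delta> where \<delta>: "0 < \<delta>" "\<delta> < b" "\<delta> * \<bar>deriv01 u \<delta>\<bar> < e"
    using L2_01_liminf_at_0[OF U(2) _ \<open>e > 0\<close>] by blast
  have \<delta>b: "\<delta> < \<delta>0" "\<delta> < 1 / 2" "\<delta> < b1" "b2 < 1 - \<delta>" "\<delta> < b3" using \<delta>(2) by (auto simp: b_def)
  have small: "\<bar>u \<delta>\<bar> < e" "\<bar>u (1 - \<delta>)\<bar> < e" "\<bar>deriv01 u (1 - \<delta>)\<bar> < e"
    using b1(2)[of \<delta>] b2(2)[of "1 - \<delta>"] \<delta> \<delta>b by auto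
  have AC: "abs_cont_on \<delta> (1 - \<delta>) (deriv01 u)"
    by (rule abs_cont_on_subset[OF U(6)[of \<delta>]]) (use \<delta> \<delta>b in auto)
  have i0: "(deriv2_01 u has_integral deriv01 u (1 - \<delta>) - deriv01 u \<delta>) {\<delta>..1 - \<delta>}"
    using abs_cont_on_deriv01(2)[OF _ _ _ AC, of "1 - \<delta>"] \<delta> \<delta>b by auto
  have ai0: "deriv2_01 u absolutely_integrable_on {\<delta>..1 - \<delta>}"
    using abs_cont_on_deriv01(1)[OF _ _ _ AC] \<delta> \<delta>b by auto
  \<comment> \<open>The antiderivative \<open>x u' - u\<close> of \<open>x u''\<close>, whose
    boundary values at \<open>\<delta>\<close> involve \<open>u'\<close> only through
    \<open>\<delta> u' \<delta>\<close>.\<close>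
  define w where "w = (\<lambda>x. 1 * (x * deriv01 u x) + (-1) * u x)"
  have ACx: "abs_cont_on \<delta> (1 - \<delta>) (\<lambda>x. x)" by (rule abs_cont_on_lipschitz[of _ _ _ 1]) auto
  have ACw: "abs_cont_on \<delta> (1 - \<delta>) w"
    unfolding w_def using \<delta> \<delta>b by (intro abs_cont_on_lincomb abs_cont_on_mult ACx AC abs_cont_on_subset[OF U(1)]) auto
  have iw: "(deriv01 w has_integral w (1 - \<delta>) - w \<delta>) {\<delta>..1 - \<delta>}"
    using abs_cont_on_deriv01(2)[OF _ _ _ ACw, of "1 - \<delta>"] \<delta> \<delta>b by auto
  obtain N where N: "negligible N" "\<And>x. x \<in> {0<..<1} - N \<Longrightarrow> (deriv01 u has_real_derivative deriv2_01 u x) (at x)"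
    using H2a0_sd_AE_deriv2[OF H2a0_sd[OF u]] by blast
  have "x * deriv2_01 u x = deriv01 w x" if x: "x \<in> {\<delta>..1 - \<delta>} - N" for x
  proof -
    have x': "x \<in> {0<..<1}" using x \<delta> by auto
    have "(w has_real_derivative x * deriv2_01 u x) (at x)"
      unfolding w_def using x x' N(2)[of x] diff01_on_DERIV[OF U(5), of x]
      by (auto intro!: derivative_eq_intros simp: algebra_simps)
    then show ?thesis using x' by (intro deriv01_DERIV[symmetric]) auto
  qed
  then have i1: "((\<lambda>x. x * deriv2_01 u x) has_integral w (1 - \<delta>) - w \<delta>) {\<delta>..1 - \<delta>}"
    using has_integral_spike[OF N(1) _ iw, of "\<lambda>x. x * deriv2_01 u x"] by blast
  \<comment> \<open>Turns a gauge integral over \<open>{\<delta>..1 - \<delta>}\<close> into a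
    Lebesgue integral over the unit interval. The absolute integrability this requires comes from
    the absolute continuity of \<open>u'\<close> on the smaller interval.\<close>
  have int: "(LINT x|leb01. k x * (indicator {\<delta>..1 - \<delta>} x * deriv2_01 u x)) = I"
    if hk: "((\<lambda>x. k x * deriv2_01 u x) has_integral I) {\<delta>..1 - \<delta>}"
      and k: "continuous_on {0..1} k" for k I
  proof -
    have kc: "continuous_on {\<delta>..1 - \<delta>} k" using k by (rule continuous_on_subset) (use \<delta> in auto)
    have "(\<lambda>x. k x * deriv2_01 u x) absolutely_integrable_on {\<delta>..1 - \<delta>}"
      using kc by (intro absolutely_integrable_bounded_measurable_product_real ai0
          continuous_imp_measurable_on_sets_lebesgue compact_imp_bounded compact_continuous_image) auto
    then have "integrable (lebesgue_on {\<delta>..1 - \<delta>}) (\<lambda>x. k x * deriv2_01 u x)"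
      and "integral\<^sup>L (lebesgue_on {\<delta>..1 - \<delta>}) (\<lambda>x. k x * deriv2_01 u x) = I"
      using hk by (auto simp: integrable_restrict_space set_integrable_def lebesgue_integral_eq_integral integral_unique)
    then have "(LINT x|lebesgue. indicator {\<delta>..1 - \<delta>} x * (k x * deriv2_01 u x)) = I"
      by (simp add: integral_restrict_space)
    moreover have "(LINT x|leb01. k x * (indicator {\<delta>..1 - \<delta>} x * deriv2_01 u x)) =
      (LINT x|lebesgue. indicator {0<..<1} x * (k x * (indicator {\<delta>..1 - \<delta>} x * deriv2_01 u x)))"
      by (simp add: integral_restrict_space)
    moreover have "indicator {0<..<1} x * (k x * (indicator {\<delta>..1 - \<delta>} x * deriv2_01 u x))
       = indicator {\<delta>..1 - \<delta>} x * (k x * deriv2_01 u x)" for x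
      using \<delta> by (auto simp: indicator_def)
    ultimately show ?thesis by simp
  qed
  show thesis
  proof (rule that[OF \<delta>(1) \<delta>b(1,2)])
    have "(1 - \<delta>) * \<bar>deriv01 u (1 - \<delta>)\<bar> \<le> 1 * \<bar>deriv01 u (1 - \<delta>)\<bar>"
      using \<delta> by (intro mult_right_mono) auto
    then have "\<bar>(1 - \<delta>) * deriv01 u (1 - \<delta>)\<bar> \<le> e" using small \<delta> \<delta>b by (simp add: abs_mult)
    moreover have "\<bar>\<delta> * deriv01 u \<delta>\<bar> \<le> e" using \<delta> by (simp add: abs_mult)
    moreover have "w (1 - \<delta>) - w \<delta> = (1 - \<delta>) * deriv01 u (1 - \<delta>) - u (1 - \<delta>) - \<delta> * deriv01 u \<delta> + u \<delta>"
      by (simp add: w_def)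
    ultimately have "\<bar>w (1 - \<delta>) - w \<delta>\<bar> \<le> \<epsilon>" using small unfolding e_def by linarith
    then show "\<bar>LINT x|leb01. x * (indicator {\<delta>..1 - \<delta>} x * deriv2_01 u x)\<bar> \<le> \<epsilon>"
      using int[OF i1] by (simp add: continuous_on_id)
    assume "weakly_degenerate a"
    then have "\<bar>deriv01 u \<delta>\<bar> < e" using b3 \<delta> \<delta>b by simp
    then have "\<bar>deriv01 u (1 - \<delta>) - deriv01 u \<delta>\<bar> \<le> \<epsilon>" using small unfolding e_def by linarith
    then show "\<bar>LINT x|leb01. 1 * (indicator {\<delta>..1 - \<delta>} x * deriv2_01 u x)\<bar> \<le> \<epsilon>"
      using int[of "\<lambda>_. 1"] i0 by simp
  qed
qed

text \<open>The chain runs from \<open>u''\<close> through its cutoff \<open>z\<close> and the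
  smooth \<open>P = p / a\<close> to \<open>v'' = P - \<kappa> / a\<close>. Closeness of
  \<open>P\<close> to \<open>z\<close> without the weight keeps the moments of \<open>P\<close>
  small, so the correction \<open>\<kappa>\<close> is small too.\<close>

lemma domA_approx:
  assumes deg: "weakly_degenerate a \<or> strongly_degenerate a" and u: "u \<in> H2a0 a" and "0 < \<epsilon>"
  obtains v where "v \<in> domA a"
    "dist2 (\<lambda>x. sqrt (a x) * deriv2_01 v x) (\<lambda>x. sqrt (a x) * deriv2_01 u x) < \<epsilon>"
proof -
  note pos = degenerate_pos[OF deg] and ca = degenerate_continuous[OF deg]
  note U = H2a0_sdD[OF H2a0_sd[OF u]]
  have "bounded (a ` {0..1})" by (intro compact_imp_bounded compact_continuous_image ca) auto
  then obtain A where A: "\<And>x. x \<in> {0..1} \<Longrightarrow> \<bar>a x\<bar> \<le> A"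
    by (auto simp: bounded_iff simp del: atLeastAtMost_iff)
  then have "0 \<le> A" by (meson abs_ge_zero atLeastAtMost_iff order_refl order_trans zero_le_one)
  have sA: "\<bar>sqrt (a x)\<bar> \<le> sqrt A" if "x \<in> {0..1}" for x
  proof -
    have "\<bar>sqrt (a x)\<bar> = sqrt \<bar>a x\<bar>" by (cases "0 \<le> a x") (simp_all add: real_sqrt_minus[symmetric])
    then show ?thesis using A[OF that] by simp
  qed
  obtain C where C: "0 \<le> C" "\<And>e0 e1. \<exists>\<kappa>. bump \<kappa> \<and> (LINT x|leb01. \<kappa> x / a x) = e0 \<and>
     (LINT x|leb01. x * (\<kappa> x / a x)) = e1 \<and> (\<forall>x\<in>{0..1}. \<bar>\<kappa> x / a x\<bar> \<le> C * (\<bar>e0\<bar> + \<bar>e1\<bar>))"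
    using moment_correction[OF deg] by blast
  \<comment> \<open>Collects the errors in units of \<open>\<eta>\<close> squared: the weight times
    the smoothing error, the weight times the correction of size \<open>4 * C * \<eta>\<close>, and
    1 for positivity.\<close>
  define Q where "Q = (sqrt A)\<^sup>2 * (1 + (4 * C)\<^sup>2) + 1"
  have "0 < Q" unfolding Q_def by (intro add_nonneg_pos mult_nonneg_nonneg) auto
  define \<eta> where "\<eta> = sqrt (\<epsilon> / 16 / Q)"
  have \<eta>: "0 < \<eta>" "\<eta>\<^sup>2 * Q = \<epsilon> / 16"
    using \<open>0 < \<epsilon>\<close> \<open>0 < Q\<close> by (simp_all add: \<eta>_def)
  define w where "w = (\<lambda>x. sqrt (a x) * deriv2_01 u x)"
  have wL: "w \<in> L2_01" using U(8) by (simp add: w_def)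
  have "0 < \<epsilon> / 16" using \<open>0 < \<epsilon>\<close> by simp
  then obtain \<delta>0 where \<delta>0: "0 < \<delta>0"
    "\<And>\<delta>. 0 < \<delta> \<Longrightarrow> \<delta> < \<delta>0 \<Longrightarrow> dist2 (\<lambda>x. indicator {\<delta>..1 - \<delta>} x * w x) w < \<epsilon> / 16"
    using dist2_restrict[OF wL] by blast
  obtain \<delta> where \<delta>: "0 < \<delta>" "\<delta> < \<delta>0" "\<delta> < 1 / 2"
    and mom: "\<bar>LINT x|leb01. x * (indicator {\<delta>..1 - \<delta>} x * deriv2_01 u x)\<bar> \<le> \<eta>"
    "weakly_degenerate a \<Longrightarrow> \<bar>LINT x|leb01. 1 * (indicator {\<delta>..1 - \<delta>} x * deriv2_01 u x)\<bar> \<le> \<eta>"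
    using small_moments[OF u \<eta>(1) \<delta>0(1)] by blast
  define z where "z = (\<lambda>x. indicator {\<delta>..1 - \<delta>} x * deriv2_01 u x)"
  have im: "(indicator {\<delta>..1 - \<delta>} :: real \<Rightarrow> real) \<in> borel_measurable leb01"
    by (intro measurable_restrict_space1 borel_measurable_indicator) simp
  have apos: "0 < a x" if "x \<in> {\<delta>..1 - \<delta>}" for x using pos \<delta> that by simp
  have zL: "z \<in> L2_01"
  proof -
    have "bounded ((\<lambda>x. 1 / sqrt (a x)) ` {\<delta>..1 - \<delta>})"
    proof (intro compact_imp_bounded compact_continuous_image continuous_intros)
      show "continuous_on {\<delta>..1 - \<delta>} a" using \<delta> by (intro continuous_on_subset[OF ca]) auto
      show "\<forall>x\<in>{\<delta>..1 - \<delta>}. sqrt (a x) \<noteq> 0" using apos by fastforce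
    qed auto
    then obtain K where K: "\<And>x. x \<in> {\<delta>..1 - \<delta>} \<Longrightarrow> \<bar>1 / sqrt (a x)\<bar> \<le> K"
      by (auto simp: bounded_iff simp del: atLeastAtMost_iff)
    have "1 / 2 \<in> {\<delta>..1 - \<delta>}" using \<delta> by auto
    then have "0 \<le> K" using K by (meson abs_ge_zero order_trans)
    have "a \<in> borel_measurable leb01" using L2_01_D(1)[OF L2_01_continuous[OF ca]] .
    then have "(\<lambda>x. (indicator {\<delta>..1 - \<delta>} x * (1 / sqrt (a x))) * w x) \<in> L2_01"
    proof (intro L2_01_bounded_mult[OF wL])
      show "\<bar>indicator {\<delta>..1 - \<delta>} x * (1 / sqrt (a x))\<bar> \<le> K" for x
        using K[of x] \<open>0 \<le> K\<close> by (cases "x \<in> {\<delta>..1 - \<delta>}") auto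
    qed (use im in measurable)
    moreover have "(indicator {\<delta>..1 - \<delta>} x * (1 / sqrt (a x))) * w x = z x" for x
      using apos[of x] by (cases "x \<in> {\<delta>..1 - \<delta>}") (simp_all add: z_def w_def)
    ultimately show ?thesis by simp
  qed
  have a01: "continuous_on {0<..<1} a" by (rule continuous_on_subset[OF ca]) auto
  obtain p where p: "bump p" "dist2 (\<lambda>x. p x / a x) z < \<eta>\<^sup>2"
    by (rule bump_weighted_approx[OF zL \<delta>(1,3), of a "\<eta>\<^sup>2"])
      (use a01 pos \<eta>(1) in \<open>auto simp: z_def\<close>)
  define P where "P = (\<lambda>x. p x / a x)"
  have cP: "continuous_on {0..1} P" unfolding P_def by (rule bump_div_continuous[OF p(1) ca pos])
  note PL = L2_01_continuous[OF cP]
  have dPz: "dist2 P z \<le> \<eta>\<^sup>2" using p(2) by (simp add: P_def)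
  define e1 where "e1 = (LINT x|leb01. x * P x)"
  \<comment> \<open>In the strongly degenerate case \<open>u' 0\<close> is unconstrained, so the
    integral of \<open>u''\<close> is left as it is.\<close>
  define e0 where "e0 = (if weakly_degenerate a then (LINT x|leb01. P x) else 0)"
  have "\<bar>(LINT x|leb01. x * P x) - (LINT x|leb01. x * z x)\<bar> \<le> \<eta>"
    by (rule abs_integral_diff_le[OF PL zL _ _ dPz]) (use \<eta> in auto)
  then have e1: "\<bar>e1\<bar> \<le> 2 * \<eta>" using mom(1) unfolding e1_def z_def by linarith
  have "\<bar>(LINT x|leb01. 1 * P x) - (LINT x|leb01. 1 * z x)\<bar> \<le> \<eta>"
    by (rule abs_integral_diff_le[OF PL zL _ _ dPz]) (use \<eta> in auto)
  then have e0: "\<bar>e0\<bar> \<le> 2 * \<eta>"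
    using mom(2) \<eta> unfolding e0_def z_def mult_1 by (cases "weakly_degenerate a") auto
  obtain \<kappa> where \<kappa>: "bump \<kappa>" "(LINT x|leb01. \<kappa> x / a x) = e0" "(LINT x|leb01. x * (\<kappa> x / a x)) = e1"
      "\<And>x. x \<in> {0..1} \<Longrightarrow> \<bar>\<kappa> x / a x\<bar> \<le> C * (\<bar>e0\<bar> + \<bar>e1\<bar>)"
    using C(2)[of e0 e1] by blast
  have ck: "continuous_on {0..1} (\<lambda>x. \<kappa> x / a x)" by (rule bump_div_continuous[OF \<kappa>(1) ca pos])
  define r where "r = (\<lambda>x. p x - \<kappa> x)"
  have r: "bump r" unfolding r_def by (rule bump_diff[OF p(1) \<kappa>(1)])
  have rP: "r x / a x = P x - \<kappa> x / a x" for x by (simp add: r_def P_def diff_divide_distrib)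
  have r1: "(LINT x|leb01. x * (r x / a x)) = 0"
  proof -
    have "integrable leb01 (\<lambda>x. x * P x)" "integrable leb01 (\<lambda>x. x * (\<kappa> x / a x))"
      by (intro L2_01_integrable L2_01_continuous continuous_intros cP ck)+
    then show ?thesis unfolding rP right_diff_distrib using \<kappa>(3) by (simp add: e1_def)
  qed
  have r0: "(LINT x|leb01. r x / a x) = 0" if "weakly_degenerate a"
    using that \<kappa>(2) L2_01_integrable[OF PL] L2_01_integrable[OF L2_01_continuous[OF ck]]
    unfolding rP by (simp add: e0_def)
  obtain v where v: "v \<in> domA a" "\<And>x. x \<in> {0..1} \<Longrightarrow> deriv2_01 v x = r x / a x"
    using domA_of_bump[OF deg r r1 r0] by blast
  let ?v = "\<lambda>x. sqrt (a x) * deriv2_01 v x" and ?P = "\<lambda>x. sqrt (a x) * P x" and ?z = "\<lambda>x. indicator {\<delta>..1 - \<delta>} x * w x"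
  have vL: "?v \<in> L2_01" using v(1) by (auto simp: domA_def intro: H2a0_sdD H2a0_sd)
  have PL': "?P \<in> L2_01" by (intro L2_01_continuous continuous_intros ca cP)
  have zL': "?z \<in> L2_01" by (rule L2_01_bounded_mult[OF wL im, of 1]) (simp add: indicator_def)
  \<comment> \<open>A uniform bound is expressed through \<open>dist2_bounded_mult\<close> by
    comparison with the constants 1 and 0, whose squared distance is 1.\<close>
  have d1: "dist2 ?v ?P \<le> (sqrt A * (C * (4 * \<eta>)))\<^sup>2 * dist2 (\<lambda>_. 1) (\<lambda>_. 0)"
  proof (rule dist2_bounded_mult)
    show "(\<lambda>_. 1) \<in> L2_01" "(\<lambda>_. 0) \<in> L2_01" by (intro L2_01_continuous continuous_intros)+
    fix x :: real assume "x \<in> {0<..<1}"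
    then have x: "x \<in> {0..1}" by auto
    have "\<bar>?v x - ?P x\<bar> = \<bar>sqrt (a x)\<bar> * \<bar>\<kappa> x / a x\<bar>"
      unfolding v(2)[OF x] rP by (simp add: algebra_simps abs_mult)
    also have "\<dots> \<le> sqrt A * (C * (4 * \<eta>))"
    proof (rule mult_mono[OF sA[OF x]])
      have "C * (\<bar>e0\<bar> + \<bar>e1\<bar>) \<le> C * (4 * \<eta>)" using e0 e1 C(1) by (intro mult_left_mono) auto
      then show "\<bar>\<kappa> x / a x\<bar> \<le> C * (4 * \<eta>)" using \<kappa>(4)[OF x] by linarith
    qed (use \<open>0 \<le> A\<close> in auto)
    finally show "\<bar>?v x - ?P x\<bar> \<le> sqrt A * (C * (4 * \<eta>)) * \<bar>1 - 0\<bar>" by simp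
  qed
  have "dist2 (\<lambda>_. 1) (\<lambda>_. 0) = 1" using measure_leb01 by (simp add: dist2_def)
  then have d1': "dist2 ?v ?P \<le> \<eta>\<^sup>2 * ((sqrt A)\<^sup>2 * (4 * C)\<^sup>2)"
    using d1 by (simp add: power_mult_distrib algebra_simps)
  have "dist2 ?P ?z \<le> (sqrt A)\<^sup>2 * dist2 P z"
  proof (rule dist2_bounded_mult[OF PL zL])
    fix x :: real assume "x \<in> {0<..<1}"
    then have x: "x \<in> {0..1}" by auto
    have "\<bar>?P x - ?z x\<bar> = \<bar>sqrt (a x)\<bar> * \<bar>P x - z x\<bar>"
      unfolding abs_mult[symmetric] by (simp add: z_def w_def algebra_simps)
    also have "\<dots> \<le> sqrt A * \<bar>P x - z x\<bar>" using sA[OF x] by (intro mult_right_mono) auto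
    finally show "\<bar>?P x - ?z x\<bar> \<le> sqrt A * \<bar>P x - z x\<bar>" .
  qed
  also have "\<dots> \<le> (sqrt A)\<^sup>2 * \<eta>\<^sup>2" using dPz by (intro mult_left_mono) auto
  finally have d2: "dist2 ?P ?z \<le> \<eta>\<^sup>2 * (sqrt A)\<^sup>2" by (simp add: mult.commute)
  have "\<eta>\<^sup>2 * Q = \<eta>\<^sup>2 * ((sqrt A)\<^sup>2 * (4 * C)\<^sup>2) + \<eta>\<^sup>2 * (sqrt A)\<^sup>2 + \<eta>\<^sup>2"
    by (simp add: Q_def algebra_simps)
  then have "dist2 ?v ?P + dist2 ?P ?z \<le> \<epsilon> / 16" using d1' d2 \<eta>(2) zero_le_power2[of \<eta>] by linarith
  moreover have "dist2 ?z w < \<epsilon> / 16" by (rule \<delta>0(2)[OF \<delta>(1,2)])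
  moreover have "dist2 ?v ?z \<le> 2 * dist2 ?v ?P + 2 * dist2 ?P ?z" by (rule dist2_triangle[OF vL PL' zL'])
  moreover have "dist2 ?v w \<le> 2 * dist2 ?v ?z + 2 * dist2 ?z w" by (rule dist2_triangle[OF vL zL' wL])
  ultimately have "dist2 ?v w < \<epsilon>" using \<open>0 < \<epsilon>\<close> by linarith
  then show thesis using that[OF v(1)] by (simp add: w_def)
qed

text \<open>The squared norm separates the components, so each is approximated within
  \<open>\<epsilon>^2 / 2\<close>; bumps lie in \<open>H2a0\<close>, which settles the
  second.\<close>

lemma dom_calA_dense:
  assumes deg: "weakly_degenerate a \<or> strongly_degenerate a" and U: "U \<in> H0 a" and "0 < \<epsilon>"
  shows "\<exists>U'\<in>dom_calA a. H0_norm a (state_diff U U') < \<epsilon>"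
proof -
  have "0 < \<epsilon>\<^sup>2 / 2" using \<open>0 < \<epsilon>\<close> by simp
  have "fst U \<in> H2a0 a" using U by (auto simp: H0_def)
  then obtain v where v: "v \<in> domA a"
    "dist2 (\<lambda>x. sqrt (a x) * deriv2_01 v x) (\<lambda>x. sqrt (a x) * deriv2_01 (fst U) x) < \<epsilon>\<^sup>2 / 2"
    using domA_approx[OF deg _ \<open>0 < \<epsilon>\<^sup>2 / 2\<close>] by blast
  obtain p where p: "bump p" "dist2 p (snd U) < \<epsilon>\<^sup>2 / 2"
    using bump_L2_dense[OF H0D(3)[OF U] \<open>0 < \<epsilon>\<^sup>2 / 2\<close>] by blast
  define U' where "U' = (v, p)"
  have dom: "U' \<in> dom_calA a" using v(1) bump_H2a0[OF deg p(1)] by (simp add: U'_def dom_calA_def)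
  note U'H = calA_H0(1)[OF dom]
  have AE: "AE x in leb01. bend a (state_diff U U') x * bend a (state_diff U U') x
      = (sqrt (a x) * deriv2_01 v x - sqrt (a x) * deriv2_01 (fst U) x)\<^sup>2"
    using AE_bend_lincomb[OF U U'H, of 1 "-1"]
  proof eventually_elim
    case (elim x)
    then have "bend a (state_diff U U') x = - (sqrt (a x) * deriv2_01 v x - sqrt (a x) * deriv2_01 (fst U) x)"
      by (simp add: bend_def U'_def state_diff_def)
    then show ?case by (simp only: power2_eq_square minus_mult_minus)
  qed
  have "ip a (state_diff U U') (state_diff U U') =
      dist2 (\<lambda>x. sqrt (a x) * deriv2_01 v x) (\<lambda>x. sqrt (a x) * deriv2_01 (fst U) x) + dist2 p (snd U)"
    unfolding ip_def dist2_def integral_leb01_cong_AE[OF AE]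
    by (simp add: state_diff_def lincomb_def U'_def power2_eq_square algebra_simps)
  then have "ip a (state_diff U U') (state_diff U U') < \<epsilon>\<^sup>2" using v(2) p(2) by simp
  then have "H0_norm a (state_diff U U') < \<epsilon>"
    unfolding H0_norm_ip[OF degenerate_pos[OF deg]] using \<open>0 < \<epsilon>\<close>
    by (metis real_sqrt_less_iff real_sqrt_pow2_iff real_sqrt_abs abs_of_pos)
  then show ?thesis using dom by blast
qed

section \<open>Energy of mild solutions\<close>

text \<open>\<open>\<approx>\<close> equates first components on the whole interval, so their second
  derivatives agree, while velocities need only agree almost everywhere under the integral.\<close>

lemma energy_H0_norm:
  assumes pos: "\<forall>x\<in>{0<..1}. a x > 0" and U: "U \<in> H0 a" and eq: "(y t, yt t) \<approx> U"
  shows "energy a y yt t = 1 / 2 * (H0_norm a U)\<^sup>2"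
proof -
  have "AE x in leb01. yt t x = snd U x" "AE x in leb01. x \<in> {0<..<1}"
    using eq by (auto simp: state_eq_def intro!: AE_I2)
  then have AE: "AE x in leb01. (yt t x)\<^sup>2 + a x * (deriv2_01 (y t) x)\<^sup>2 = snd U x * snd U x + bend a U x * bend a U x"
  proof eventually_elim
    case (elim x)
    have "deriv2_01 (y t) x = deriv2_01 (fst U) x"
      using eq elim(2) by (intro deriv2_01_cong) (auto simp: state_eq_def)
    moreover have "0 \<le> a x" using pos elim(2) by (auto intro: less_imp_le)
    ultimately show ?case using elim(1) by (simp add: bend_def power2_eq_square)
  qed
  have "energy a y yt t = 1 / 2 * (LINT x|leb01. snd U x * snd U x + bend a U x * bend a U x)"
    unfolding energy_def using integral_leb01_cong_AE[OF AE] by simp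
  also have "\<dots> = 1 / 2 * ip a U U"
    using L2_01_mult_integrable[OF H0D(2)[OF U] H0D(2)[OF U]] L2_01_mult_integrable[OF H0D(3)[OF U] H0D(3)[OF U]]
    by (simp add: ip_def)
  finally show ?thesis by (simp add: H0_norm_ip[OF pos] ip_nonneg)
qed

theorem theorem3p3:
  fixes a :: "real \<Rightarrow> real"
    and T :: "real \<Rightarrow> state \<Rightarrow> state"
    and y0 y1 :: "real \<Rightarrow> real"
    and y yt :: "real \<Rightarrow> real \<Rightarrow> real"
  assumes "weakly_degenerate a \<or> strongly_degenerate a"
    and "contraction_semigroup a T"
    and "generated_by_calA a T"
    and "(y0, y1) \<in> H0 a"
    and "mild_solution T y0 y1 y yt"
  shows "\<forall>t\<ge>0. energy a y yt t = energy a y yt 0"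
proof (intro allI impI)
  fix t :: real assume t: "0 \<le> t"
  interpret beam_semigroup a T
    by unfold_locales (use assms(1-3) degenerate_pos[OF assms(1)] in auto)
  have E: "energy a y yt s = 1 / 2 * (H0_norm a (T s (y0, y1)))\<^sup>2" if "0 \<le> s" for s
    using assms(4,5) that
    by (intro energy_H0_norm pos T_H0) (auto simp: mild_solution_def)
  have "H0_norm a (T s (y0, y1)) = H0_norm a (y0, y1)" if "0 \<le> s" for s
    by (rule norm_conserved[OF _ assms(4) that]) (rule dom_calA_dense[OF assms(1,4)])
  then show "energy a y yt t = energy a y yt 0" using t by (simp add: E)
qed

end
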